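(* Assume either $1<\alpha\le 3$ and $0<r_1<\infty$, or $\alpha>3$ and $r_1\in(0,\infty]$. Let $Y$ be a random compact subset of $\mathbb{R}^2$ such that $D(a_1)\subset Y\subset D(a_2)$ almost surely for some constants $0<a_1<a_2$, and $\nu(\partial Y)=0$ almost surely. Let $C_0=\{C_0(\mathbf{x}):\mathbf{x}\in\mathbb{R}^2\}$ be a real valued random field, and for $r_0\in(0,r_1)$ let $I(C_0,r_0,r_1)$ be the colored dead leaves model defined from $M(r_0,r_1)$ and $C_0$. Then there exists a random process $I(C_0,0,r_1)$ indexed by $\mathbb{R}^2$ such that, as $r_0\to0$, $$I(C_0,r_0,r_1)\to I(C_0,0,r_1)$$ in the sense of finite-dimensional distributions.
   Context: $\nu$ is Lebesgue measure on $\mathbb{R}^2$; $D(a)$ is the disk of radius $a$ centered at the origin; $\mathring A$ and $\partial A$ denote interior and topological boundary. A random closed (compact) set is a random element of the space of closed sets of $\mathbb{R}^2$ with the Borel $\sigma$-field of the Fell topology (a.s. compact). Dead leaves model associated with a random closed set $X$: let $\{(x_i,t_i)\}$ be a homogeneous Poisson point process of intensity one on $\mathbb{R}^2\times\mathbb{R}$ and $(X_i)$ i.i.d. copies of $X$, independent of it. Using only points with $t_i\le 0$, the visible parts are $V_i=(x_i+X_i)\setminus\bigcup_{t_j\in(t_i,0)}(x_j+\mathring X_j)$, $t_i\le 0$; the model is $M=\{V_i\}$, and $\partial M=\bigcup_i\partial V_i$. $M(r_0,r_1)$ denotes the dead leaves model associated with $X=RY$, where $R$ is a real random variable independent of $Y$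 with probability density proportional to $r^{-\alpha}\mathbf{1}(r_0\le r\le r_1)$. Colored dead leaves model $I(C_0,r_0,r_1)$: let $(C_i)_i$ be independent copies of the field $C_0$, independent of $M(r_0,r_1)=\{V_i\}$. For $\mathbf{x}\notin\partial M(r_0,r_1)$ let $i(\mathbf{x})$ be the (a.s.) unique index with $\mathbf{x}\in\mathring V_{i(\mathbf{x})}$. Then $I(C_0,r_0,r_1)(\mathbf{x})=C_{i(\mathbf{x})}(\mathbf{x})$ if $\mathbf{x}\notin\partial M(r_0,r_1)$ and $0$ if $\mathbf{x}\in\partial M(r_0,r_1)$. Convergence in the sense of finite-dimensional distributions means convergence in distribution of the vectors of values at any finite set of points. *)

theory Defs
  imports "HOL-Probability.Probability"
begin

section \<open>Random closed sets\<close>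

definition fell_topology :: "'a::topological_space set topology" where
  "fell_topology = topology_generated_by
     ({{F. closed F \<and> F \<inter> K = {}} |K. compact K} \<union>
      {{F. closed F \<and> F \<inter> G \<noteq> {}} |G. open G})"

lemma topspace_fell_topology: "topspace fell_topology = {F. closed F}"
proof -
  have "{F::'a set. closed F} \<in> {{F. closed F \<and> F \<inter> K = {}} |K. compact K}"
    by (rule CollectI, rule exI[of _ "{}"]) auto
  then show ?thesis
    unfolding fell_topology_def topology_generated_by_topspace by auto
qed

definition fell_borel :: "'a::topological_space set measure" where
  "fell_borel = sigma (topspace fell_topology) {U. openin fell_topology U}"

lemma space_fell_borel: "space fell_borel = {F. closed F}"
  by (simp add: fell_borel_def topspace_fell_topology space_measure_of_conv)

definition random_compact_set :: "'w measure \<Rightarrow> ('w \<Rightarrow> 'a::topological_space set) \<Rightarrow> bool" where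
  "random_compact_set P Y \<longleftrightarrow>
     prob_space P \<and> Y \<in> measurable P fell_borel \<and> (AE w in P. compact (Y w))"

text \<open>The library's \<open>indep_var\<close> requires both variables to have the same type.\<close>

definition indep_rv ::
  "'w measure \<Rightarrow> 'b measure \<Rightarrow> ('w \<Rightarrow> 'b) \<Rightarrow> 'c measure \<Rightarrow> ('w \<Rightarrow> 'c) \<Rightarrow> bool" where
  "indep_rv P S A T B \<longleftrightarrow>
     A \<in> measurable P S \<and> B \<in> measurable P T \<and>
     prob_space.indep_set P (sets (vimage_algebra (space P) A S))
       (sets (vimage_algebra (space P) B T))"

section \<open>The dead leaves model\<close>

text \<open>A point process is given by a measurable enumeration of its points. The sets of infinite
  Lebesgue measure need no clause of their own: their counts are limits of finite ones.
  Counting indices means counting points with multiplicity.\<close>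

definition npoints :: "(nat \<Rightarrow> 'w \<Rightarrow> 'e) \<Rightarrow> 'e set \<Rightarrow> 'w \<Rightarrow> nat" where
  "npoints p B w = card {i. p i w \<in> B}"

definition poisson_process :: "'w measure \<Rightarrow> (nat \<Rightarrow> 'w \<Rightarrow> 'e::euclidean_space) \<Rightarrow> bool" where
  "poisson_process \<Omega> p \<longleftrightarrow>
     prob_space \<Omega> \<and>
     (\<forall>i. p i \<in> borel_measurable \<Omega>) \<and>
     (\<forall>B\<in>sets borel. emeasure lborel B < \<infinity> \<longrightarrow>
        (AE w in \<Omega>. finite {i. p i w \<in> B}) \<and>
        (\<forall>k. measure \<Omega> {w \<in> space \<Omega>. npoints p B w = k} =
               measure lborel B ^ k / fact k * exp (- measure lborel B))) \<and>
     (\<forall>(J::nat set) B. finite J \<longrightarrow> disjoint_family_on B J \<longrightarrow>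
        (\<forall>j\<in>J. B j \<in> sets borel \<and> emeasure lborel (B j) < \<infinity>) \<longrightarrow>
        prob_space.indep_vars \<Omega> (\<lambda>_. count_space UNIV) (\<lambda>j. npoints p (B j)) J)"

text \<open>The point \<open>p i w = (x, t)\<close> has position \<open>x\<close> and time \<open>t\<close>; \<open>X i\<close> is the leaf attached to it.
  Here \<open>L\<close> is the law of the typical leaf.\<close>

definition marked_leaves ::
  "'w measure \<Rightarrow> (real^2) set measure \<Rightarrow> (nat \<Rightarrow> 'w \<Rightarrow> (real^2) \<times> real) \<Rightarrow>
     (nat \<Rightarrow> 'w \<Rightarrow> (real^2) set) \<Rightarrow> bool" where
  "marked_leaves \<Omega> L p X \<longleftrightarrow>
     poisson_process \<Omega> p \<and>
     prob_space.indep_vars \<Omega> (\<lambda>_. fell_borel) X UNIV \<and>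
     (\<forall>i. distr \<Omega> fell_borel (X i) = L) \<and>
     indep_rv \<Omega> (Pi\<^sub>M UNIV (\<lambda>_. borel)) (\<lambda>w i. p i w)
       (Pi\<^sub>M UNIV (\<lambda>_. fell_borel)) (\<lambda>w i. X i w)"

text \<open>Points with positive time carry no visible part; they are kept in the enumeration with an
  empty one, which contributes neither interior nor boundary points.\<close>

definition visible_part ::
  "(nat \<Rightarrow> 'w \<Rightarrow> (real^2) \<times> real) \<Rightarrow> (nat \<Rightarrow> 'w \<Rightarrow> (real^2) set) \<Rightarrow> nat \<Rightarrow> 'w \<Rightarrow> (real^2) set" where
  "visible_part p X i w =
     (if snd (p i w) \<le> 0
      then (+) (fst (p i w)) ` X i w -
        (\<Union>j\<in>{j. snd (p j w) \<in> {snd (p i w)<..<0}}. (+) (fst (p j w)) ` interior (X j w))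
      else {})"

definition model_boundary :: "(nat \<Rightarrow> 'w \<Rightarrow> (real^2) set) \<Rightarrow> 'w \<Rightarrow> (real^2) set" where
  "model_boundary V w = (\<Union>i. frontier (V i w))"

definition power_law_radius :: "'p measure \<Rightarrow> real \<Rightarrow> real \<Rightarrow> ereal \<Rightarrow> ('p \<Rightarrow> real) \<Rightarrow> bool" where
  "power_law_radius P \<alpha> r0 r1 R \<longleftrightarrow>
     (\<exists>c>0. distributed P lborel R
        (\<lambda>r. ennreal (c * r powr (-\<alpha>) * indicator {r. r0 \<le> r \<and> ereal r \<le> r1} r)))"

section \<open>Random fields and the colored dead leaves model\<close>

definition random_field :: "'w measure \<Rightarrow> ('s \<Rightarrow> 'w \<Rightarrow> real) \<Rightarrow> bool" where
  "random_field \<Omega> Z \<longleftrightarrow> prob_space \<Omega> \<and> (\<forall>x. Z x \<in> borel_measurable \<Omega>)"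

definition field_law :: "'w measure \<Rightarrow> ('s \<Rightarrow> 'w \<Rightarrow> real) \<Rightarrow> ('s \<Rightarrow> real) measure" where
  "field_law \<Omega> Z = distr \<Omega> (Pi\<^sub>M UNIV (\<lambda>_. borel)) (\<lambda>w x. Z x w)"

definition color_copies ::
  "'w measure \<Rightarrow> ((real^2) \<Rightarrow> real) measure \<Rightarrow> (nat \<Rightarrow> 'w \<Rightarrow> (real^2) set) \<Rightarrow>
     (nat \<Rightarrow> (real^2) \<Rightarrow> 'w \<Rightarrow> real) \<Rightarrow> bool" where
  "color_copies \<Omega> L V C \<longleftrightarrow>
     prob_space.indep_vars \<Omega> (\<lambda>_. Pi\<^sub>M UNIV (\<lambda>_. borel)) (\<lambda>i w x. C i x w) UNIV \<and>
     (\<forall>i. field_law \<Omega> (C i) = L) \<and>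
     indep_rv \<Omega> (Pi\<^sub>M UNIV (\<lambda>_. fell_borel)) (\<lambda>w i. V i w)
       (Pi\<^sub>M UNIV (\<lambda>_. Pi\<^sub>M UNIV (\<lambda>_. borel))) (\<lambda>w i x. C i x w)"

text \<open>The index is almost surely unique. \<open>LEAST\<close> rather than \<open>THE\<close> only makes the choice measurable
  on the null event where uniqueness fails.\<close>

definition visible_index :: "(nat \<Rightarrow> 'w \<Rightarrow> (real^2) set) \<Rightarrow> (real^2) \<Rightarrow> 'w \<Rightarrow> nat" where
  "visible_index V x w = (LEAST i. x \<in> interior (V i w))"

definition colored_dead_leaves ::
  "(nat \<Rightarrow> 'w \<Rightarrow> (real^2) set) \<Rightarrow> (nat \<Rightarrow> (real^2) \<Rightarrow> 'w \<Rightarrow> real) \<Rightarrow> (real^2) \<Rightarrow> 'w \<Rightarrow> real" where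
  "colored_dead_leaves V C x w =
     (if x \<in> model_boundary V w then 0 else C (visible_index V x w) x w)"

text \<open>Weak convergence of the random vectors indexed by a finite set \<open>S\<close> is tested against bounded
  continuous functions on \<open>\<real>\<close> to the power \<open>S\<close>. The fields may live on different probability spaces.\<close>

definition fdd_converges ::
  "('r \<Rightarrow> 'w measure) \<Rightarrow> ('r \<Rightarrow> 's \<Rightarrow> 'w \<Rightarrow> real) \<Rightarrow> 'v measure \<Rightarrow> ('s \<Rightarrow> 'v \<Rightarrow> real) \<Rightarrow>
     'r filter \<Rightarrow> bool" where
  "fdd_converges \<Omega> Z \<Omega>' Z' F \<longleftrightarrow>
     (\<forall>\<^sub>F r in F. random_field (\<Omega> r) (Z r)) \<and> random_field \<Omega>' Z' \<and>
     (\<forall>S f. finite S \<longrightarrow> continuous_map (powertop_real S) euclideanreal f \<longrightarrow>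
        bounded (f ` topspace (powertop_real S)) \<longrightarrow>
        ((\<lambda>r. \<integral>w. f (\<lambda>x\<in>S. Z r x w) \<partial>\<Omega> r) \<longlongrightarrow> (\<integral>w. f (\<lambda>x\<in>S. Z' x w) \<partial>\<Omega>')) F)"

end

theory Submission
  imports Defs
begin

text \<open>
  Given the leaves, the values of the colored model at the points of a finite set \<open>S\<close> depend only on
  the partition of \<open>S\<close> into the points that see the same leaf: different blocks are colored
  independently, and the points of one block by a single copy of \<open>C0\<close>. So it suffices that the law of
  this partition converges as \<open>r0\<close> tends to 0; the limits are then the marginals of a process by
  Kolmogorov's theorem.

  Call the set of points of \<open>U \<subseteq> S\<close> covered by a leaf its trace on \<open>U\<close>. The most recent leaf that hits
  \<open>U\<close> has trace \<open>D\<close> with probability \<open>m D / (\<Sum>D'. m D')\<close>, where \<open>m D\<close> is the intensity of the leaves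
  with trace \<open>D\<close>; then \<open>D\<close> is a block, and the partition of \<open>U - D\<close> is produced by the older leaves.
  Thus the law of the partition is a rational function of the ratios of the intensities. Up to a
  common normalizing factor, \<open>m D\<close> does not depend on a small \<open>r0\<close> when \<open>D\<close> has at least two points, as
  small leaves cannot cover both, and is a constant plus \<open>u r0\<close> when \<open>D\<close> is a single point, with the
  same monotone \<open>u\<close> for every point. Hence the ratios converge, whether \<open>u\<close> stays bounded or not.

  The recursion for the partition uses only void probabilities: the probability that no leaf belongs to
  a given set of marked points is the exponential of minus the intensity of that set.
\<close>

text \<open>The models for different \<open>r0\<close> live on unrelated probability spaces, so
  nothing can be compared pathwise and only laws can converge. Nor can one simply take the most
  recent leaf: a Poisson process is given here by an arbitrary enumeration of its points, with
  counts specified on sets of finite volume only, and the leaves that miss \<open>S\<close> have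
  infinite intensity in every time interval of positive length. The argument therefore stays with
  void events for the leaves that hit \<open>S\<close>, cuts off one thin slice of time, and reads
  the weights of the recursion off the derivative at slice length 0. Removing a slice moves the time
  of observation, so the partition is considered as seen from every time \<open>c\<close>; that its
  law is the same for all \<open>c\<close> is an outcome of the argument and not an input. Visible
  parts are defined with interiors, boundaries and indices; these are reduced to the times and
  traces of leaves on an almost sure event, where no leaf has a point of \<open>S\<close> on its
  frontier and no leaf covering two points ties in time with one separating them. No asymptotics in
  \<alpha> are computed: monotonicity of \<open>u\<close> suffices.\<close>

section \<open>Measurability for the Fell topology\<close>

lemma sets_countable_UNI:
  assumes "countable I" "\<And>i. i \<in> I \<Longrightarrow> A i \<in> sets M"
  shows "(\<Union>i\<in>I. A i) \<in> sets M"
  using assms by (intro sets.countable_UN'') auto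

text \<open>One fixed countable dense set. The balls around its points of radius
  \<open>1 / Suc n\<close> act as a countable base of the space, so that events become countable
  unions and intersections.\<close>

definition dense_points :: "'a::euclidean_space set" where
  "dense_points = (SOME D. countable D \<and> (\<forall>x. \<forall>e>0. \<exists>d\<in>D. dist x d < e))"

lemma countable_dense_points: "countable (dense_points :: 'a::euclidean_space set)"
  and dense_points_near: "0 < e \<Longrightarrow> \<exists>d\<in>dense_points. dist x d < e" for x :: "'a::euclidean_space"
proof -
  obtain D :: "'a set" where D: "countable D" "\<And>X. open X \<Longrightarrow> X \<noteq> {} \<Longrightarrow> \<exists>d\<in>D. d \<in> X"
    using countable_dense_setE by metis
  have "\<exists>d\<in>D. dist x d < e" if "0 < e" for x e
    using D(2)[of "ball x e"] that by auto
  with D(1) have "\<exists>D::'a set. countable D \<and> (\<forall>x. \<forall>e>0. \<exists>d\<in>D. dist x d < e)" by blast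
  from someI_ex[OF this]
  have *: "countable (dense_points::'a set)" "\<forall>x::'a. \<forall>e>0. \<exists>d\<in>dense_points. dist x d < e"
    unfolding dense_points_def by auto
  show "countable (dense_points::'a set)" by (rule *)
  show "0 < e \<Longrightarrow> \<exists>d\<in>dense_points. dist x d < e" for x :: 'a
    using *(2) by blast
qed

lemma dense_ball_inside:
  fixes x :: "'a::euclidean_space"
  assumes "open G" "x \<in> G"
  obtains d n where "d \<in> dense_points" "x \<in> ball d (1 / Suc n)" "cball d (1 / Suc n) \<subseteq> G"
proof -
  obtain e where e: "e > 0" "cball x e \<subseteq> G" using assms open_contains_cball by blast
  obtain n where n: "1 / real (Suc n) < e / 2" using nat_approx_posE[of "e/2"] e(1) by auto
  obtain d where d: "d \<in> dense_points" "dist x d < 1 / Suc n"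
    using dense_points_near[of "1 / Suc n" x] by auto
  have "cball d (1 / Suc n) \<subseteq> G"
  proof
    fix z assume "z \<in> cball d (1 / Suc n)"
    then have "dist x z \<le> 1 / Suc n + 1 / Suc n"
      using d dist_triangle[of x z d] by (simp add: dist_commute)
    then show "z \<in> G" using n e by auto
  qed
  with d that show thesis by (auto simp: dist_commute)
qed

lemma openin_fell_topology: "openin fell_topology U \<longleftrightarrow> generate_topology_on
     ({{F. closed F \<and> F \<inter> K = {}} |K. compact K} \<union> {{F. closed F \<and> F \<inter> G \<noteq> {}} |G. open G}) U"
  by (simp add: fell_topology_def openin_topology_generated_by_iff)

lemma openin_fell_closed: "openin fell_topology U \<Longrightarrow> U \<subseteq> {F. closed F}"
  using openin_subset topspace_fell_topology by metis

lemma sets_fell_borel: "sets fell_borel = sigma_sets {F. closed F} {U. openin fell_topology U}"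
  unfolding fell_borel_def topspace_fell_topology
  by (rule sets_measure_of) (use openin_fell_closed in auto)

lemma openin_fell_sets: "openin fell_topology U \<Longrightarrow> U \<in> sets fell_borel"
  by (simp add: sets_fell_borel sigma_sets.Basic)

lemma fell_hit_sets: "open G \<Longrightarrow> {F. closed F \<and> F \<inter> G \<noteq> {}} \<in> sets fell_borel"
  by (rule openin_fell_sets) (auto simp: openin_fell_topology intro!: generate_topology_on.Basis)

text \<open>Misses use closed balls, which are compact, and hits use open ones, so for finite
  \<open>A\<close> and \<open>B\<close> these sets are open in the Fell topology. With balls from
  the countable family they form a countable base.\<close>

definition fell_base ::
  "('a::euclidean_space \<times> nat) set \<Rightarrow> ('a \<times> nat) set \<Rightarrow> 'a set set" where
  "fell_base A B = {F. closed F \<and> (\<forall>(d, n)\<in>A. F \<inter> cball d (1 / Suc n) = {}) \<and>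
     (\<forall>(d, n)\<in>B. F \<inter> ball d (1 / Suc n) \<noteq> {})}"

text \<open>Induction over the generation of the topology. If a closed \<open>F\<close> misses a
  compact \<open>K\<close>, finitely many small balls cover \<open>K\<close> while their closures
  still miss \<open>F\<close>; if \<open>F\<close> meets an open \<open>G\<close>, a small ball
  around a common point lies in \<open>G\<close>.\<close>

lemma fell_base_refines:
  fixes F :: "'a::euclidean_space set"
  assumes "openin fell_topology U" "F \<in> U"
  shows "\<exists>A B. finite A \<and> finite B \<and> A \<subseteq> dense_points \<times> UNIV \<and> B \<subseteq> dense_points \<times> UNIV \<and>
    F \<in> fell_base A B \<and> fell_base A B \<subseteq> U"
  using assms unfolding openin_fell_topology
proof (induction U arbitrary: F rule: generate_topology_on.induct)
  case Empty
  then show ?case by simp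
next
  case (Int a b)
  obtain A B where 1: "finite A" "finite B" "A \<subseteq> dense_points \<times> UNIV" "B \<subseteq> dense_points \<times> UNIV"
    "F \<in> fell_base A B" "fell_base A B \<subseteq> a" using Int.IH(1)[of F] Int.prems by auto
  obtain A' B' where 2: "finite A'" "finite B'" "A' \<subseteq> dense_points \<times> UNIV" "B' \<subseteq> dense_points \<times> UNIV"
    "F \<in> fell_base A' B'" "fell_base A' B' \<subseteq> b" using Int.IH(2)[of F] Int.prems by auto
  have "fell_base (A \<union> A') (B \<union> B') = fell_base A B \<inter> fell_base A' B'"
    unfolding fell_base_def by (auto simp: ball_Un)
  then show ?case using 1 2
    by (intro exI[of _ "A \<union> A'"] exI[of _ "B \<union> B'"]) auto
next
  case (UN K)
  then show ?case by (meson Sup_upper UnionE subset_trans)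
next
  case (Basis s)
  then consider (miss) K where "compact K" "s = {F. closed F \<and> F \<inter> K = {}}"
    | (hit) G where "open G" "s = {F. closed F \<and> F \<inter> G \<noteq> {}}" by blast
  then show ?case
  proof cases
    case miss
    with Basis have F: "closed F" "F \<inter> K = {}" by auto
    define \<C> where "\<C> = {(d, n). d \<in> dense_points \<and> cball d (1 / Suc n) \<subseteq> - F}"
    have "K \<subseteq> (\<Union>c\<in>\<C>. ball (fst c) (1 / Suc (snd c)))"
    proof
      fix x assume "x \<in> K"
      then have "x \<in> - F" using F by auto
      from dense_ball_inside[OF _ this] F(1) obtain d n where "d \<in> dense_points" "x \<in> ball d (1 / Suc n)"
        "cball d (1 / Suc n) \<subseteq> - F" by (auto simp: open_Compl)
      then show "x \<in> (\<Union>c\<in>\<C>. ball (fst c) (1 / Suc (snd c)))"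
        unfolding \<C>_def by (intro UN_I[of "(d, n)"]) auto
    qed
    then obtain \<D> where D: "\<D> \<subseteq> \<C>" "finite \<D>" "K \<subseteq> (\<Union>c\<in>\<D>. ball (fst c) (1 / Suc (snd c)))"
      using compactE_image[OF miss(1), of \<C> "\<lambda>c. ball (fst c) (1 / Suc (snd c))"] by auto
    have "fell_base \<D> {} \<subseteq> s"
    proof
      fix F' assume F': "F' \<in> fell_base \<D> {}"
      have "x \<notin> K" if "x \<in> F'" for x
      proof
        assume "x \<in> K"
        then obtain c where c: "c \<in> \<D>" "x \<in> ball (fst c) (1 / Suc (snd c))" using D by blast
        moreover have "\<forall>(d, n)\<in>\<D>. F' \<inter> cball d (1 / Suc n) = {}" using F' by (simp add: fell_base_def)
        ultimately have "F' \<inter> cball (fst c) (1 / Suc (snd c)) = {}" by (auto simp: case_prod_unfold)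
        then show False using c that by (auto simp: disjoint_iff)
      qed
      then show "F' \<in> s" using F' unfolding miss fell_base_def by auto
    qed
    moreover have "F \<in> fell_base \<D> {}"
      using D(1) F unfolding \<C>_def fell_base_def by fastforce
    ultimately show ?thesis using D unfolding \<C>_def
      by (intro exI[of _ \<D>] exI[of _ "{}"]) auto
  next
    case hit
    with Basis obtain x where x: "closed F" "x \<in> F" "x \<in> G" by auto
    from dense_ball_inside[OF hit(1) x(3)] obtain d n where dn: "d \<in> dense_points" "x \<in> ball d (1 / Suc n)"
      "cball d (1 / Suc n) \<subseteq> G" by blast
    then have "fell_base {} {(d, n)} \<subseteq> s"
      unfolding hit fell_base_def using ball_subset_cball by fastforce
    moreover have "F \<in> fell_base {} {(d, n)}" using x dn unfolding fell_base_def by auto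
    ultimately show ?thesis using dn by (intro exI[of _ "{}"] exI[of _ "{(d, n)}"]) auto
  qed
qed

text \<open>Hitting events of open sets control the whole Fell sigma-algebra: they yield the missing
  events of compact sets, and every Fell open set is a countable union of \<open>fell_base\<close>
  sets.\<close>

lemma measurable_fell_borelI:
  fixes f :: "'b \<Rightarrow> 'a::euclidean_space set"
  assumes closed: "\<And>w. w \<in> space M \<Longrightarrow> closed (f w)"
    and hit: "\<And>G. open G \<Longrightarrow> {w \<in> space M. f w \<inter> G \<noteq> {}} \<in> sets M"
  shows "f \<in> measurable M fell_borel"
proof -
  have miss: "{w \<in> space M. f w \<inter> K = {}} \<in> sets M" if K: "compact K" for K
  proof -
    let ?N = "\<lambda>n. \<Union>k\<in>K. ball k (1 / real (Suc n))"
    \<comment> \<open>A compact set disjoint from a closed one has positive distance from it, so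
      missing \<open>K\<close> means missing one of its open neighbourhoods
      \<open>?N n\<close>.\<close>
    have "{w \<in> space M. f w \<inter> K = {}} = (\<Union>n. space M - {w \<in> space M. f w \<inter> ?N n \<noteq> {}})"
    proof (intro equalityI subsetI)
      fix w assume w: "w \<in> {w \<in> space M. f w \<inter> K = {}}"
      then obtain e where e: "e > 0" "\<And>x y. x \<in> K \<Longrightarrow> y \<in> f w \<Longrightarrow> e \<le> dist x y"
        using separate_compact_closed[OF K, of "f w"] closed by (auto simp: Int_commute)
      obtain n where n: "1 / real (Suc n) < e" using nat_approx_posE[OF e(1)] by auto
      have "f w \<inter> ?N n = {}"
      proof (rule equals0I)
        fix z assume "z \<in> f w \<inter> ?N n"
        then obtain k where "k \<in> K" "z \<in> f w" "dist k z < 1 / Suc n" by auto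
        then show False using e(2)[of k z] n by simp
      qed
      then show "w \<in> (\<Union>n. space M - {w \<in> space M. f w \<inter> ?N n \<noteq> {}})" using w by blast
    next
      fix w assume "w \<in> (\<Union>n. space M - {w \<in> space M. f w \<inter> ?N n \<noteq> {}})"
      then obtain n where n: "w \<in> space M" "f w \<inter> ?N n = {}" by blast
      have "K \<subseteq> ?N n" by (auto intro!: bexI)
      then show "w \<in> {w \<in> space M. f w \<inter> K = {}}" using n by blast
    qed
    then show ?thesis
      by (simp only:) (intro sets_countable_UNI countableI_type sets.Diff sets.top hit open_UN ballI open_ball)
  qed
  have base: "{w \<in> space M. f w \<in> fell_base A B} \<in> sets M" if "finite A" "finite B" for A B
  proof -
    have "{w \<in> space M. f w \<in> fell_base A B} =
      {w \<in> space M. \<forall>c\<in>A. f w \<inter> cball (fst c) (1 / Suc (snd c)) = {}} \<inter>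
      {w \<in> space M. \<forall>c\<in>B. f w \<inter> ball (fst c) (1 / Suc (snd c)) \<noteq> {}}"
      unfolding fell_base_def case_prod_unfold using closed by blast
    also have "\<dots> \<in> sets M"
      using that by (intro sets.Int sets.sets_Collect_finite_All' sets.sets_Collect_finite_All miss hit) auto
    finally show ?thesis .
  qed
  show ?thesis
    unfolding measurable_def
  proof (intro CollectI conjI ballI)
    show "f \<in> space M \<rightarrow> space fell_borel" using closed by (auto simp: space_fell_borel)
    have "f \<in> measurable M (sigma {F. closed F} {U. openin fell_topology U})"
    proof (rule measurable_measure_of)
      show "{U. openin fell_topology U} \<subseteq> Pow {F. closed F}" using openin_fell_closed by auto
      show "f \<in> space M \<rightarrow> {F. closed F}" using closed by auto
      fix U :: "'a set set" assume "U \<in> {U. openin fell_topology U}"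
      then have U: "openin fell_topology U" by simp
      define I where "I = {(A, B). finite A \<and> finite B \<and> A \<subseteq> dense_points \<times> (UNIV::nat set) \<and>
         B \<subseteq> dense_points \<times> (UNIV::nat set) \<and> fell_base A B \<subseteq> U}"
      define \<A> where "\<A> = {A. A \<subseteq> (dense_points::'a set) \<times> (UNIV::nat set) \<and> finite A}"
      have "countable \<A>"
        using countable_Collect_finite_subset[of "(dense_points::'a set) \<times> (UNIV::nat set)"]
          countable_dense_points by (auto simp: \<A>_def conj_commute)
      then have "countable (\<A> \<times> \<A>)" by auto
      moreover have "I \<subseteq> \<A> \<times> \<A>" by (auto simp: I_def \<A>_def)
      ultimately have "countable I" by (rule countable_subset[rotated])
      have "U = (\<Union>(A, B)\<in>I. fell_base A B)"
      proof
        show "U \<subseteq> (\<Union>(A, B)\<in>I. fell_base A B)"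
        proof
          fix F assume "F \<in> U"
          from fell_base_refines[OF U this] obtain A B where
            "(A, B) \<in> I" "F \<in> fell_base A B" unfolding I_def by auto
          then show "F \<in> (\<Union>(A, B)\<in>I. fell_base A B)" by blast
        qed
      qed (auto simp: I_def)
      then have "f -` U \<inter> space M = (\<Union>(A, B)\<in>I. {w \<in> space M. f w \<in> fell_base A B})" by auto
      also have "\<dots> \<in> sets M"
        using \<open>countable I\<close> by (intro sets_countable_UNI) (auto simp: I_def intro!: base)
      finally show "f -` U \<inter> space M \<in> sets M" .
    qed
    then have m: "f \<in> measurable M fell_borel" unfolding fell_borel_def topspace_fell_topology .
    show "f -` y \<inter> space M \<in> sets M" if "y \<in> sets fell_borel" for y
      using measurable_sets[OF m that] .
  qed
qed

lemma fell_closed: "F \<in> measurable M fell_borel \<Longrightarrow> w \<in> space M \<Longrightarrow> closed (F w)"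
  using measurable_space[of F M fell_borel w] by (simp add: space_fell_borel)

lemma sets_fell_hit_open:
  assumes F: "F \<in> measurable M fell_borel" and G: "open G"
  shows "{w \<in> space M. F w \<inter> G \<noteq> {}} \<in> sets M"
proof -
  have "{w \<in> space M. F w \<inter> G \<noteq> {}} = F -` {F. closed F \<and> F \<inter> G \<noteq> {}} \<inter> space M"
    using fell_closed[OF F] by auto
  then show ?thesis using measurable_sets[OF F fell_hit_sets[OF G]] by simp
qed

text \<open>The centre moves with \<open>w\<close>, so the ball is exhausted by fixed small balls
  around dense points that lie in it with room to spare.\<close>

lemma sets_fell_hit_ball:
  fixes y :: "'b \<Rightarrow> 'a::euclidean_space"
  assumes F: "F \<in> measurable M fell_borel" and y[measurable]: "y \<in> borel_measurable M"
  shows "{w \<in> space M. F w \<inter> ball (y w) e \<noteq> {}} \<in> sets M"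
proof -
  have "{w \<in> space M. F w \<inter> ball (y w) e \<noteq> {}} =
    (\<Union>d\<in>dense_points. \<Union>n. {w \<in> space M. F w \<inter> ball d (1 / Suc n) \<noteq> {}} \<inter>
       {w \<in> space M. dist (y w) d + 1 / Suc n < e})" (is "?L = ?R")
  proof (intro equalityI subsetI)
    fix w assume "w \<in> ?L"
    then obtain z where w: "w \<in> space M" "z \<in> F w" "dist (y w) z < e" by auto
    obtain n where n: "1 / real (Suc n) < (e - dist (y w) z) / 2"
      using nat_approx_posE[of "(e - dist (y w) z) / 2"] w(3) by auto
    obtain d where d: "d \<in> dense_points" "dist z d < 1 / Suc n"
      using dense_points_near[of "1 / Suc n" z] by auto
    have "dist (y w) d + 1 / Suc n < e"
      using dist_triangle[of "y w" d z] d n by (simp only: less_divide_eq_numeral1)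
    moreover have "z \<in> F w \<inter> ball d (1 / Suc n)" using d w by (auto simp: dist_commute)
    ultimately show "w \<in> ?R" using d w by blast
  next
    fix w assume "w \<in> ?R"
    then obtain d n z where w: "w \<in> space M" "z \<in> F w" "dist d z < 1 / Suc n"
      "dist (y w) d + 1 / Suc n < e" by auto
    then have "z \<in> ball (y w) e" using dist_triangle[of "y w" z d] by auto
    then show "w \<in> ?L" using w by blast
  qed
  also have "\<dots> \<in> sets M"
    by (intro sets_countable_UNI countable_dense_points countableI_type sets.Int sets_fell_hit_open[OF F]) auto
  finally show ?thesis .
qed

lemma sets_fell_mem:
  fixes y :: "'b \<Rightarrow> 'a::euclidean_space"
  assumes F: "F \<in> measurable M fell_borel" and y: "y \<in> borel_measurable M"
  shows "{w \<in> space M. y w \<in> F w} \<in> sets M"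
proof -
  have "{w \<in> space M. y w \<in> F w} = (\<Inter>n. {w \<in> space M. F w \<inter> ball (y w) (1 / Suc n) \<noteq> {}})"
  proof (intro equalityI subsetI)
    fix w assume w: "w \<in> (\<Inter>n. {w \<in> space M. F w \<inter> ball (y w) (1 / Suc n) \<noteq> {}})"
    then have "w \<in> space M" by auto
    have "y w \<in> closure (F w)"
      unfolding closure_approachable
    proof (intro allI impI)
      fix e :: real assume "0 < e"
      then obtain n where n: "1 / real (Suc n) < e" using nat_approx_posE by blast
      obtain z where "z \<in> F w" "dist (y w) z < 1 / Suc n" using w by fastforce
      then show "\<exists>z\<in>F w. dist z (y w) < e" using n by (auto simp: dist_commute intro!: bexI[of _ z])
    qed
    then show "w \<in> {w \<in> space M. y w \<in> F w}" using fell_closed[OF F] \<open>w \<in> space M\<close> by auto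
  qed (auto simp: disjoint_iff intro!: exI)
  also have "\<dots> \<in> sets M" using sets_fell_hit_ball[OF F y] by auto
  finally show ?thesis .
qed

text \<open>A closed set contains a ball as soon as it contains the dense points of that ball. So
  being interior reduces to countably many membership conditions.\<close>

lemma sets_fell_interior:
  fixes y :: "'b \<Rightarrow> 'a::euclidean_space"
  assumes F: "F \<in> measurable M fell_borel" and y[measurable]: "y \<in> borel_measurable M"
  shows "{w \<in> space M. y w \<in> interior (F w)} \<in> sets M"
proof -
  have sub: "ball d r \<subseteq> F w" if "w \<in> space M" "\<forall>d'\<in>dense_points \<inter> ball d r. d' \<in> F w" for d r w
  proof
    fix x assume x: "x \<in> ball d r"
    have "x \<in> closure (F w)"
      unfolding closure_approachable
    proof (intro allI impI)
      fix e :: real assume "0 < e"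
      then obtain d' where d': "d' \<in> dense_points" "dist x d' < min e (r - dist d x)"
        using dense_points_near[of "min e (r - dist d x)" x] x by auto
      then have "d' \<in> ball d r" using dist_triangle[of d d' x] by auto
      with d' that(2) show "\<exists>y\<in>F w. dist y x < e" by (auto simp: dist_commute intro!: bexI[of _ d'])
    qed
    then show "x \<in> F w" using fell_closed[OF F that(1)] by simp
  qed
  have "{w \<in> space M. y w \<in> interior (F w)} = (\<Union>d\<in>dense_points. \<Union>n.
     {w \<in> space M. dist d (y w) < 1 / Suc n} \<inter>
       {w \<in> space M. \<forall>d'\<in>dense_points \<inter> ball d (1 / Suc n). d' \<in> F w})" (is "?L = ?R")
  proof (intro equalityI subsetI)
    fix w assume w: "w \<in> ?L"
    obtain d n where "d \<in> dense_points" "y w \<in> ball d (1 / Suc n)" "cball d (1 / Suc n) \<subseteq> interior (F w)"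
      using dense_ball_inside[of "interior (F w)" "y w"] w by auto
    moreover have "d' \<in> F w" if "d' \<in> ball d (1 / Suc n)" for d'
      using calculation(3) that interior_subset by (meson ball_subset_cball subsetD)
    moreover have "dist d (y w) < 1 / Suc n" using calculation(2) by simp
    ultimately show "w \<in> ?R" using w by blast
  next
    fix w assume "w \<in> ?R"
    then obtain d n where w: "w \<in> space M" "dist d (y w) < 1 / Suc n"
      "\<forall>d'\<in>dense_points \<inter> ball d (1 / Suc n). d' \<in> F w" by blast
    from sub[OF w(1,3)] have "ball d (1 / Suc n) \<subseteq> interior (F w)"
      by (simp add: interior_maximal)
    then show "w \<in> ?L" using w by auto
  qed
  also have "\<dots> \<in> sets M"
  proof (intro sets_countable_UNI countable_dense_points countableI_type sets.Int)
    show "{w \<in> space M. \<forall>d'\<in>dense_points \<inter> ball d (1 / Suc n). d' \<in> F w} \<in> sets M" for d n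
      by (intro sets.sets_Collect_countable_All' sets_fell_mem[OF F] countable_Int1 countable_dense_points) auto
  qed auto
  finally show ?thesis .
qed

lemma sets_fell_frontier:
  fixes y :: "'b \<Rightarrow> 'a::euclidean_space"
  assumes F: "F \<in> measurable M fell_borel" and y[measurable]: "y \<in> borel_measurable M"
  shows "{w \<in> space M. y w \<in> frontier (F w)} \<in> sets M"
proof -
  have "{w \<in> space M. y w \<in> frontier (F w)} =
    {w \<in> space M. y w \<in> F w} - {w \<in> space M. y w \<in> interior (F w)}"
    using fell_closed[OF F] by (auto simp: frontier_def)
  then show ?thesis using sets_fell_mem[OF F y] sets_fell_interior[OF F y] by simp
qed

text \<open>Multiplication of a scalar and a vector is continuous, so the preimage of an open
  \<open>G\<close> is a union of boxes, ball times interval, from a countable family.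
  \<open>J\<close> indexes the boxes that are mapped into \<open>G\<close>.\<close>

lemma measurable_fell_scaleR:
  fixes Y :: "'b \<Rightarrow> 'a::euclidean_space set"
  assumes F: "Y \<in> measurable M fell_borel" and R[measurable]: "R \<in> borel_measurable M"
  shows "(\<lambda>w. (*\<^sub>R) (R w) ` Y w) \<in> measurable M fell_borel"
proof (rule measurable_fell_borelI)
  show "closed ((*\<^sub>R) (R w) ` Y w)" if "w \<in> space M" for w
    using closed_scaling[of "Y w" "R w"] fell_closed[OF F that] by simp
next
  fix G :: "'a set" assume G: "open G"
  define J where "J = {(d, n, q, m). d \<in> dense_points \<and> q \<in> \<rat> \<and>
    (\<forall>z r. dist d z < 1 / real (Suc n) \<longrightarrow> \<bar>r - q\<bar> < 1 / real (Suc m) \<longrightarrow> r *\<^sub>R z \<in> G)}"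
  have "J \<subseteq> dense_points \<times> (UNIV::nat set) \<times> \<rat> \<times> (UNIV::nat set)" unfolding J_def by auto
  then have J: "countable J"
    by (rule countable_subset) (intro countable_SIGMA countable_dense_points countable_rat, auto)
  have "{w \<in> space M. (*\<^sub>R) (R w) ` Y w \<inter> G \<noteq> {}} =
    (\<Union>(d, n, q, m)\<in>J. {w \<in> space M. Y w \<inter> ball d (1 / Suc n) \<noteq> {}} \<inter>
      {w \<in> space M. \<bar>R w - q\<bar> < 1 / Suc m})" (is "?L = ?R")
  proof (intro equalityI subsetI)
    fix w assume "w \<in> ?L"
    then obtain y where y: "w \<in> space M" "y \<in> Y w" "R w *\<^sub>R y \<in> G" by auto
    have "open ((\<lambda>(r, z). r *\<^sub>R z) -` G :: (real \<times> 'a) set)"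
      by (intro open_vimage G) (auto simp: case_prod_unfold intro!: continuous_intros)
    moreover have "(R w, y) \<in> (\<lambda>(r, z). r *\<^sub>R z) -` G" using y by auto
    ultimately obtain A B where AB: "open A" "open B" "R w \<in> A" "y \<in> B"
      "A \<times> B \<subseteq> (\<lambda>(r, z). r *\<^sub>R z) -` G"
      by (rule open_prod_elim) (auto elim: that)
    obtain d n where dn: "d \<in> dense_points" "y \<in> ball d (1 / Suc n)" "cball d (1 / Suc n) \<subseteq> B"
      using dense_ball_inside[OF AB(2,4)] by blast
    obtain e where e: "e > 0" "\<And>x. \<bar>x - R w\<bar> < e \<Longrightarrow> x \<in> A"
      using AB(1,3) unfolding open_dist dist_real_def by blast
    \<comment> \<open>Half of \<open>e\<close>, because \<open>r\<close> is within
      \<open>1 / Suc m\<close> of \<open>q\<close>, which is itself within \<open>1 / Suc m\<close>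
      of \<open>R w\<close>.\<close>
    obtain m where m: "1 / real (Suc m) < e / 2" using nat_approx_posE[of "e/2"] e(1) by auto
    obtain q where q: "q \<in> \<rat>" "R w < q" "q < R w + 1 / Suc m"
      using Rats_dense_in_real[of "R w" "R w + 1 / Suc m"] by auto
    have "(d, n, q, m) \<in> J"
    proof -
      have "r *\<^sub>R z \<in> G" if "dist d z < 1 / Suc n" "\<bar>r - q\<bar> < 1 / Suc m" for z r
      proof -
        have "z \<in> B" using that dn by auto
        moreover have "r \<in> A" using that q m by (intro e) linarith
        ultimately show ?thesis using AB by auto
      qed
      then show ?thesis unfolding J_def using dn q by auto
    qed
    moreover have "\<bar>R w - q\<bar> < 1 / Suc m" using q by auto
    moreover have "Y w \<inter> ball d (1 / Suc n) \<noteq> {}" using y dn by auto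
    ultimately show "w \<in> ?R" using y(1) by blast
  next
    fix w assume "w \<in> ?R"
    then obtain d n q m where J: "(d, n, q, m) \<in> J" and w: "w \<in> space M"
      "Y w \<inter> ball d (1 / Suc n) \<noteq> {}" "\<bar>R w - q\<bar> < 1 / Suc m" by blast
    then obtain z where z: "z \<in> Y w" "dist d z < 1 / Suc n" by auto
    then have "R w *\<^sub>R z \<in> G" using J w unfolding J_def by blast
    then show "w \<in> ?L" using z w by auto
  qed
  also have "\<dots> \<in> sets M"
    by (intro sets_countable_UNI[OF J]) (auto intro!: sets.Int sets_fell_hit_open[OF F])
  finally show "{w \<in> space M. (*\<^sub>R) (R w) ` Y w \<inter> G \<noteq> {}} \<in> sets M" .
qed

section \<open>Poisson processes\<close>

text \<open>Generating function of the Poisson law with mean \<open>l\<close>, at the argument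
  \<open>z\<close>.\<close>

lemma poisson_weight_sums:
  fixes l z :: real
  shows "(\<lambda>k. l ^ k / fact k * exp (- l) * z ^ k) sums exp (- ((1 - z) * l))"
proof -
  have "(\<lambda>k. exp (- l) * ((z * l) ^ k /\<^sub>R fact k)) sums (exp (- l) * exp (z * l))"
    by (intro sums_mult exp_converges)
  also have "exp (- l) * exp (z * l) = exp (- ((1 - z) * l))"
    by (simp add: exp_add[symmetric] algebra_simps)
  finally show ?thesis
    by (rule sums_cong[THEN iffD1, rotated]) (simp add: power_mult_distrib field_simps)
qed

lemma poisson_mean_sums:
  fixes l :: real
  shows "(\<lambda>k. l ^ k / fact k * exp (- l) * real k) sums l"
proof -
  have "(\<lambda>k. l * exp (- l) * (l ^ k /\<^sub>R fact k)) sums (l * exp (- l) * exp l)"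
    by (intro sums_mult exp_converges)
  also have "l * exp (- l) * exp l = l" by (simp add: exp_minus field_simps)
  finally have "(\<lambda>k. l ^ Suc k / fact (Suc k) * exp (- l) * real (Suc k)) sums l"
    by (rule sums_cong[THEN iffD1, rotated]) (simp add: field_simps del: of_nat_Suc)
  then show ?thesis by (subst (asm) sums_Suc_iff) simp
qed

section \<open>Mean measure and generating functional of a Poisson process\<close>

locale poisson_enumeration = prob_space \<Omega> for \<Omega> :: "'w measure" +
  fixes p :: "nat \<Rightarrow> 'w \<Rightarrow> 'e::euclidean_space"
  assumes poisson: "poisson_process \<Omega> p"
begin

lemma point_measurable[measurable]: "p i \<in> borel_measurable \<Omega>"
  using poisson by (auto simp: poisson_process_def)

lemma AE_finite_points:
  assumes "B \<in> sets borel" "emeasure lborel B < \<infinity>"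
  shows "AE w in \<Omega>. finite {i. p i w \<in> B}"
  using poisson assms by (auto simp: poisson_process_def)

lemma npoints_indep:
  fixes J :: "nat set"
  assumes "finite J" "disjoint_family_on B J"
    "\<And>j. j \<in> J \<Longrightarrow> B j \<in> sets borel" "\<And>j. j \<in> J \<Longrightarrow> emeasure lborel (B j) < \<infinity>"
  shows "indep_vars (\<lambda>_. count_space UNIV) (\<lambda>j. npoints p (B j)) J"
  using poisson assms by (auto simp: poisson_process_def)

text \<open>Measurability of a count comes out of the independence clause, applied to a family with
  a single index.\<close>

lemma npoints_measurable:
  assumes "B \<in> sets borel" "emeasure lborel B < \<infinity>"
  shows "npoints p B \<in> measurable \<Omega> (count_space UNIV)"
  using npoints_indep[of "{0}" "\<lambda>_. B"] assms by (auto simp: indep_vars_def disjoint_family_on_def)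

text \<open>The value \<open>s\<close> of the series is left open, so that both the generating
  function and the mean of a count can be obtained.\<close>

lemma nn_integral_npoints:
  assumes B: "B \<in> sets borel" "emeasure lborel B < \<infinity>"
    and f: "\<And>k. 0 \<le> f k"
    and s: "(\<lambda>k. measure lborel B ^ k / fact k * exp (- measure lborel B) * f k) sums s"
  shows "(\<integral>\<^sup>+w. ennreal (f (npoints p B w)) \<partial>\<Omega>) = ennreal s"
proof -
  note [measurable] = npoints_measurable[OF B]
  define D where "D = distr \<Omega> (count_space UNIV) (npoints p B)"
  have D: "emeasure D {k} = ennreal (measure lborel B ^ k / fact k * exp (- measure lborel B))" for k
  proof -
    have "emeasure D {k} = emeasure \<Omega> {w \<in> space \<Omega>. npoints p B w = k}"
      unfolding D_def by (subst emeasure_distr) (auto intro!: arg_cong2[where f = emeasure])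
    also have "\<dots> = ennreal (measure lborel B ^ k / fact k * exp (- measure lborel B))"
      using poisson B by (simp add: poisson_process_def emeasure_eq_measure)
    finally show ?thesis .
  qed
  have "(\<integral>\<^sup>+w. ennreal (f (npoints p B w)) \<partial>\<Omega>) = (\<integral>\<^sup>+k. ennreal (f k) \<partial>D)"
    unfolding D_def by (subst nn_integral_distr) auto
  also have "D = density (count_space UNIV) (\<lambda>k. emeasure D {k})"
  proof (rule measure_eqI_countable[of _ UNIV])
    show "emeasure D {a} = emeasure (density (count_space UNIV) (\<lambda>k. emeasure D {k})) {a}" for a
      by (subst emeasure_density) (auto simp: nn_integral_count_space_indicator[symmetric])
  qed (auto simp: D_def)
  also have "(\<integral>\<^sup>+k. ennreal (f k) \<partial>density (count_space UNIV) (\<lambda>k. emeasure D {k})) =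
    (\<Sum>k. emeasure D {k} * ennreal (f k))"
    by (subst nn_integral_density) (auto simp: nn_integral_count_space_nat)
  also have "\<dots> = (\<Sum>k. ennreal (measure lborel B ^ k / fact k * exp (- measure lborel B) * f k))"
    by (intro suminf_cong, subst D, rule ennreal_mult[symmetric]) (auto simp: f)
  also have "\<dots> = ennreal s"
    using s f by (intro suminf_ennreal_eq) auto
  finally show ?thesis .
qed

text \<open>Campbell's formula for a set: both sides are the mean number of points in
  \<open>B\<close>, computed along the enumeration and from the Poisson law.\<close>

lemma sum_prob_points:
  assumes B: "B \<in> sets borel" "emeasure lborel B < \<infinity>"
  shows "(\<Sum>i. emeasure \<Omega> {w \<in> space \<Omega>. p i w \<in> B}) = emeasure lborel B"
proof -
  note [measurable] = npoints_measurable[OF B] B(1)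
  have "(\<Sum>i. emeasure \<Omega> {w \<in> space \<Omega>. p i w \<in> B}) = (\<Sum>i. \<integral>\<^sup>+w. indicator B (p i w) \<partial>\<Omega>)"
    by (intro suminf_cong) (simp flip: nn_integral_indicator add: indicator_def cong: nn_integral_cong)
  also have "\<dots> = (\<integral>\<^sup>+w. (\<Sum>i. indicator B (p i w)) \<partial>\<Omega>)"
    by (rule nn_integral_suminf[symmetric]) measurable
  also have "\<dots> = (\<integral>\<^sup>+w. ennreal (real (npoints p B w)) \<partial>\<Omega>)"
  proof (rule nn_integral_cong_AE, use AE_finite_points[OF B] in eventually_elim)
    fix w assume "finite {i. p i w \<in> B}"
    have "(\<Sum>i. indicator B (p i w) :: ennreal) = (\<integral>\<^sup>+i. indicator {i. p i w \<in> B} i \<partial>count_space UNIV)"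
      by (subst nn_integral_count_space_nat) (auto intro!: suminf_cong simp: indicator_def)
    also have "\<dots> = emeasure (count_space UNIV) {i. p i w \<in> B}" by simp
    also have "\<dots> = ennreal (real (npoints p B w))"
      using \<open>finite _\<close> by (simp add: npoints_def ennreal_of_nat_eq_real_of_nat)
    finally show "(\<Sum>i. indicator B (p i w)) = ennreal (real (npoints p B w))" .
  qed
  also have "\<dots> = ennreal (measure lborel B)"
    by (rule nn_integral_npoints[OF B _ poisson_mean_sums]) simp
  also have "\<dots> = emeasure lborel B"
    using B(2) by (intro emeasure_eq_ennreal_measure[symmetric]) auto
  finally show ?thesis .
qed

text \<open>The mean measure of the process is Lebesgue measure: the image \<open>N\<close> of
  counting measure times \<Omega> under the enumeration agrees with it on boxes, which determine
  it.\<close>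

lemma suminf_nn_integral_points:
  assumes [measurable]: "h \<in> borel_measurable borel"
  shows "(\<Sum>i. \<integral>\<^sup>+w. h (p i w) \<partial>\<Omega>) = (\<integral>\<^sup>+x. h x \<partial>lborel)"
proof -
  interpret P: pair_sigma_finite "count_space (UNIV::nat set)" \<Omega>
    by (intro pair_sigma_finite.intro sigma_finite_measure_count_space_countable sigma_finite_measure_axioms) auto
  let ?PP = "count_space (UNIV::nat set) \<Otimes>\<^sub>M \<Omega>"
  have [measurable]: "(\<lambda>(i, w). p i w) \<in> borel_measurable ?PP"
    by (rule measurable_pair_measure_countable1) auto
  define N where "N = distr ?PP borel (\<lambda>(i, w). p i w)"
  have NN: "(\<integral>\<^sup>+x. g x \<partial>N) = (\<Sum>i. \<integral>\<^sup>+w. g (p i w) \<partial>\<Omega>)" if [measurable]: "g \<in> borel_measurable borel" for g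
    unfolding N_def
    by (simp add: nn_integral_distr case_prod_unfold P.nn_integral_fst[symmetric] nn_integral_count_space_nat)
       (subst nn_integral_fst[symmetric]; auto simp: nn_integral_count_space_nat)
  have "lborel = N"
  proof (rule lborel_eqI)
    show "sets N = sets borel" by (simp add: N_def)
    fix l u :: 'e assume lu: "\<And>b. b \<in> Basis \<Longrightarrow> l \<bullet> b \<le> u \<bullet> b"
    have "emeasure N (box l u) = (\<integral>\<^sup>+x. indicator (box l u) x \<partial>N)"
      by (rule nn_integral_indicator[symmetric]) (simp add: N_def)
    also have "\<dots> = (\<Sum>i. emeasure \<Omega> {w \<in> space \<Omega>. p i w \<in> box l u})"
      by (subst NN) (auto intro!: suminf_cong simp flip: nn_integral_indicator simp: indicator_def cong: nn_integral_cong)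
    also have "\<dots> = emeasure lborel (box l u)"
      by (rule sum_prob_points) (use emeasure_lborel_box_finite[of l u] in auto)
    finally show "emeasure N (box l u) = (\<Prod>b\<in>Basis. (u - l) \<bullet> b)"
      using lu by (simp add: emeasure_lborel_box)
  qed
  then show ?thesis using NN[of h] by simp
qed

text \<open>The counts on the level sets of \<open>h\<close> are independent, and each contributes
  its generating function at 1 minus the level. The infimum over \<open>m\<close> is the infinite
  product over all points, since the partial products decrease.\<close>

lemma nn_integral_void_simple:
  fixes h :: "'e \<Rightarrow> real"
  assumes sf: "simple_function borel h"
    and h: "\<And>x. 0 \<le> h x" "\<And>x. h x \<le> 1"
    and fin: "\<And>c. c \<noteq> 0 \<Longrightarrow> emeasure lborel (h -` {c}) < \<infinity>"
  shows "(\<integral>\<^sup>+w. (INF m. ennreal (\<Prod>i<m. 1 - h (p i w))) \<partial>\<Omega>) = ennreal (exp (- (\<integral>x. h x \<partial>lborel)))"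
proof -
  define C where "C = range h - {0}"
  have C: "finite C" using sf by (auto simp: C_def simple_function_def)
  define A where "A c = h -` {c}" for c
  have Am[measurable]: "A c \<in> sets borel" for c
    using simple_functionD(2)[OF sf, of "{c}"] by (simp add: A_def)
  have Afin: "emeasure lborel (A c) < \<infinity>" if "c \<in> C" for c using fin that by (auto simp: C_def A_def)
  have C01: "0 \<le> c" "c \<le> 1" if "c \<in> C" for c using that h by (auto simp: C_def)
  \<comment> \<open>Independence of counts is stated for families indexed by natural numbers, so the
    levels are numbered.\<close>
  obtain e where e: "bij_betw e C {..<card C}"
    using ex_bij_betw_finite_nat[OF C] atLeast0LessThan by auto
  define g where "g = inv_into C e"
  have g: "bij_betw g {..<card C} C" unfolding g_def using e by (rule bij_betw_inv_into)
  have gC: "g j \<in> C" if "j < card C" for j using g that by (auto simp: bij_betw_def)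
  have AE: "AE w in \<Omega>. \<forall>c\<in>C. finite {i. p i w \<in> A c}"
    using C AE_finite_points[OF Am Afin] by (intro AE_finite_allI) auto
  have eq: "(INF m. ennreal (\<Prod>i<m. 1 - h (p i w))) = (\<Prod>c\<in>C. ennreal ((1 - c) ^ npoints p (A c) w))"
    if fin: "\<forall>c\<in>C. finite {i. p i w \<in> A c}" for w
  proof -
    define F where "F = (\<Union>c\<in>C. {i. p i w \<in> A c})"
    have F: "finite F" using C fin by (auto simp: F_def)
    have nF: "h (p i w) = 0" if "i \<notin> F" for i using that by (auto simp: F_def C_def A_def)
    have prodF: "(\<Prod>i\<in>F. 1 - h (p i w)) = (\<Prod>c\<in>C. (1 - c) ^ npoints p (A c) w)"
    proof -
      have "(\<Prod>i\<in>F. 1 - h (p i w)) = (\<Prod>c\<in>C. \<Prod>i\<in>{i. p i w \<in> A c}. 1 - h (p i w))"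
        unfolding F_def by (rule prod.UNION_disjoint) (use C fin in \<open>auto simp: A_def\<close>)
      also have "\<dots> = (\<Prod>c\<in>C. \<Prod>i\<in>{i. p i w \<in> A c}. 1 - c)"
        by (intro prod.cong) (auto simp: A_def)
      finally show ?thesis by (simp add: npoints_def)
    qed
    have dec: "decseq (\<lambda>m. ennreal (\<Prod>i<m. 1 - h (p i w)))"
      unfolding decseq_Suc_iff by (auto intro!: ennreal_leI mult_right_le_one_le prod_nonneg h simp: h)
    obtain m0 where m0: "F \<subseteq> {..<m0}"
      using F finite_nat_bounded by blast
    have ev: "(\<Prod>i<m. 1 - h (p i w)) = (\<Prod>i\<in>F. 1 - h (p i w))" if "m \<ge> m0" for m
      by (rule prod.mono_neutral_right) (use m0 that nF in auto)
    have "(\<lambda>m. ennreal (\<Prod>i<m. 1 - h (p i w))) \<longlonglongrightarrow> ennreal (\<Prod>i\<in>F. 1 - h (p i w))"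
      by (rule tendsto_eventually) (use ev in \<open>auto simp: eventually_sequentially intro!: exI[of _ m0]\<close>)
    then have "(INF m. ennreal (\<Prod>i<m. 1 - h (p i w))) = ennreal (\<Prod>i\<in>F. 1 - h (p i w))"
      using LIMSEQ_INF[OF dec] LIMSEQ_unique by blast
    then show ?thesis unfolding prodF using C01 by (simp add: prod_ennreal)
  qed
  have "(\<integral>\<^sup>+w. (INF m. ennreal (\<Prod>i<m. 1 - h (p i w))) \<partial>\<Omega>) =
    (\<integral>\<^sup>+w. (\<Prod>c\<in>C. ennreal ((1 - c) ^ npoints p (A c) w)) \<partial>\<Omega>)"
    using AE by (intro nn_integral_cong_AE, eventually_elim) (rule eq)
  also have "\<dots> = (\<integral>\<^sup>+w. (\<Prod>j<card C. ennreal ((1 - g j) ^ npoints p (A (g j)) w)) \<partial>\<Omega>)"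
    by (simp add: prod.reindex_bij_betw[OF g, symmetric])
  also have "\<dots> = (\<Prod>j<card C. \<integral>\<^sup>+w. ennreal ((1 - g j) ^ npoints p (A (g j)) w) \<partial>\<Omega>)"
  proof (rule indep_vars_nn_integral)
    have "indep_vars (\<lambda>_. count_space UNIV) (\<lambda>j. npoints p (A (g j))) {..<card C}"
    proof (rule npoints_indep)
      show "disjoint_family_on (\<lambda>j. A (g j)) {..<card C}"
        using g by (auto simp: disjoint_family_on_def A_def bij_betw_def inj_on_def)
    qed (use Afin gC in auto)
    then show "indep_vars (\<lambda>_. borel) (\<lambda>j w. ennreal ((1 - g j) ^ npoints p (A (g j)) w)) {..<card C}"
      by (rule indep_vars_compose2) auto
  qed auto
  also have "\<dots> = (\<Prod>j<card C. ennreal (exp (- (g j * measure lborel (A (g j))))))"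
  proof (rule prod.cong[OF refl])
    fix j assume j: "j \<in> {..<card C}"
    then have c: "g j \<in> C" using gC by auto
    show "(\<integral>\<^sup>+w. ennreal ((1 - g j) ^ npoints p (A (g j)) w) \<partial>\<Omega>) = ennreal (exp (- (g j * measure lborel (A (g j)))))"
      using nn_integral_npoints[OF Am Afin[OF c] _ poisson_weight_sums[of _ "1 - g j"]] C01[OF c] by simp
  qed
  also have "\<dots> = (\<Prod>c\<in>C. ennreal (exp (- (c * measure lborel (A c)))))"
    by (rule prod.reindex_bij_betw[OF g])
  also have "\<dots> = ennreal (exp (- (\<Sum>c\<in>C. c * measure lborel (A c))))"
    using C by (simp add: prod_ennreal exp_sum[symmetric] sum_negf)
  also have "(\<Sum>c\<in>C. c * measure lborel (A c)) = (\<integral>x. (\<Sum>c\<in>C. c * indicator (A c) x) \<partial>lborel)"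
  proof -
    have "integrable lborel (\<lambda>x. c * indicator (A c) x :: real)" if "c \<in> C" for c
      using Afin[OF that] by (intro integrable_mult_right) (auto intro!: integrable_real_indicator)
    then show ?thesis by (simp add: Bochner_Integration.integral_sum)
  qed
  also have "(\<lambda>x. \<Sum>c\<in>C. c * indicator (A c) x :: real) = h"
  proof
    fix x
    have "(\<Sum>c\<in>C. c * indicator (A c) x) = (\<Sum>c\<in>C. if c = h x then c else 0)"
      by (intro sum.cong) (auto simp: A_def indicator_def)
    also have "\<dots> = h x" using C by (auto simp: C_def)
    finally show "(\<Sum>c\<in>C. c * indicator (A c) x :: real) = h x" .
  qed
  finally show ?thesis .
qed

text \<open>Simple functions increase to \<open>h\<close>, and the corresponding infinite products
  decrease to the one for \<open>h\<close> because the infima over \<open>m\<close> and over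
  \<open>n\<close> commute. The exponents converge by dominated convergence.\<close>

lemma nn_integral_void:
  fixes h :: "'e \<Rightarrow> real"
  assumes hm[measurable]: "h \<in> borel_measurable borel"
    and h: "\<And>x. 0 \<le> h x" "\<And>x. h x \<le> 1" and int: "integrable lborel h"
  shows "(\<integral>\<^sup>+w. (INF m. ennreal (\<Prod>i<m. 1 - h (p i w))) \<partial>\<Omega>) = ennreal (exp (- (\<integral>x. h x \<partial>lborel)))"
proof -
  obtain f where f: "incseq f" "\<And>i. simple_function borel (f i)" "\<And>x. bdd_above (range (\<lambda>i. f i x))"
    "\<And>i x. 0 \<le> f i x" "h = (SUP i. f i)"
    using borel_measurable_implies_simple_function_sequence_real[OF hm h(1)] by metis
  have fm[measurable]: "f n \<in> borel_measurable borel" for n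
    using f(2) by (rule borel_measurable_simple_function)
  have hx: "h x = (SUP i. f i x)" for x by (simp only: f(5) Sup_apply image_image)
  have incx: "incseq (\<lambda>n. f n x)" for x using f(1) by (auto simp: incseq_def le_fun_def)
  have lim: "(\<lambda>n. f n x) \<longlonglongrightarrow> h x" for x
    unfolding hx by (rule LIMSEQ_incseq_SUP[OF f(3) incx])
  have le: "f n x \<le> h x" for n x unfolding hx by (rule cSUP_upper[OF _ f(3)]) simp
  \<comment> \<open>Markov's inequality for the integrable function \<open>h\<close> bounds the
    volume of every nonzero level set of an approximating function.\<close>
  have fin: "emeasure lborel (f n -` {c}) < \<infinity>" if "c \<noteq> 0" for n c
  proof (cases "0 < c")
    case True
    have "emeasure lborel (f n -` {c}) \<le> emeasure lborel {x \<in> UNIV. 1 \<le> ennreal (1 / c) * ennreal (h x)}"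
    proof (rule emeasure_mono)
      show "f n -` {c} \<subseteq> {x \<in> UNIV. 1 \<le> ennreal (1 / c) * ennreal (h x)}"
      proof clarsimp
        fix x assume "c = f n x"
        then have "1 \<le> 1 / c * h x" using True le[of n x] by (simp add: field_simps)
        then show "1 \<le> ennreal (1 / f n x) * ennreal (h x)"
          using True h \<open>c = f n x\<close> by (simp add: ennreal_mult[symmetric] del: ennreal_1 flip: ennreal_1)
      qed
    qed measurable
    also have "\<dots> \<le> ennreal (1 / c) * (\<integral>\<^sup>+x. ennreal (h x) * indicator UNIV x \<partial>lborel)"
      by (rule nn_integral_Markov_inequality) auto
    also have "\<dots> < \<infinity>"
      using nn_integral_eq_integral[OF int] h by (simp add: ennreal_mult_less_top)
    finally show ?thesis .
  next
    case False
    then have "f n x \<noteq> c" for x using f(4)[of n x] that by auto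
    then have "f n -` {c} = {}" by auto
    then show ?thesis by simp
  qed
  have f1: "f n x \<le> 1" for n x using le[of n x] h(2)[of x] by simp
  define G where "G n w = (INF m. ennreal (\<Prod>i<m. 1 - f n (p i w)))" for n w
  have Gm[measurable]: "G n \<in> borel_measurable \<Omega>" for n unfolding G_def by measurable
  have G: "(\<integral>\<^sup>+w. G n w \<partial>\<Omega>) = ennreal (exp (- (\<integral>x. f n x \<partial>lborel)))" for n
    unfolding G_def using f(2,4) f1 fin by (intro nn_integral_void_simple) auto
  have decx: "decseq (\<lambda>n. ennreal (\<Prod>i<m. 1 - f n (p i w)))" for m w
    unfolding decseq_def using f1 incx[unfolded incseq_def]
    by (auto intro!: ennreal_leI prod_mono)
  have decG: "decseq G"
    by (intro decseq_SucI le_funI, unfold G_def) (intro INF_mono' decseq_SucD decx)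
  have INFG: "(INF n. G n w) = (INF m. ennreal (\<Prod>i<m. 1 - h (p i w)))" for w
  proof -
    have "(INF n. G n w) = (INF m. INF n. ennreal (\<Prod>i<m. 1 - f n (p i w)))"
      unfolding G_def by (rule INF_commute)
    moreover have "(INF n. ennreal (\<Prod>i<m. 1 - f n (p i w))) = ennreal (\<Prod>i<m. 1 - h (p i w))" for m
    proof -
      have "(\<lambda>n. ennreal (\<Prod>i<m. 1 - f n (p i w))) \<longlonglongrightarrow> ennreal (\<Prod>i<m. 1 - h (p i w))"
        by (intro tendsto_ennrealI tendsto_prod tendsto_diff tendsto_const lim)
      then show ?thesis using LIMSEQ_INF[OF decx] LIMSEQ_unique by blast
    qed
    ultimately show ?thesis by simp
  qed
  have "(\<integral>\<^sup>+w. (INF m. ennreal (\<Prod>i<m. 1 - h (p i w))) \<partial>\<Omega>) = (\<integral>\<^sup>+w. (INF n. G n w) \<partial>\<Omega>)"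
    by (simp add: INFG)
  also have "\<dots> = (INF n. \<integral>\<^sup>+w. G n w \<partial>\<Omega>)"
    by (rule nn_integral_monotone_convergence_INF_decseq[OF decG, of _ 0]) (auto simp: G)
  also have "\<dots> = ennreal (exp (- (\<integral>x. h x \<partial>lborel)))"
  proof -
    have "(\<lambda>n. \<integral>x. f n x \<partial>lborel) \<longlonglongrightarrow> (\<integral>x. h x \<partial>lborel)"
      by (rule integral_dominated_convergence[where w = h])
         (use int lim le f(4) in \<open>auto intro!: AE_I2\<close>)
    then have "(\<lambda>n. \<integral>\<^sup>+w. G n w \<partial>\<Omega>) \<longlonglongrightarrow> ennreal (exp (- (\<integral>x. h x \<partial>lborel)))"
      unfolding G by (intro tendsto_ennrealI tendsto_exp tendsto_minus)
    moreover have "decseq (\<lambda>n. \<integral>\<^sup>+w. G n w \<partial>\<Omega>)"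
      by (intro decseq_SucI nn_integral_mono le_funD[OF decseq_SucD[OF decG]])
    ultimately show ?thesis using LIMSEQ_INF[THEN LIMSEQ_unique] by blast
  qed
  finally show ?thesis .
qed

end

lemma indep_rv_distr:
  assumes "prob_space P" and ind: "indep_rv P S A T B"
  shows "distr P (S \<Otimes>\<^sub>M T) (\<lambda>w. (A w, B w)) = distr P S A \<Otimes>\<^sub>M distr P T B"
proof -
  interpret prob_space P by fact
  have A[measurable]: "A \<in> measurable P S" and B[measurable]: "B \<in> measurable P T"
    using ind by (auto simp: indep_rv_def)
  interpret A: prob_space "distr P S A" by (rule prob_space_distr) measurable
  interpret B: prob_space "distr P T B" by (rule prob_space_distr) measurable
  show ?thesis
  proof (rule pair_measure_eqI[symmetric])
    show "sigma_finite_measure (distr P S A)" "sigma_finite_measure (distr P T B)" by unfold_locales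
    show "sets (distr P S A \<Otimes>\<^sub>M distr P T B) = sets (distr P (S \<Otimes>\<^sub>M T) (\<lambda>w. (A w, B w)))"
      by (simp cong: sets_pair_measure_cong)
    fix U V assume "U \<in> sets (distr P S A)" "V \<in> sets (distr P T B)"
    then have [measurable]: "U \<in> sets S" "V \<in> sets T" by auto
    have "prob ((A -` U \<inter> space P) \<inter> (B -` V \<inter> space P)) = prob (A -` U \<inter> space P) * prob (B -` V \<inter> space P)"
      using ind unfolding indep_rv_def by (intro indep_setD[of "sets (vimage_algebra (space P) A S)"
        "sets (vimage_algebra (space P) B T)"]) (auto intro: in_vimage_algebra)
    moreover have "(\<lambda>w. (A w, B w)) -` (U \<times> V) \<inter> space P = (A -` U \<inter> space P) \<inter> (B -` V \<inter> space P)" by auto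
    ultimately show "emeasure (distr P S A) U * emeasure (distr P T B) V =
        emeasure (distr P (S \<Otimes>\<^sub>M T) (\<lambda>w. (A w, B w))) (U \<times> V)"
      by (simp add: emeasure_distr emeasure_eq_measure ennreal_mult)
  qed
qed

section \<open>Independent marking of a Poisson process\<close>

locale marked_poisson = poisson_enumeration \<Omega> p
  for \<Omega> :: "'w measure" and p :: "nat \<Rightarrow> 'w \<Rightarrow> 'e::euclidean_space" +
  fixes N L :: "'m measure" and X :: "nat \<Rightarrow> 'w \<Rightarrow> 'm"
  assumes indep_marks: "indep_vars (\<lambda>_. N) X UNIV"
    and distr_mark: "\<And>i. distr \<Omega> N (X i) = L"
    and indep_points_marks: "indep_rv \<Omega> (Pi\<^sub>M UNIV (\<lambda>_. borel)) (\<lambda>w i. p i w)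
      (Pi\<^sub>M UNIV (\<lambda>_. N)) (\<lambda>w i. X i w)"
begin

lemma mark_measurable[measurable]: "X i \<in> measurable \<Omega> N"
  using indep_marks by (auto simp: indep_vars_def)

lemma sets_L[measurable_cong]: "sets L = sets N"
  unfolding distr_mark[of 0, symmetric] by simp

lemma space_L: "space L = space N"
  unfolding distr_mark[of 0, symmetric] by simp

lemma prob_space_L: "prob_space L"
  unfolding distr_mark[of 0, symmetric] by (rule prob_space_distr) measurable

sublocale L: prob_space L by (rule prob_space_L)

lemma marks_measurable[measurable]: "(\<lambda>w i. X i w) \<in> measurable \<Omega> (Pi\<^sub>M UNIV (\<lambda>_. N))"
  and points_measurable[measurable]: "(\<lambda>w i. p i w) \<in> measurable \<Omega> (Pi\<^sub>M UNIV (\<lambda>_. borel))"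
  using indep_points_marks by (auto simp: indep_rv_def)

lemma distr_points_marks:
  "distr \<Omega> (Pi\<^sub>M UNIV (\<lambda>_. borel) \<Otimes>\<^sub>M Pi\<^sub>M UNIV (\<lambda>_. N)) (\<lambda>w. (\<lambda>i. p i w, \<lambda>i. X i w)) =
    distr \<Omega> (Pi\<^sub>M UNIV (\<lambda>_. borel)) (\<lambda>w i. p i w) \<Otimes>\<^sub>M Pi\<^sub>M UNIV (\<lambda>_. L)"
proof -
  have "distr \<Omega> (Pi\<^sub>M UNIV (\<lambda>_. N)) (\<lambda>w i. X i w) = Pi\<^sub>M UNIV (\<lambda>_. L)"
    using indep_marks indep_vars_iff_distr_eq_PiM[of UNIV X "\<lambda>_. N"] by (simp add: distr_mark restrict_UNIV)
  then show ?thesis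
    using indep_rv_distr[OF prob_space_axioms indep_points_marks] by simp
qed

text \<open>Given the points, the marks are still independent with law \<open>L\<close>; integrating
  them out leaves the product of the masses of the sections of \<open>E i\<close>.\<close>

lemma emeasure_marks_in:
  assumes I: "finite I" and E[measurable]: "\<And>i. E i \<in> sets (borel \<Otimes>\<^sub>M N)"
  shows "emeasure \<Omega> {w \<in> space \<Omega>. \<forall>i\<in>I. (p i w, X i w) \<in> E i} =
    (\<integral>\<^sup>+w. (\<Prod>i\<in>I. emeasure L (Pair (p i w) -` E i)) \<partial>\<Omega>)"
proof -
  let ?Pp = "Pi\<^sub>M UNIV (\<lambda>_::nat. borel :: 'e measure)" and ?PN = "Pi\<^sub>M UNIV (\<lambda>_::nat. N)"
  interpret PL: product_prob_space "\<lambda>_. L" "UNIV :: nat set" ..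
  interpret D: prob_space "distr \<Omega> ?Pp (\<lambda>w i. p i w)" by (rule prob_space_distr) measurable
  define Z where "Z = {x \<in> space (?Pp \<Otimes>\<^sub>M ?PN). \<forall>i\<in>I. (fst x i, snd x i) \<in> E i}"
  have Em[measurable]: "Measurable.pred (borel \<Otimes>\<^sub>M N) (\<lambda>x. x \<in> E i)" for i by measurable
  have Z[measurable]: "Z \<in> sets (?Pp \<Otimes>\<^sub>M ?PN)"
    unfolding Z_def using I by measurable
  have "emeasure \<Omega> {w \<in> space \<Omega>. \<forall>i\<in>I. (p i w, X i w) \<in> E i} =
      emeasure (distr \<Omega> (?Pp \<Otimes>\<^sub>M ?PN) (\<lambda>w. (\<lambda>i. p i w, \<lambda>i. X i w))) Z"
    by (subst emeasure_distr, measurable) (auto intro!: arg_cong2[where f = emeasure]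
       simp: Z_def space_pair_measure space_PiM measurable_space[OF mark_measurable])
  also have "\<dots> = emeasure (distr \<Omega> ?Pp (\<lambda>w i. p i w) \<Otimes>\<^sub>M Pi\<^sub>M UNIV (\<lambda>_. L)) Z"
    by (simp only: distr_points_marks)
  also have "\<dots> = (\<integral>\<^sup>+q. emeasure (Pi\<^sub>M UNIV (\<lambda>_. L)) (Pair q -` Z) \<partial>distr \<Omega> ?Pp (\<lambda>w i. p i w))"
    by (rule PL.P.emeasure_pair_measure_alt) measurable
  also have "\<dots> = (\<integral>\<^sup>+q. (\<Prod>i\<in>I. emeasure L (Pair (q i) -` E i)) \<partial>distr \<Omega> ?Pp (\<lambda>w i. p i w))"
  proof (rule nn_integral_cong)
    fix q :: "nat \<Rightarrow> 'e"
    have "Pair q -` Z = {F \<in> space (Pi\<^sub>M UNIV (\<lambda>_::nat. L)). \<forall>i\<in>I. F i \<in> Pair (q i) -` E i}"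
      by (auto simp: Z_def space_pair_measure space_PiM space_L)
    then show "emeasure (Pi\<^sub>M UNIV (\<lambda>_. L)) (Pair q -` Z) = (\<Prod>i\<in>I. emeasure L (Pair (q i) -` E i))"
      using I sets_Pair1[OF E] by (simp only:) (rule PL.emeasure_PiM_Collect, auto simp: sets_L)
  qed
  also have "\<dots> = (\<integral>\<^sup>+w. (\<Prod>i\<in>I. emeasure L (Pair (p i w) -` E i)) \<partial>\<Omega>)"
  proof -
    have *: "(\<lambda>y. emeasure L (Pair y -` E i)) \<in> borel_measurable borel" for i
      by (rule L.measurable_emeasure_Pair) (simp add: sets_L cong: sets_pair_measure_cong)
    have "(\<lambda>q. emeasure L (Pair (q i) -` E i)) \<in> borel_measurable ?Pp" for i
      by (rule measurable_compose[OF _ *]) measurable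
    then have "(\<lambda>q. \<Prod>i\<in>I. emeasure L (Pair (q i) -` E i)) \<in> borel_measurable ?Pp"
      by (intro borel_measurable_prod_ennreal)
    then show ?thesis by (simp add: nn_integral_distr)
  qed
  finally show ?thesis .
qed

text \<open>The marking theorem in void form. Integrating out the marks leaves the generating
  functional of the points for \<open>h\<close>, the mass under \<open>L\<close> of the sections of
  \<open>E\<close>, and the integral of \<open>h\<close> is the product measure of
  \<open>E\<close>.\<close>

lemma prob_no_marked_point:
  assumes E[measurable]: "E \<in> sets (borel \<Otimes>\<^sub>M N)" and fin: "emeasure (lborel \<Otimes>\<^sub>M L) E < \<infinity>"
  shows "{w \<in> space \<Omega>. \<forall>i. (p i w, X i w) \<notin> E} \<in> sets \<Omega>"
    and "prob {w \<in> space \<Omega>. \<forall>i. (p i w, X i w) \<notin> E} = exp (- measure (lborel \<Otimes>\<^sub>M L) E)"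
proof -
  have Em[measurable]: "Measurable.pred (borel \<Otimes>\<^sub>M N) (\<lambda>x. x \<in> E)" by measurable
  show S: "{w \<in> space \<Omega>. \<forall>i. (p i w, X i w) \<notin> E} \<in> sets \<Omega>" by measurable
  have E': "E \<in> sets (borel \<Otimes>\<^sub>M L)" using E by (simp add: sets_L cong: sets_pair_measure_cong)
  have E'': "E \<in> sets (lborel \<Otimes>\<^sub>M L)" using E by (simp add: sets_L cong: sets_pair_measure_cong)
  define h where "h y = measure L (Pair y -` E)" for y
  have hm[measurable]: "h \<in> borel_measurable borel"
    unfolding h_def measure_def using L.measurable_emeasure_Pair[OF E'] by measurable
  have h01: "0 \<le> h y" "h y \<le> 1" for y by (auto simp: h_def)
  have eh: "emeasure L (Pair y -` E) = ennreal (h y)" for y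
    by (simp add: h_def L.emeasure_eq_measure)
  have em: "emeasure (lborel \<Otimes>\<^sub>M L) E = (\<integral>\<^sup>+y. ennreal (h y) \<partial>lborel)"
    by (subst L.emeasure_pair_measure_alt[OF E'']) (simp add: eh)
  then have int: "integrable lborel h"
    using fin h01 by (intro integrableI_nonneg) auto
  have meas: "measure (lborel \<Otimes>\<^sub>M L) E = (\<integral>y. h y \<partial>lborel)"
    unfolding measure_def em using nn_integral_eq_integral[OF int] h01 by simp
  let ?A = "\<lambda>m. {w \<in> space \<Omega>. \<forall>i\<in>{..<m}. (p i w, X i w) \<in> space (borel \<Otimes>\<^sub>M N) - E}"
  have A: "emeasure \<Omega> (?A m) = (\<integral>\<^sup>+w. ennreal (\<Prod>i<m. 1 - h (p i w)) \<partial>\<Omega>)" for m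
  proof -
    have "emeasure L (Pair y -` (space (borel \<Otimes>\<^sub>M N) - E)) = ennreal (1 - h y)" for y
    proof -
      have "Pair y -` (space (borel \<Otimes>\<^sub>M N) - E) = space L - Pair y -` E"
        by (auto simp: space_pair_measure space_L)
      then show ?thesis
        by (simp add: L.emeasure_eq_measure h_def L.prob_compl sets_Pair1 sets_L)
    qed
    then show ?thesis
      by (subst emeasure_marks_in) (auto simp: prod_ennreal h01)
  qed
  have Am: "?A m \<in> sets \<Omega>" for m by measurable
  have "{w \<in> space \<Omega>. \<forall>i. (p i w, X i w) \<notin> E} = (\<Inter>m. ?A m)"
    using measurable_space[OF mark_measurable] by (auto simp: space_pair_measure)
  then have "emeasure \<Omega> {w \<in> space \<Omega>. \<forall>i. (p i w, X i w) \<notin> E} = (INF m. emeasure \<Omega> (?A m))"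
    using Am by (simp only:) (rule INF_emeasure_decseq[symmetric], auto simp: decseq_def)
  also have "\<dots> = (\<integral>\<^sup>+w. (INF m. ennreal (\<Prod>i<m. 1 - h (p i w))) \<partial>\<Omega>)"
    unfolding A
    by (rule nn_integral_monotone_convergence_INF_decseq[symmetric, of _ _ 0])
       (auto simp: emeasure_space_1
         intro!: decseq_SucI le_funI ennreal_leI mult_right_le_one_le prod_nonneg h01)
  also have "\<dots> = ennreal (exp (- (\<integral>x. h x \<partial>lborel)))"
    by (rule nn_integral_void[OF hm h01 int])
  finally show "prob {w \<in> space \<Omega>. \<forall>i. (p i w, X i w) \<notin> E} = exp (- measure (lborel \<Otimes>\<^sub>M L) E)"
    unfolding meas by (simp add: measure_def)
qed

lemma sum_prob_marked:
  assumes E[measurable]: "E \<in> sets (borel \<Otimes>\<^sub>M N)"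
  shows "(\<Sum>i. emeasure \<Omega> {w \<in> space \<Omega>. (p i w, X i w) \<in> E}) = emeasure (lborel \<Otimes>\<^sub>M L) E"
proof -
  have E': "E \<in> sets (borel \<Otimes>\<^sub>M L)" using E by (simp add: sets_L cong: sets_pair_measure_cong)
  have E'': "E \<in> sets (lborel \<Otimes>\<^sub>M L)" using E by (simp add: sets_L cong: sets_pair_measure_cong)
  have "emeasure \<Omega> {w \<in> space \<Omega>. (p i w, X i w) \<in> E} = (\<integral>\<^sup>+w. emeasure L (Pair (p i w) -` E) \<partial>\<Omega>)" for i
    using emeasure_marks_in[of "{i}" "\<lambda>_. E"] by simp
  then show ?thesis
    using suminf_nn_integral_points[OF L.measurable_emeasure_Pair[OF E']]
    by (simp add: L.emeasure_pair_measure_alt[OF E''])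
qed

text \<open>The mean number of marked points in \<open>E\<close> is finite, by Campbell's
  formula.\<close>

lemma AE_finite_marked:
  assumes E[measurable]: "E \<in> sets (borel \<Otimes>\<^sub>M N)" and fin: "emeasure (lborel \<Otimes>\<^sub>M L) E < \<infinity>"
  shows "AE w in \<Omega>. finite {i. (p i w, X i w) \<in> E}"
proof -
  have Em[measurable]: "Measurable.pred (borel \<Otimes>\<^sub>M N) (\<lambda>x. x \<in> E)" by measurable
  have [measurable]: "{w \<in> space \<Omega>. (p i w, X i w) \<in> E} \<in> sets \<Omega>" for i by measurable
  let ?f = "\<lambda>w. \<Sum>i. indicator {w \<in> space \<Omega>. (p i w, X i w) \<in> E} w :: ennreal"
  have "(\<integral>\<^sup>+w. ?f w \<partial>\<Omega>) = (\<Sum>i. \<integral>\<^sup>+w. indicator {w \<in> space \<Omega>. (p i w, X i w) \<in> E} w \<partial>\<Omega>)"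
    by (rule nn_integral_suminf) measurable
  also have "\<dots> < \<infinity>"
    using fin by (simp add: sum_prob_marked)
  finally have "AE w in \<Omega>. ?f w \<noteq> \<infinity>"
    by (intro nn_integral_PInf_AE) auto
  moreover have "AE w in \<Omega>. w \<in> space \<Omega>" by (rule AE_space)
  ultimately show ?thesis
  proof eventually_elim
    fix w assume w: "?f w \<noteq> \<infinity>" "w \<in> space \<Omega>"
    have "?f w = (\<integral>\<^sup>+i. indicator {i. (p i w, X i w) \<in> E} i \<partial>count_space UNIV)"
      using w(2) by (subst nn_integral_count_space_nat) (auto intro!: suminf_cong simp: indicator_def)
    also have "\<dots> = emeasure (count_space UNIV) {i. (p i w, X i w) \<in> E}" by simp
    finally show "finite {i. (p i w, X i w) \<in> E}"
      using w(1) by (auto simp: emeasure_count_space split: if_splits)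
  qed
qed

lemma AE_none_marked:
  assumes E: "E \<in> sets (borel \<Otimes>\<^sub>M N)" and null: "emeasure (lborel \<Otimes>\<^sub>M L) E = 0"
  shows "AE w in \<Omega>. \<forall>i. (p i w, X i w) \<notin> E"
proof -
  have "prob {w \<in> space \<Omega>. \<forall>i. (p i w, X i w) \<notin> E} = 1"
    using prob_no_marked_point(2)[OF E] null by (simp add: measure_def)
  then show ?thesis
    using prob_no_marked_point(1)[OF E] null by (subst (asm) prob_Collect_eq_1) auto
qed

end

section \<open>Types of leaves in time\<close>

lemma exp_difference_quotient:
  "(\<lambda>n. (exp (- (a * inverse (real (Suc n)))) - 1) * real (Suc n)) \<longlonglongrightarrow> - a" for a :: real
proof -
  have "((\<lambda>x::real. exp (- (a * x))) has_real_derivative - a) (at 0)"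
    by (auto intro!: derivative_eq_intros)
  then have "((\<lambda>h. (exp (- (a * h)) - 1) / h) \<longlongrightarrow> - a) (at 0)"
    by (simp add: DERIV_def)
  moreover have "filterlim (\<lambda>n. inverse (real (Suc n))) (at 0) sequentially"
    unfolding filterlim_at using LIMSEQ_inverse_real_of_nat by auto
  ultimately have "(\<lambda>n. (exp (- (a * inverse (real (Suc n)))) - 1) / inverse (real (Suc n))) \<longlonglongrightarrow> - a"
    by (rule filterlim_compose)
  then show ?thesis by (simp add: divide_inverse)
qed

text \<open>\<open>Q\<close> is enclosed in measurable sets of vanishing measure, so that its own
  measurability is not at issue.\<close>

lemma (in finite_measure) AE_not_in_if_small:
  assumes "\<And>n. A n \<in> sets M" "(\<lambda>n. measure M (A n)) \<longlonglongrightarrow> 0"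
    and "\<And>n w. w \<in> space M \<Longrightarrow> Q w \<Longrightarrow> w \<in> A n"
  shows "AE w in M. \<not> Q w"
proof (rule AE_I)
  have "measure M (\<Inter>n. A n) \<le> measure M (A n)" for n
    using assms(1) by (intro finite_measure_mono) auto
  then have "measure M (\<Inter>n. A n) \<le> 0"
    using LIMSEQ_le_const[OF assms(2)] by auto
  then show "emeasure M (\<Inter>n. A n) = 0"
    by (simp add: emeasure_eq_measure measure_le_0_iff)
  show "{w \<in> space M. \<not> \<not> Q w} \<subseteq> (\<Inter>n. A n)" using assms(3) by auto
  show "(\<Inter>n. A n) \<in> sets M" using assms(1) by auto
qed

text \<open>Abstraction of the leaves: \<open>t i w\<close> is the time of leaf \<open>i\<close>,
  \<open>b i w\<close> its trace on \<open>S\<close>, and \<open>m B\<close> the intensity in time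
  of the leaves with trace \<open>B\<close>. The process enters through void probabilities only, and
  only for nonempty traces, since the leaves missing \<open>S\<close> are too numerous to have
  finite intensity.\<close>

locale type_process = prob_space \<Omega> for \<Omega> :: "'w measure" +
  fixes S :: "'s set" and t :: "nat \<Rightarrow> 'w \<Rightarrow> real" and b :: "nat \<Rightarrow> 'w \<Rightarrow> 's set"
    and m :: "'s set \<Rightarrow> real"
  assumes finite_S: "finite S"
    and m_nonneg: "\<And>B. 0 \<le> m B"
    and void_sets: "\<And>E. (\<And>B. E B \<in> sets borel) \<Longrightarrow> (\<And>B. emeasure lborel (E B) < \<infinity>) \<Longrightarrow>
      {w \<in> space \<Omega>. \<forall>i. b i w \<in> Pow S - {{}} \<longrightarrow> t i w \<notin> E (b i w)} \<in> sets \<Omega>"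
    and void_prob: "\<And>E. (\<And>B. E B \<in> sets borel) \<Longrightarrow> (\<And>B. emeasure lborel (E B) < \<infinity>) \<Longrightarrow>
      prob {w \<in> space \<Omega>. \<forall>i. b i w \<in> Pow S - {{}} \<longrightarrow> t i w \<notin> E (b i w)} =
        exp (- (\<Sum>B\<in>Pow S - {{}}. m B * measure lborel (E B)))"
begin

definition void :: "('s set \<Rightarrow> real set) \<Rightarrow> 'w set" where
  "void E = {w \<in> space \<Omega>. \<forall>i. b i w \<in> Pow S - {{}} \<longrightarrow> t i w \<notin> E (b i w)}"

definition time_sets :: "real set \<Rightarrow> ('s set \<Rightarrow> real set) set" where
  "time_sets T = {E. \<forall>B. E B \<in> sets borel \<and> emeasure lborel (E B) < \<infinity> \<and> E B \<subseteq> T}"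

text \<open>Events decided by the leaves hitting \<open>S\<close> at times in \<open>T\<close>. Void
  events generate it because theirs are the probabilities that are given.\<close>

definition window_algebra :: "real set \<Rightarrow> 'w set set" where
  "window_algebra T = sigma_sets (space \<Omega>) (void ` time_sets T)"

lemma void_events: "E \<in> time_sets T \<Longrightarrow> void E \<in> events"
  unfolding void_def time_sets_def by (intro void_sets) auto

lemma prob_void: "E \<in> time_sets T \<Longrightarrow>
    prob (void E) = exp (- (\<Sum>B\<in>Pow S - {{}}. m B * measure lborel (E B)))"
  unfolding void_def time_sets_def by (intro void_prob) auto

lemma window_algebra_events: "window_algebra T \<subseteq> events"
  unfolding window_algebra_def by (rule sets.sigma_sets_subset) (auto intro: void_events)

lemma sigma_algebra_window: "sigma_algebra (space \<Omega>) (window_algebra T)"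
  unfolding window_algebra_def
  by (rule sigma_algebra_sigma_sets) (auto simp: void_def)

lemma time_sets_Un:
  assumes "E \<in> time_sets T" "E' \<in> time_sets T'"
  shows "(\<lambda>B. E B \<union> E' B) \<in> time_sets (T \<union> T')"
proof -
  have "emeasure lborel (E B \<union> E' B) < \<infinity>" for B
  proof -
    have "emeasure lborel (E B \<union> E' B) \<le> emeasure lborel (E B) + emeasure lborel (E' B)"
      using assms by (intro emeasure_subadditive) (auto simp: time_sets_def)
    also have "\<dots> < \<infinity>" using assms by (auto simp: time_sets_def ennreal_add_less_top)
    finally show ?thesis .
  qed
  then show ?thesis using assms by (auto simp: time_sets_def)
qed

lemma void_Int: "void E \<inter> void E' = void (\<lambda>B. E B \<union> E' B)"
  by (auto simp: void_def)

text \<open>Void events are stable under intersection, so it suffices to compare them. For disjoint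
  time sets the measures add up in the exponent, hence the probabilities multiply.\<close>

lemma indep_windows:
  assumes "T \<inter> T' = {}"
  shows "indep_set (window_algebra T) (window_algebra T')"
  unfolding window_algebra_def
proof (rule indep_set_sigma_sets)
  show "Int_stable (void ` time_sets T)" "Int_stable (void ` time_sets T')"
    using time_sets_Un[of _ T _ T] time_sets_Un[of _ T' _ T'] by (auto simp: Int_stable_def void_Int)
  show "indep_set (void ` time_sets T) (void ` time_sets T')"
  proof (rule indep_setI)
    show "void ` time_sets T \<subseteq> events" "void ` time_sets T' \<subseteq> events" by (auto intro: void_events)
    fix A A' assume "A \<in> void ` time_sets T" "A' \<in> void ` time_sets T'"
    then obtain E E' where E: "E \<in> time_sets T" "A = void E" "E' \<in> time_sets T'" "A' = void E'" by auto
    have "measure lborel (E B \<union> E' B) = measure lborel (E B) + measure lborel (E' B)" for B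
    proof (rule measure_Union)
      have "E B \<in> sets borel" "emeasure lborel (E B) < \<infinity>" "E B \<subseteq> T"
        "E' B \<in> sets borel" "emeasure lborel (E' B) < \<infinity>" "E' B \<subseteq> T'"
        using E(1,3) by (auto simp: time_sets_def)
      then show "E B \<in> sets lborel" "E' B \<in> sets lborel" "emeasure lborel (E B) \<noteq> \<infinity>"
        "emeasure lborel (E' B) \<noteq> \<infinity>" "E B \<inter> E' B = {}" using assms by auto
    qed
    then show "prob (A \<inter> A') = prob A * prob A'"
      using prob_void[OF time_sets_Un[OF E(1,3)]] prob_void[OF E(1)] prob_void[OF E(3)]
      by (simp add: E(2,4) void_Int exp_add[symmetric] sum.distrib[symmetric] algebra_simps)
  qed
qed

definition quiet :: "'s set set \<Rightarrow> real \<Rightarrow> real \<Rightarrow> 'w set" where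
  "quiet \<T> a c = {w \<in> space \<Omega>. \<forall>i. b i w \<in> \<T> \<longrightarrow> \<not> (a < t i w \<and> t i w \<le> c)}"

lemma quiet_void:
  assumes "\<T> \<subseteq> Pow S - {{}}"
  shows "quiet \<T> a c = void (\<lambda>B. if B \<in> \<T> then {a<..c} else {})"
  using assms by (auto simp: quiet_def void_def subset_iff)

lemma time_sets_interval:
  assumes "{a<..c} \<subseteq> T"
  shows "(\<lambda>B. if B \<in> \<T> then {a<..c} else {}) \<in> time_sets T"
  using assms by (cases "a \<le> c") (auto simp: time_sets_def)

lemma quiet_window:
  assumes "\<T> \<subseteq> Pow S - {{}}" "{a<..c} \<subseteq> T"
  shows "quiet \<T> a c \<in> window_algebra T"
  unfolding quiet_void[OF assms(1)] window_algebra_def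
  using time_sets_interval[OF assms(2)] by (intro sigma_sets.Basic) auto

lemma quiet_events: "\<T> \<subseteq> Pow S - {{}} \<Longrightarrow> quiet \<T> a c \<in> events"
  using quiet_window[of \<T> a c UNIV] window_algebra_events by auto

lemma prob_quiet:
  assumes "\<T> \<subseteq> Pow S - {{}}" "a \<le> c"
  shows "prob (quiet \<T> a c) = exp (- ((\<Sum>B\<in>\<T>. m B) * (c - a)))"
proof -
  have "(\<Sum>B\<in>Pow S - {{}}. m B * measure lborel (if B \<in> \<T> then {a<..c} else {})) =
    (\<Sum>B\<in>Pow S - {{}}. if B \<in> \<T> then m B * (c - a) else 0)"
    using assms by (intro sum.cong) auto
  also have "\<dots> = (\<Sum>B\<in>\<T>. m B * (c - a))"
    using finite_S assms by (subst sum.inter_restrict[symmetric]) (auto simp: Int_absorb1)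
  finally show ?thesis
    unfolding quiet_void[OF assms(1)]
    using prob_void[OF time_sets_interval[of a c UNIV \<T>]] by (simp add: sum_distrib_right)
qed

definition sep :: "'s \<Rightarrow> 's \<Rightarrow> 's set set" where
  "sep x y = {B \<in> Pow S. (x \<in> B) \<noteq> (y \<in> B)}"
definition both :: "'s \<Rightarrow> 's \<Rightarrow> 's set set" where
  "both x y = {B \<in> Pow S. x \<in> B \<and> y \<in> B}"
definition hits :: "'s set \<Rightarrow> 's set set" where
  "hits U = {B \<in> Pow S. B \<inter> U \<noteq> {}}"
definition traces :: "'s set \<Rightarrow> 's set \<Rightarrow> 's set set" where
  "traces U D = {B \<in> Pow S. B \<inter> U = D}"

lemma type_classes_subset:
  "sep x y \<subseteq> Pow S - {{}}" "both x y \<subseteq> Pow S - {{}}" "hits U \<subseteq> Pow S - {{}}"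
  "D \<noteq> {} \<Longrightarrow> traces U D \<subseteq> Pow S - {{}}"
  by (auto simp: sep_def both_def hits_def traces_def)

lemma type_classes_disjoint: "sep x y \<inter> both x y = {}"
  by (auto simp: sep_def both_def)

text \<open>Some leaf covers both points, and going back in time from \<open>c\<close> none separates them before that.
  Up to a null event this says that \<open>x\<close> and \<open>y\<close> see the same leaf at time \<open>c\<close>; it is expressed by
  void events only.\<close>

definition same :: "real \<Rightarrow> 's \<Rightarrow> 's \<Rightarrow> 'w set" where
  "same c x y = (\<Union>q\<in>{q\<in>\<rat>. 0 < q}. quiet (sep x y) (c - q) c - quiet (both x y) (c - q) c)"

text \<open>\<open>K\<close> is a candidate for the relation of seeing the same leaf. Variable
  \<open>c\<close> and \<open>U\<close> make the recursion close up: peeling off a slice of time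
  lowers \<open>c\<close>, and removing a block shrinks \<open>U\<close>.\<close>

definition good :: "('s \<times> 's) set \<Rightarrow> real \<Rightarrow> 's set \<Rightarrow> 'w set" where
  "good K c U = {w \<in> space \<Omega>. \<forall>x\<in>U. \<forall>y\<in>U. (x, y) \<in> K \<longleftrightarrow> w \<in> same c x y}"

lemma same_window: "same c x y \<in> window_algebra {..c}"
proof -
  interpret W: sigma_algebra "space \<Omega>" "window_algebra {..c}" by (rule sigma_algebra_window)
  show ?thesis
    unfolding same_def using countable_subset[of "{q \<in> \<rat>. 0 < q}" \<rat>] countable_rat
    by (intro W.countable_UN'' W.Diff quiet_window type_classes_subset) auto
qed

lemma good_window:
  assumes "U \<subseteq> S"
  shows "good K c U \<in> window_algebra {..c}"
proof -
  interpret W: sigma_algebra "space \<Omega>" "window_algebra {..c}" by (rule sigma_algebra_window)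
  have U: "finite U" using assms finite_S by (rule finite_subset)
  have "same c x y \<subseteq> space \<Omega>" for x y by (auto simp: same_def quiet_def)
  then have "{w \<in> space \<Omega>. (x, y) \<in> K \<longleftrightarrow> w \<in> same c x y} =
      (if (x, y) \<in> K then same c x y else space \<Omega> - same c x y)" for x y by auto
  then have "{w \<in> space \<Omega>. (x, y) \<in> K \<longleftrightarrow> w \<in> same c x y} \<in> window_algebra {..c}" for x y
    using same_window by auto
  then show ?thesis
    unfolding good_def using U by (intro W.sets_Collect_finite_All W.sets_Collect_finite_All') auto
qed

lemma same_earlier:
  assumes q: "q \<in> \<rat>" "0 < q" and w: "w \<in> quiet (sep x y) (c - q) c" "w \<in> quiet (both x y) (c - q) c"
  shows "w \<in> same c x y \<longleftrightarrow> w \<in> same (c - q) x y"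
proof
  assume "w \<in> same c x y"
  then obtain q' where q': "q' \<in> \<rat>" "0 < q'" "w \<in> quiet (sep x y) (c - q') c"
    "w \<notin> quiet (both x y) (c - q') c" by (auto simp: same_def)
  then obtain i where i: "b i w \<in> both x y" "c - q' < t i w" "t i w \<le> c" by (auto simp: quiet_def)
  then have "t i w \<le> c - q" using w(2) by (force simp: quiet_def)
  then have "w \<notin> quiet (both x y) (c - q - (q' - q)) (c - q)" "q < q'"
    using i by (auto simp: quiet_def)
  moreover have "w \<in> quiet (sep x y) (c - q - (q' - q)) (c - q)"
    using q' q by (auto simp: quiet_def)
  moreover have "q' - q \<in> \<rat>" using q q' by simp
  ultimately show "w \<in> same (c - q) x y" unfolding same_def by (intro UN_I[of "q' - q"]) auto
next
  assume "w \<in> same (c - q) x y"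
  then obtain q' where q': "q' \<in> \<rat>" "0 < q'" "w \<in> quiet (sep x y) (c - q - q') (c - q)"
    "w \<notin> quiet (both x y) (c - q - q') (c - q)" by (auto simp: same_def)
  have "w \<in> quiet (sep x y) (c - (q' + q)) c"
    using q'(3) w(1) by (force simp: quiet_def)
  moreover have "w \<notin> quiet (both x y) (c - (q' + q)) c"
    using q'(3,4) q by (force simp: quiet_def)
  moreover have "q' + q \<in> \<rat>" using q q' by simp
  ultimately show "w \<in> same c x y" unfolding same_def using q q' by (intro UN_I[of "q' + q"]) auto
qed

lemma good_quiet:
  assumes q: "q \<in> \<rat>" "0 < q" and w: "w \<in> quiet (hits U) (c - q) c" and U: "U \<subseteq> S"
  shows "w \<in> good K c U \<longleftrightarrow> w \<in> good K (c - q) U"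
proof -
  have "w \<in> same c x y \<longleftrightarrow> w \<in> same (c - q) x y" if "x \<in> U" "y \<in> U" for x y
    using w that by (intro same_earlier q) (auto simp: quiet_def sep_def both_def hits_def)
  then show ?thesis by (auto simp: good_def)
qed

text \<open>For an equivalence relation on \<open>U\<close>, the nonempty
  \<open>D \<subseteq> U\<close> with this property are its classes. \<open>K\<close> is an
  arbitrary relation, hence both orders of a pair.\<close>

definition block :: "('s \<times> 's) set \<Rightarrow> 's set \<Rightarrow> 's set \<Rightarrow> bool" where
  "block K U D \<longleftrightarrow> (\<forall>x\<in>D. \<forall>y\<in>U. ((x, y) \<in> K \<longleftrightarrow> y \<in> D) \<and> ((y, x) \<in> K \<longleftrightarrow> y \<in> D))"

text \<open>In such a slice some leaf hits \<open>U\<close>, and all leaves that do so cover exactly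
  \<open>D\<close>. Hence the points of \<open>D\<close> see a common leaf, no other point of
  \<open>U\<close> sees it, and the partition of \<open>U - D\<close> is decided before the
  slice.\<close>

lemma good_pure:
  assumes q: "q \<in> \<rat>" "0 < q" and U: "U \<subseteq> S" and D: "D \<subseteq> U" "D \<noteq> {}"
    and w: "w \<in> quiet (hits U - traces U D) (c - q) c" "w \<notin> quiet (traces U D) (c - q) c"
  shows "w \<in> good K c U \<longleftrightarrow> block K U D \<and> w \<in> good K (c - q) (U - D)"
proof -
  have ws: "w \<in> space \<Omega>" using w by (auto simp: quiet_def)
  have trace: "B \<inter> U = D" if "b i w = B" "B \<subseteq> S" "B \<inter> U \<noteq> {}" "c - q < t i w" "t i w \<le> c" for i B
  proof (rule ccontr)
    assume "B \<inter> U \<noteq> D"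
    then have "b i w \<in> hits U - traces U D" using that by (auto simp: hits_def traces_def)
    then show False using w(1) that by (auto simp: quiet_def)
  qed
  obtain j where j: "b j w \<subseteq> S" "b j w \<inter> U = D" "c - q < t j w" "t j w \<le> c"
    using w(2) ws by (auto simp: quiet_def traces_def)
  have in1: "w \<in> same c x y" if "x \<in> D" "y \<in> D" for x y
  proof -
    have "w \<in> quiet (sep x y) (c - q) c"
      unfolding quiet_def
    proof (intro CollectI conjI allI impI notI ws)
      fix i assume i: "b i w \<in> sep x y" "c - q < t i w \<and> t i w \<le> c"
      then have "b i w \<inter> U = D" using that D by (intro trace[of i]) (auto simp: sep_def)
      then show False using i(1) that by (auto simp: sep_def)
    qed
    moreover have "w \<notin> quiet (both x y) (c - q) c"
      using j that by (auto simp: quiet_def both_def)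
    ultimately show ?thesis using q by (auto simp: same_def)
  qed
  have out: "w \<notin> same c x y" "w \<notin> same c y x" if "x \<in> D" "y \<in> U - D" for x y
  proof -
    \<comment> \<open>A leaf covering both points must precede the slice, and then leaf
      \<open>j\<close> of the slice separates the points at a later time.\<close>
    have *: "w \<in> quiet (both x y) (c - q') c" if q': "w \<in> quiet (sep x y) (c - q') c" for q'
    proof (rule ccontr)
      assume "w \<notin> quiet (both x y) (c - q') c"
      then obtain i where i: "b i w \<in> both x y" "c - q' < t i w" "t i w \<le> c" using ws by (auto simp: quiet_def)
      have "t i w \<le> c - q"
      proof (rule ccontr)
        assume "\<not> t i w \<le> c - q"
        then have "b i w \<inter> U = D" using i \<open>x \<in> D\<close> D by (intro trace[of i]) (auto simp: both_def)
        then show False using i(1) \<open>y \<in> U - D\<close> by (auto simp: both_def)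
      qed
      then have "c - q' < t j w" using i(2) j(3) by linarith
      moreover have "b j w \<in> sep x y" using j \<open>x \<in> D\<close> \<open>y \<in> U - D\<close> by (auto simp: sep_def)
      ultimately show False using q' j(4) by (auto simp: quiet_def)
    qed
    have "sep y x = sep x y" "both y x = both x y" by (auto simp: sep_def both_def)
    then show "w \<notin> same c x y" "w \<notin> same c y x" using * by (auto simp: same_def)
  qed
  have rest: "w \<in> same c x y \<longleftrightarrow> w \<in> same (c - q) x y" if "x \<in> U - D" "y \<in> U - D" for x y
  proof (rule same_earlier[OF q])
    have *: False if "b i w \<subseteq> S" "x \<in> b i w \<or> y \<in> b i w" "c - q < t i w" "t i w \<le> c" for i
    proof -
      have "b i w \<inter> U = D" using that \<open>x \<in> U - D\<close> \<open>y \<in> U - D\<close> by (intro trace[of i]) auto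
      then show False using that \<open>x \<in> U - D\<close> \<open>y \<in> U - D\<close> by blast
    qed
    then show "w \<in> quiet (sep x y) (c - q) c" "w \<in> quiet (both x y) (c - q) c"
      using ws by (auto simp: quiet_def sep_def both_def)
  qed
  show ?thesis
  proof
    assume g: "w \<in> good K c U"
    have "block K U D"
      unfolding block_def
    proof (intro ballI)
      fix x y assume xy: "x \<in> D" "y \<in> U"
      then have "(x, y) \<in> K \<longleftrightarrow> w \<in> same c x y" "(y, x) \<in> K \<longleftrightarrow> w \<in> same c y x"
        using g D by (auto simp: good_def)
      then show "((x, y) \<in> K \<longleftrightarrow> y \<in> D) \<and> ((y, x) \<in> K \<longleftrightarrow> y \<in> D)"
        using in1[of x y] in1[of y x] out[of x y] xy by blast
    qed
    moreover have "w \<in> good K (c - q) (U - D)"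
      using g rest by (auto simp: good_def)
    ultimately show "block K U D \<and> w \<in> good K (c - q) (U - D)" ..
  next
    assume r: "block K U D \<and> w \<in> good K (c - q) (U - D)"
    have "(x, y) \<in> K \<longleftrightarrow> w \<in> same c x y" if "x \<in> U" "y \<in> U" for x y
    proof (cases "x \<in> D \<or> y \<in> D")
      case True
      then show ?thesis using r that in1[of x y] out[of x y] out[of y x] unfolding block_def by blast
    next
      case False
      then show ?thesis using r that rest[of x y] unfolding good_def by blast
    qed
    then show "w \<in> good K c U" using ws by (auto simp: good_def)
  qed
qed

section \<open>Thin time slices and the recursion for the partition\<close>

definition rate :: "'s set \<Rightarrow> real" where
  "rate U = (\<Sum>B\<in>hits U. m B)"
definition trace_rate :: "'s set \<Rightarrow> 's set \<Rightarrow> real" where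
  "trace_rate U D = (\<Sum>B\<in>traces U D. m B)"

lemma rate_split: "rate U = (\<Sum>D\<in>Pow U - {{}}. trace_rate U D)" if "U \<subseteq> S"
proof -
  have fin: "finite U" using that finite_S by (rule finite_subset)
  have "hits U = (\<Union>D\<in>Pow U - {{}}. traces U D)" by (auto simp: hits_def traces_def)
  then show ?thesis
    unfolding rate_def trace_rate_def using finite_S fin
    by (simp only:) (rule sum.UNION_disjoint, auto simp: traces_def)
qed

text \<open>\<open>D = {}\<close> stands for a slice without leaves hitting \<open>U\<close>. Slices
  containing leaves with two different nonempty traces belong to none of these events.\<close>

definition slice_event :: "'s set \<Rightarrow> real \<Rightarrow> real \<Rightarrow> 's set \<Rightarrow> 'w set" where
  "slice_event U c q D = (if D = {} then quiet (hits U) (c - q) c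
     else quiet (hits U - traces U D) (c - q) c - quiet (traces U D) (c - q) c)"

lemma slice_event_window: "slice_event U c q D \<in> window_algebra {c - q<..}"
proof -
  interpret W: sigma_algebra "space \<Omega>" "window_algebra {c - q<..}" by (rule sigma_algebra_window)
  show ?thesis
  proof (cases "D = {}")
    case True
    then show ?thesis
      by (auto simp: slice_event_def intro!: quiet_window[OF type_classes_subset(3)])
  next
    case False
    have h: "hits U - traces U D \<subseteq> Pow S - {{}}" "traces U D \<subseteq> Pow S - {{}}"
      using type_classes_subset(3)[of U] type_classes_subset(4)[OF False, of U] by blast+
    show ?thesis
      by (simp add: slice_event_def False, intro W.Diff quiet_window h) auto
  qed
qed

text \<open>A difference of two void probabilities: no nonempty trace other than \<open>D\<close>
  occurs, minus no hit at all.\<close>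

lemma prob_slice_event:
  assumes U: "U \<subseteq> S" and D: "D \<subseteq> U" "D \<noteq> {}" and q: "0 \<le> q"
  shows "prob (slice_event U c q D) = exp (- ((rate U - trace_rate U D) * q)) - exp (- (rate U * q))"
proof -
  have fh: "finite (hits U)" using finite_S by (auto simp: hits_def)
  have sub: "traces U D \<subseteq> hits U" using D by (auto simp: traces_def hits_def)
  have "prob (slice_event U c q D) = prob (quiet (hits U - traces U D) (c - q) c) - prob (quiet (hits U) (c - q) c)"
  proof -
    have "quiet (hits U - traces U D) (c - q) c - quiet (traces U D) (c - q) c =
      quiet (hits U - traces U D) (c - q) c - quiet (hits U) (c - q) c"
      using sub by (auto simp: quiet_def)
    moreover have "quiet (hits U) (c - q) c \<subseteq> quiet (hits U - traces U D) (c - q) c"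
      by (auto simp: quiet_def)
    ultimately show ?thesis
      unfolding slice_event_def using D type_classes_subset(3)[of U]
      by (simp only: if_False) (rule finite_measure_Diff, auto intro!: quiet_events)
  qed
  also have "\<dots> = exp (- ((rate U - trace_rate U D) * q)) - exp (- (rate U * q))"
    using type_classes_subset(3)[of U] q sub fh
    by (subst (1 2) prob_quiet) (auto simp: rate_def trace_rate_def sum_diff)
  finally show ?thesis .
qed

lemma prob_slice_event_empty:
  assumes "0 \<le> q"
  shows "prob (slice_event U c q {}) = exp (- (rate U * q))"
  unfolding slice_event_def using type_classes_subset(3)[of U] assms
  by (simp add: prob_quiet rate_def)

lemma disjoint_slice_events: "disjoint_family_on (slice_event U c q) (Pow U)"
proof -
  have *: "slice_event U c q D \<inter> slice_event U c q D' = {}" if H: "D \<noteq> D'" "D \<subseteq> U" "D' \<subseteq> U" "D \<noteq> {}" for D D'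
  proof (rule ccontr)
    assume "slice_event U c q D \<inter> slice_event U c q D' \<noteq> {}"
    then obtain w where w: "w \<in> slice_event U c q D" "w \<in> slice_event U c q D'" by auto
    then obtain i where i: "b i w \<in> traces U D" "c - q < t i w" "t i w \<le> c"
      using H by (auto simp: slice_event_def quiet_def)
    then have "b i w \<in> hits U" "b i w \<notin> traces U D'" using H by (auto simp: traces_def hits_def)
    then show False using w(2) i by (auto simp: slice_event_def quiet_def split: if_splits)
  qed
  show ?thesis unfolding disjoint_family_on_def using * by blast
qed

text \<open>Split along the slice events, which are independent of the partition seen from
  \<open>c - q\<close>. What remains is a slice with several traces, and its probability bounds the
  error.\<close>

lemma prob_good_step:
  assumes q: "q \<in> \<rat>" "0 < q" and U: "U \<subseteq> S"
    and r: "r = (\<Sum>D | D \<subseteq> U \<and> D \<noteq> {} \<and> block K U D.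
      prob (slice_event U c q D) * prob (good K (c - q) (U - D)))"
  shows "\<bar>prob (good K c U) - exp (- (rate U * q)) * prob (good K (c - q) U) - r\<bar> \<le>
    1 - (\<Sum>D\<in>Pow U. prob (slice_event U c q D))"
proof -
  have fU: "finite U" using U finite_S by (rule finite_subset)
  let ?A = "slice_event U c q"
  have Ae: "?A D \<in> events" for D using slice_event_window window_algebra_events by blast
  have ge: "good K c' U' \<in> events" if "U' \<subseteq> S" for c' U'
    using good_window[OF that] window_algebra_events by blast
  have indep: "prob (good K (c - q) U' \<inter> ?A D) = prob (good K (c - q) U') * prob (?A D)" if "U' \<subseteq> S" for U' D
    by (rule indep_setD[OF indep_windows good_window[OF that] slice_event_window]) auto
  have e0: "prob (good K c U \<inter> ?A {}) = exp (- (rate U * q)) * prob (good K (c - q) U)"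
  proof -
    have "good K c U \<inter> ?A {} = good K (c - q) U \<inter> ?A {}"
      using good_quiet[OF q _ U] by (auto simp: slice_event_def)
    then show ?thesis using indep[OF U] q by (simp add: prob_slice_event_empty)
  qed
  have eD: "prob (good K c U \<inter> ?A D) = (if block K U D then prob (?A D) * prob (good K (c - q) (U - D)) else 0)"
    if "D \<subseteq> U" "D \<noteq> {}" for D
  proof -
    have "good K c U \<inter> ?A D = (if block K U D then good K (c - q) (U - D) \<inter> ?A D else {})"
      using good_pure[OF q U that] that by (auto simp: slice_event_def)
    moreover have "U - D \<subseteq> S" using U by auto
    ultimately show ?thesis using indep[of "U - D" D] by (simp add: mult.commute)
  qed
  have dj: "disjoint_family_on ?A (Pow U)" by (rule disjoint_slice_events)
  let ?V = "\<Union>D\<in>Pow U. ?A D"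
  have V[measurable]: "?V \<in> events" using fU Ae by auto
  have pV: "prob ?V = (\<Sum>D\<in>Pow U. prob (?A D))"
    using fU Ae dj by (intro finite_measure_finite_Union) auto
  have "prob (good K c U \<inter> ?V) = prob (\<Union>D\<in>Pow U. good K c U \<inter> ?A D)"
    by (rule arg_cong[where f = prob]) auto
  also have "\<dots> = (\<Sum>D\<in>Pow U. prob (good K c U \<inter> ?A D))"
    using fU Ae dj ge[OF U] by (intro finite_measure_finite_Union) (auto simp: disjoint_family_on_def)
  also have "\<dots> = prob (good K c U \<inter> ?A {}) + (\<Sum>D\<in>Pow U - {{}}. prob (good K c U \<inter> ?A D))"
    using fU by (subst sum.remove[of _ "{}"]) auto
  also have "(\<Sum>D\<in>Pow U - {{}}. prob (good K c U \<inter> ?A D)) =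
     (\<Sum>D\<in>Pow U - {{}}. if block K U D then prob (?A D) * prob (good K (c - q) (U - D)) else 0)"
    by (intro sum.cong) (auto simp: eD)
  also have "\<dots> = r"
    unfolding r using fU by (subst sum.inter_filter[symmetric]) (auto intro!: sum.cong)
  finally have 1: "prob (good K c U \<inter> ?V) = exp (- (rate U * q)) * prob (good K (c - q) U) + r"
    by (simp add: e0)
  have 2: "prob (good K c U) = prob (good K c U \<inter> ?V) + prob (good K c U - ?V)"
    using ge[OF U] V by (subst finite_measure_Union[symmetric]) (auto intro!: arg_cong[where f = prob])
  have 3: "prob (good K c U - ?V) \<le> prob (space \<Omega> - ?V)"
    by (rule finite_measure_mono) (auto simp: good_def)
  show ?thesis
    using 1 2 3 prob_compl[OF V] pV measure_nonneg[of \<Omega> "good K c U - ?V"] by simp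
qed

text \<open>In a thin time slice of length \<open>q\<close>, leaves of two different traces occur with probability \<open>o(q)\<close>
  only. Hence the largest deviation of \<open>prob (good K c U)\<close> from its presumed value, over all times \<open>c\<close>,
  is at most \<open>exp (- (rate U * q))\<close> times itself plus \<open>o(q)\<close>, so it vanishes.\<close>

lemma prob_good_recursion_aux:
  assumes U: "U \<subseteq> S" and pos: "0 < rate U"
    and IH: "\<And>D c. D \<subseteq> U \<Longrightarrow> D \<noteq> {} \<Longrightarrow> prob (good K c (U - D)) = g (U - D)"
  shows "prob (good K c U) = (\<Sum>D | D \<subseteq> U \<and> D \<noteq> {} \<and> block K U D. trace_rate U D * g (U - D)) / rate U"
proof -
  let ?B = "{D. D \<subseteq> U \<and> D \<noteq> {} \<and> block K U D}"
  have fU: "finite U" using U finite_S by (rule finite_subset)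
  define k where "k = (\<Sum>D\<in>?B. trace_rate U D * g (U - D)) / rate U"
  define d where "d = (SUP c. \<bar>prob (good K c U) - k\<bar>)"
  have bdd: "bdd_above (range (\<lambda>c. \<bar>prob (good K c U) - k\<bar>))"
    by (rule bdd_aboveI2[of _ _ "1 + \<bar>k\<bar>"]) (smt (verit) measure_nonneg prob_le_1)
  have dle: "\<bar>prob (good K c U) - k\<bar> \<le> d" for c
    unfolding d_def by (rule cSUP_upper[OF _ bdd]) simp
  \<comment> \<open>\<open>\<pi>\<close> is the probability of a slice with trace \<open>D\<close>
    only, \<open>\<rho>\<close> that of a slice with several traces, and \<open>\<sigma>\<close> the
    amount by which the constant \<open>k\<close> fails the one-step equation. Divided by
    \<open>q\<close> they tend to \<open>trace_rate U D\<close>, 0 and 0, the last by the choice of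
    \<open>k\<close>.\<close>
  define \<pi> where "\<pi> q D = exp (- ((rate U - trace_rate U D) * q)) - exp (- (rate U * q))" for q D
  define \<rho> where "\<rho> q = 1 - exp (- (rate U * q)) - (\<Sum>D\<in>Pow U - {{}}. \<pi> q D)" for q
  define \<sigma> where "\<sigma> q = k * (exp (- (rate U * q)) - 1) + (\<Sum>D\<in>?B. \<pi> q D * g (U - D))" for q
  have step: "d * (1 - exp (- (rate U * q))) \<le> \<bar>\<sigma> q\<bar> + \<rho> q" if q: "q \<in> \<rat>" "0 < q" for q
  proof -
    have "\<bar>prob (good K c U) - k\<bar> \<le> exp (- (rate U * q)) * d + \<bar>\<sigma> q\<bar> + \<rho> q" for c
    proof -
      let ?e = "exp (- (rate U * q))" and ?P = "prob (good K (c - q) U)"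
      have "(\<Sum>D\<in>?B. prob (slice_event U c q D) * prob (good K (c - q) (U - D))) = (\<Sum>D\<in>?B. \<pi> q D * g (U - D))"
        using U q by (intro sum.cong) (auto simp: prob_slice_event IH \<pi>_def)
      moreover have "(\<Sum>D\<in>Pow U. prob (slice_event U c q D)) = ?e + (\<Sum>D\<in>Pow U - {{}}. \<pi> q D)"
        using fU U q by (subst sum.remove[of _ "{}"])
          (auto simp: prob_slice_event_empty prob_slice_event \<pi>_def intro!: sum.cong)
      ultimately have "\<bar>prob (good K c U) - ?e * ?P - (\<Sum>D\<in>?B. \<pi> q D * g (U - D))\<bar> \<le> \<rho> q"
        using prob_good_step[OF q U refl, of K c] by (simp add: \<rho>_def)
      moreover have "prob (good K c U) - k = (prob (good K c U) - ?e * ?P - (\<Sum>D\<in>?B. \<pi> q D * g (U - D)))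
        + ?e * (?P - k) + \<sigma> q" by (simp add: \<sigma>_def algebra_simps)
      moreover have "\<bar>?e * (?P - k)\<bar> \<le> ?e * d"
        using dle[of "c - q"] by (simp add: abs_mult)
      ultimately show ?thesis by linarith
    qed
    then have "d \<le> exp (- (rate U * q)) * d + \<bar>\<sigma> q\<bar> + \<rho> q"
      unfolding d_def by (intro cSUP_least) auto
    then show ?thesis by (simp add: algebra_simps)
  qed
  let ?q = "\<lambda>n. inverse (real (Suc n))"
  have e: "(\<lambda>n. (exp (- (a * ?q n)) - 1) * real (Suc n)) \<longlonglongrightarrow> - a" for a :: real
    by (rule exp_difference_quotient)
  have \<pi>lim: "(\<lambda>n. \<pi> (?q n) D * real (Suc n)) \<longlonglongrightarrow> trace_rate U D" for D
    using tendsto_diff[OF e[of "rate U - trace_rate U D"] e[of "rate U"]]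
    by (simp add: \<pi>_def algebra_simps)
  have "(\<lambda>n. \<rho> (?q n) * real (Suc n)) \<longlonglongrightarrow> rate U - (\<Sum>D\<in>Pow U - {{}}. trace_rate U D)"
    using tendsto_diff[OF tendsto_minus[OF e[of "rate U"]] tendsto_sum[of "Pow U - {{}}", OF \<pi>lim]]
    by (simp add: \<rho>_def algebra_simps sum_distrib_left)
  then have \<rho>lim: "(\<lambda>n. \<rho> (?q n) * real (Suc n)) \<longlonglongrightarrow> 0"
    using rate_split[OF U] by simp
  have "(\<lambda>n. \<sigma> (?q n) * real (Suc n)) \<longlonglongrightarrow> k * (- rate U) + (\<Sum>D\<in>?B. trace_rate U D * g (U - D))"
    using tendsto_add[OF tendsto_mult[OF tendsto_const[of k] e[of "rate U"]]
        tendsto_sum[of ?B, OF tendsto_mult[OF \<pi>lim tendsto_const[of "g (U - D)" for D]]]]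
    by (simp add: \<sigma>_def algebra_simps sum_distrib_left)
  then have \<sigma>lim: "(\<lambda>n. \<sigma> (?q n) * real (Suc n)) \<longlonglongrightarrow> 0" using pos by (simp add: k_def)
  have "d * rate U \<le> 0"
  proof (rule LIMSEQ_le)
    show "(\<lambda>n. d * (1 - exp (- (rate U * ?q n))) * real (Suc n)) \<longlonglongrightarrow> d * rate U"
      using tendsto_mult[OF tendsto_const[of d] tendsto_minus[OF e[of "rate U"]]]
      by (simp add: algebra_simps)
    show "(\<lambda>n. \<bar>\<sigma> (?q n) * real (Suc n)\<bar> + \<rho> (?q n) * real (Suc n)) \<longlonglongrightarrow> 0"
      using tendsto_add[OF tendsto_rabs[OF \<sigma>lim] \<rho>lim] by simp
    have "d * (1 - exp (- (rate U * ?q n))) * real (Suc n) \<le> (\<bar>\<sigma> (?q n)\<bar> + \<rho> (?q n)) * real (Suc n)" for n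
      by (intro mult_right_mono step) auto
    then show "\<exists>N. \<forall>n\<ge>N. d * (1 - exp (- (rate U * ?q n))) * real (Suc n) \<le>
        \<bar>\<sigma> (?q n) * real (Suc n)\<bar> + \<rho> (?q n) * real (Suc n)"
      by (intro exI[of _ 0] allI impI) (simp only: abs_mult distrib_right abs_of_nat)
  qed
  then have "d \<le> 0" using pos by (simp add: mult_le_0_iff)
  then show ?thesis using dle[of c] by (simp add: k_def)
qed

lemma rate_mono: "U \<subseteq> V \<Longrightarrow> rate U \<le> rate V"
  unfolding rate_def using finite_S m_nonneg by (intro sum_mono2) (auto simp: hits_def)

text \<open>Stationarity in time, by induction on \<open>U\<close>: the value given by the recursion
  involves \<open>c\<close> only through smaller sets.\<close>

lemma prob_good_const:
  assumes pos: "\<And>x. x \<in> S \<Longrightarrow> 0 < rate {x}" and U: "U \<subseteq> S"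
  shows "prob (good K c U) = prob (good K 0 U)"
proof -
  have "finite U" using U finite_S by (rule finite_subset)
  then show ?thesis using U
  proof (induction U arbitrary: c rule: finite_psubset_induct)
    case (psubset U)
    show ?case
    proof (cases "U = {}")
      case False
      then obtain x where "x \<in> U" by auto
      then have r: "0 < rate U" using pos psubset.prems rate_mono[of "{x}" U] by fastforce
      have IH: "prob (good K c (U - D)) = prob (good K 0 (U - D))" if "D \<subseteq> U" "D \<noteq> {}" for D c
        using that psubset by (intro psubset.IH) auto
      show ?thesis
        using prob_good_recursion_aux[OF psubset.prems r IH, of c]
          prob_good_recursion_aux[OF psubset.prems r IH, of 0] by simp
    qed (simp add: good_def)
  qed
qed

lemma prob_good_recursion:
  assumes pos: "\<And>x. x \<in> S \<Longrightarrow> 0 < rate {x}" and U: "U \<subseteq> S" "U \<noteq> {}"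
  shows "prob (good K 0 U) =
    (\<Sum>D | D \<subseteq> U \<and> D \<noteq> {} \<and> block K U D. trace_rate U D / rate U * prob (good K 0 (U - D)))"
proof -
  obtain x where "x \<in> U" using U by auto
  then have r: "0 < rate U" using pos U rate_mono[of "{x}" U] by fastforce
  have "prob (good K c (U - D)) = prob (good K 0 (U - D))" if "D \<subseteq> U" "D \<noteq> {}" for D c
    using U by (intro prob_good_const pos) auto
  from prob_good_recursion_aux[OF U(1) r this] show ?thesis
    by (simp add: sum_divide_distrib)
qed

text \<open>Cut the last \<open>N + 1\<close> units of time into \<open>n + 1\<close> cells of equal
  length. Disjoint classes of types are independent, so for fixed \<open>N\<close> both occur in a
  given cell with probability of order \<open>1 / n^2\<close>, and in some common cell with
  probability of order \<open>1 / n\<close>.\<close>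

lemma AE_no_ties:
  assumes T: "\<T> \<subseteq> Pow S - {{}}" "\<T>' \<subseteq> Pow S - {{}}" "\<T> \<inter> \<T>' = {}"
  shows "AE w in \<Omega>. \<forall>i j. b i w \<in> \<T> \<and> b j w \<in> \<T>' \<and> t i w \<le> 0 \<longrightarrow> t i w \<noteq> t j w"
proof -
  define a where "a = (\<Sum>B\<in>\<T>. m B)"
  define a' where "a' = (\<Sum>B\<in>\<T>'. m B)"
  have a0: "0 \<le> a" "0 \<le> a'" by (auto simp: a_def a'_def intro!: sum_nonneg m_nonneg)
  have "AE w in \<Omega>. \<not> (\<exists>i j. b i w \<in> \<T> \<and> b j w \<in> \<T>' \<and> - real (Suc N) < t i w \<and> t i w \<le> 0 \<and> t i w = t j w)" for N
  proof -
    define \<delta> where "\<delta> n = real (Suc N) / real (Suc n)" for n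
    have \<delta>: "\<delta> n > 0" for n by (simp add: \<delta>_def)
    let ?l = "\<lambda>n k. - (real (Suc k) * \<delta> n)" and ?u = "\<lambda>n k. - (real k * \<delta> n)"
    define Z where "Z n k = (space \<Omega> - quiet \<T> (?l n k) (?u n k)) \<inter> (space \<Omega> - quiet \<T>' (?l n k) (?u n k))" for n k
    have len: "?u n k - ?l n k = \<delta> n" for n k by (simp add: algebra_simps)
    have lu: "?l n k \<le> ?u n k" for n k using \<delta>[of n] by (simp add: algebra_simps)
    have Ze: "Z n k \<in> events" for n k unfolding Z_def using T by (auto intro: quiet_events)
    have PZ: "prob (Z n k) \<le> (a * \<delta> n) * (a' * \<delta> n)" for n k
    proof -
      let ?Q = "quiet \<T> (?l n k) (?u n k)" and ?Q' = "quiet \<T>' (?l n k) (?u n k)"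
      have Q: "?Q \<in> events" "?Q' \<in> events" using T by (auto intro: quiet_events)
      have pQ: "prob ?Q = exp (- (a * \<delta> n))" "prob ?Q' = exp (- (a' * \<delta> n))"
        using prob_quiet[OF T(1) lu] prob_quiet[OF T(2) lu] by (simp_all only: a_def a'_def len)
      have "?Q \<inter> ?Q' = quiet (\<T> \<union> \<T>') (?l n k) (?u n k)" by (auto simp: quiet_def)
      moreover have "(\<Sum>B\<in>\<T> \<union> \<T>'. m B) = a + a'"
        unfolding a_def a'_def using T finite_S by (intro sum.union_disjoint) (auto intro: finite_subset)
      ultimately have pI: "prob (?Q \<inter> ?Q') = prob ?Q * prob ?Q'"
        using prob_quiet[of "\<T> \<union> \<T>'", OF _ lu] T
        by (simp only: pQ len Un_least) (simp add: exp_add[symmetric] algebra_simps)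
      have "prob (Z n k) = prob (space \<Omega> - (?Q \<union> ?Q'))"
        by (rule arg_cong[where f = prob]) (auto simp: Z_def)
      also have "\<dots> = 1 - (prob ?Q + prob ?Q' - prob (?Q \<inter> ?Q'))"
        using Q by (simp add: prob_compl measure_Un3 fmeasurable_eq_sets)
      also have "\<dots> = (1 - exp (- (a * \<delta> n))) * (1 - exp (- (a' * \<delta> n)))"
        by (simp only: pI pQ) (simp add: algebra_simps)
      also have "\<dots> \<le> (a * \<delta> n) * (a' * \<delta> n)"
      proof (rule mult_mono)
        show "1 - exp (- (a * \<delta> n)) \<le> a * \<delta> n" "1 - exp (- (a' * \<delta> n)) \<le> a' * \<delta> n"
          using exp_ge_add_one_self[of "- (a * \<delta> n)"] exp_ge_add_one_self[of "- (a' * \<delta> n)"] by linarith+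
      qed (use a0 \<delta>[of n] in auto)
      finally show ?thesis .
    qed
    show ?thesis
    proof (rule AE_not_in_if_small[where A = "\<lambda>n. \<Union>k<Suc n. Z n k"])
      show "(\<Union>k<Suc n. Z n k) \<in> events" for n using Ze by auto
      have le: "prob (\<Union>k<Suc n. Z n k) \<le> a * a' * (real (Suc N))\<^sup>2 * inverse (real (Suc n))" for n
      proof -
        have "prob (\<Union>k<Suc n. Z n k) \<le> (\<Sum>k<Suc n. prob (Z n k))"
          using Ze by (intro finite_measure_subadditive_finite) auto
        also have "\<dots> \<le> (\<Sum>k<Suc n. (a * \<delta> n) * (a' * \<delta> n))"
          by (intro sum_mono PZ)
        also have "\<dots> = a * a' * (real (Suc N))\<^sup>2 * inverse (real (Suc n))"
          by (simp add: \<delta>_def power2_eq_square divide_simps del: of_nat_Suc)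
        finally show ?thesis .
      qed
      show "(\<lambda>n. prob (\<Union>k<Suc n. Z n k)) \<longlonglongrightarrow> 0"
      proof (rule tendsto_sandwich[OF _ _ tendsto_const])
        show "(\<lambda>n. a * a' * (real (Suc N))\<^sup>2 * inverse (real (Suc n))) \<longlonglongrightarrow> 0"
          using tendsto_mult[OF tendsto_const LIMSEQ_inverse_real_of_nat] by simp
      qed (use le in auto)
      fix n w assume w: "w \<in> space \<Omega>" "\<exists>i j. b i w \<in> \<T> \<and> b j w \<in> \<T>' \<and> - real (Suc N) < t i w \<and> t i w \<le> 0 \<and> t i w = t j w"
      then obtain i j where ij: "b i w \<in> \<T>" "b j w \<in> \<T>'" "- real (Suc N) < t i w" "t i w \<le> 0" "t i w = t j w" by auto
      \<comment> \<open>The cell containing \<open>t i w\<close>. Cells are open on the left and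
        closed on the right, as in \<open>quiet\<close>.\<close>
      define k where "k = nat \<lfloor>- t i w / \<delta> n\<rfloor>"
      have k1: "real k \<le> - t i w / \<delta> n" "- t i w / \<delta> n < real k + 1"
      proof -
        have "0 \<le> - t i w / \<delta> n" using ij(4) \<delta>[of n] by (intro divide_nonneg_pos) auto
        then have "real k = of_int \<lfloor>- t i w / \<delta> n\<rfloor>" unfolding k_def by (intro of_nat_nat) simp
        then show "real k \<le> - t i w / \<delta> n" "- t i w / \<delta> n < real k + 1"
          using floor_correct[of "- t i w / \<delta> n"] by linarith+
      qed
      have kk: "real k * \<delta> n \<le> - t i w" "- t i w < real (Suc k) * \<delta> n"
        using k1 \<delta>[of n] by (simp_all add: field_simps)
      have "real k * \<delta> n < real (Suc n) * \<delta> n"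
        using kk(1) ij(3) by (simp add: \<delta>_def del: of_nat_Suc)
      then have "k < Suc n" using \<delta>[of n] by (simp del: of_nat_Suc)
      moreover have "w \<in> Z n k"
      proof -
        have "?l n k < t i w \<and> t i w \<le> ?u n k" "?l n k < t j w \<and> t j w \<le> ?u n k" using kk ij(5) by linarith+
        then have "w \<notin> quiet \<T> (?l n k) (?u n k)" "w \<notin> quiet \<T>' (?l n k) (?u n k)"
          using ij(1,2) unfolding quiet_def by blast+
        then show ?thesis using w(1) by (simp add: Z_def)
      qed
      ultimately show "w \<in> (\<Union>k<Suc n. Z n k)" by blast
    qed
  qed
  then have "AE w in \<Omega>. \<forall>N. \<not> (\<exists>i j. b i w \<in> \<T> \<and> b j w \<in> \<T>' \<and> - real (Suc N) < t i w \<and> t i w \<le> 0 \<and> t i w = t j w)"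
    by (simp add: AE_all_countable)
  then show ?thesis
  proof eventually_elim
    case (elim w)
    show ?case
    proof (intro allI impI notI)
      fix i j assume ij: "b i w \<in> \<T> \<and> b j w \<in> \<T>' \<and> t i w \<le> 0" "t i w = t j w"
      obtain N where "- t i w < real (Suc N)" using reals_Archimedean2 less_trans[of _ "real N" "real (Suc N)" for N]
        by (metis lessI of_nat_less_iff)
      then show False using elim ij by (metis minus_less_iff)
    qed
  qed
qed

end

section \<open>The leaf visible at a point\<close>

definition covers :: "(nat \<Rightarrow> 'w \<Rightarrow> (real^2) \<times> real) \<Rightarrow> (nat \<Rightarrow> 'w \<Rightarrow> (real^2) set) \<Rightarrow>
    nat \<Rightarrow> real^2 \<Rightarrow> 'w \<Rightarrow> bool" where
  "covers p X i x w \<longleftrightarrow> x - fst (p i w) \<in> X i w"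

text \<open>Here a later leaf hides \<open>x\<close> whenever it covers \<open>x\<close>, while
  \<open>visible_part\<close> removes interiors only. The two agree when \<open>x\<close> lies on no
  frontier.\<close>

definition sees :: "(nat \<Rightarrow> 'w \<Rightarrow> (real^2) \<times> real) \<Rightarrow> (nat \<Rightarrow> 'w \<Rightarrow> (real^2) set) \<Rightarrow>
    nat \<Rightarrow> real^2 \<Rightarrow> 'w \<Rightarrow> bool" where
  "sees p X i x w \<longleftrightarrow> snd (p i w) \<le> 0 \<and> covers p X i x w \<and>
     (\<forall>j. snd (p i w) < snd (p j w) \<and> snd (p j w) < 0 \<longrightarrow> \<not> covers p X j x w)"

lemma mem_translate: "x \<in> (+) y ` A \<longleftrightarrow> x - y \<in> A" for x y :: "'a::ab_group_add"
  by (auto simp: image_iff intro!: bexI[of _ "x - y"])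

lemma closed_visible_part:
  assumes "closed (X i w)"
  shows "closed (visible_part p X i w)"
  unfolding visible_part_def using assms
  by (auto intro!: closed_Diff closed_translation open_UN open_translation)

text \<open>The almost sure properties of one realization \<open>w\<close>; what follows is
  deterministic. Local finiteness concerns all leaves near \<open>x\<close>, not just those covering
  it, in order to obtain neighbourhoods of \<open>x\<close>. Several leaves with the same trace may
  share a time. \<open>nonzero_time\<close> reconciles the bound at time 0, strict for the leaves
  that hide others and not strict in \<open>quiet\<close>.\<close>

locale regular_leaves =
  fixes p :: "nat \<Rightarrow> 'w \<Rightarrow> (real^2) \<times> real" and X :: "nat \<Rightarrow> 'w \<Rightarrow> (real^2) set"
    and w :: 'w and S :: "(real^2) set"
  assumes closed: "\<And>i. closed (X i w)"
    and locally_finite: "\<And>x n. x \<in> S \<Longrightarrow>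
      finite {i. - real n < snd (p i w) \<and> snd (p i w) \<le> 0 \<and> X i w \<inter> ball (x - fst (p i w)) 1 \<noteq> {}}"
    and no_frontier: "\<And>x i. x \<in> S \<Longrightarrow> x - fst (p i w) \<notin> frontier (X i w)"
    and covered: "\<And>x. x \<in> S \<Longrightarrow> \<exists>i. snd (p i w) \<le> 0 \<and> covers p X i x w"
    and no_tie: "\<And>x y i j. x \<in> S \<Longrightarrow> y \<in> S \<Longrightarrow> covers p X i x w \<Longrightarrow> covers p X i y w \<Longrightarrow>
      covers p X j x w \<noteq> covers p X j y w \<Longrightarrow> snd (p i w) \<le> 0 \<Longrightarrow> snd (p i w) \<noteq> snd (p j w)"
    and nonzero_time: "\<And>i. snd (p i w) \<noteq> 0"
begin

lemma finite_covering:
  assumes "x \<in> S"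
  shows "finite {i. - real n < snd (p i w) \<and> snd (p i w) \<le> 0 \<and> covers p X i x w}"
proof (rule finite_subset[OF _ locally_finite[OF assms, of n]], clarify)
  fix i assume "covers p X i x w"
  then have "x - fst (p i w) \<in> X i w \<inter> ball (x - fst (p i w)) 1" by (simp add: covers_def)
  then show "X i w \<inter> ball (x - fst (p i w)) 1 = {} \<Longrightarrow> False" by blast
qed

lemma covers_interior: "x \<in> S \<Longrightarrow> covers p X i x w \<longleftrightarrow> x - fst (p i w) \<in> interior (X i w)"
  using no_frontier[of x i] closed[of i] interior_subset[of "X i w"] by (auto simp: covers_def frontier_def)

text \<open>Some covering leaf lies after time \<open>- n\<close> for suitable \<open>n\<close>;
  only finitely many do, and the latest of them is seen.\<close>

lemma ex_sees:
  assumes "x \<in> S"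
  shows "\<exists>i. sees p X i x w"
proof -
  obtain k where k: "snd (p k w) \<le> 0" "covers p X k x w" using covered[OF assms] by auto
  obtain n where n: "- snd (p k w) < real n" using reals_Archimedean2 by blast
  let ?A = "{i. - real n < snd (p i w) \<and> snd (p i w) \<le> 0 \<and> covers p X i x w}"
  have "finite ?A" "k \<in> ?A" using finite_covering[OF assms] k n by auto
  then have "Max ((\<lambda>i. snd (p i w)) ` ?A) \<in> (\<lambda>i. snd (p i w)) ` ?A"
    by (intro Max_in) auto
  then obtain i where i: "i \<in> ?A" "snd (p i w) = Max ((\<lambda>i. snd (p i w)) ` ?A)" by (metis (no_types, lifting) imageE)
  have max: "snd (p j w) \<le> snd (p i w)" if "j \<in> ?A" for j
    unfolding i(2) using \<open>finite ?A\<close> that by (intro Max_ge) auto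
  have "sees p X i x w"
    unfolding sees_def
  proof (intro conjI allI impI notI)
    fix j assume j: "snd (p i w) < snd (p j w) \<and> snd (p j w) < 0" "covers p X j x w"
    then have "j \<in> ?A" using i(1) by simp
    then show False using max[of j] j by simp
  qed (use i(1) in auto)
  then show ?thesis ..
qed

lemma visible_part_sees:
  assumes x: "x \<in> S"
  shows "x \<in> visible_part p X i w \<longleftrightarrow> sees p X i x w"
proof (cases "snd (p i w) \<le> 0")
  case True
  then show ?thesis
    using covers_interior[OF x] by (auto simp: visible_part_def sees_def mem_translate covers_def)
qed (auto simp: visible_part_def sees_def)

text \<open>Only finitely many later leaves come within distance 1 of \<open>x\<close>. They are
  closed and miss \<open>x\<close>, so a neighbourhood of \<open>x\<close> avoids them all.\<close>

lemma interior_visible_part: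
  assumes x: "x \<in> S"
  shows "x \<in> interior (visible_part p X i w) \<longleftrightarrow> sees p X i x w"
proof
  assume s: "sees p X i x w"
  then have t: "snd (p i w) \<le> 0" by (simp add: sees_def)
  obtain n where n: "- snd (p i w) < real n" using reals_Archimedean2 by blast
  define Q where "Q = {j. - real n < snd (p j w) \<and> snd (p j w) \<le> 0 \<and> X j w \<inter> ball (x - fst (p j w)) 1 \<noteq> {}} \<inter>
    {j. snd (p i w) < snd (p j w) \<and> snd (p j w) < 0}"
  have Q: "finite Q" unfolding Q_def using locally_finite[OF x] by blast
  define N where "N = ball x 1 \<inter> (+) (fst (p i w)) ` interior (X i w) \<inter> (\<Inter>j\<in>Q. - ((+) (fst (p j w)) ` X j w))"
  have "open N"
    unfolding N_def using Q closed by (intro open_Int open_INT ballI) (auto intro!: open_translation open_Compl closed_translation)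
  moreover have "x \<in> N"
    using s covers_interior[OF x, of i] by (auto simp: N_def Q_def sees_def covers_def mem_translate)
  moreover have "N \<subseteq> visible_part p X i w"
  proof
    fix z assume z: "z \<in> N"
    have "z \<notin> (+) (fst (p j w)) ` interior (X j w)" if j: "snd (p i w) < snd (p j w)" "snd (p j w) < 0" for j
    proof
      assume zj: "z \<in> (+) (fst (p j w)) ` interior (X j w)"
      then have zX: "z - fst (p j w) \<in> X j w" using interior_subset by (auto simp: mem_translate)
      moreover have "z - fst (p j w) \<in> ball (x - fst (p j w)) 1"
        using z by (auto simp: N_def dist_norm)
      ultimately have "j \<in> Q" using j n by (auto simp: Q_def)
      then show False using z zX by (auto simp: N_def mem_translate)
    qed
    moreover have "z - fst (p i w) \<in> X i w" using z interior_subset by (auto simp: N_def mem_translate)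
    ultimately show "z \<in> visible_part p X i w" using t by (auto simp: visible_part_def mem_translate)
  qed
  ultimately show "x \<in> interior (visible_part p X i w)" by (rule interiorI)
next
  assume "x \<in> interior (visible_part p X i w)"
  then show "sees p X i x w" using visible_part_sees[OF x] interior_subset by blast
qed

text \<open>A visible part is closed, and a point of \<open>S\<close> in it is already interior, so
  it cannot be on the frontier.\<close>

lemma not_model_boundary:
  assumes x: "x \<in> S"
  shows "x \<notin> model_boundary (visible_part p X) w"
proof
  assume "x \<in> model_boundary (visible_part p X) w"
  then obtain i where i: "x \<in> frontier (visible_part p X i w)" by (auto simp: model_boundary_def)
  then have "x \<in> visible_part p X i w"
    using closed_visible_part[of X i w p] closed by (auto simp: frontier_def)
  then show False using i visible_part_sees[OF x] interior_visible_part[OF x] by (auto simp: frontier_def)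
qed

lemma visible_index_sees:
  assumes x: "x \<in> S"
  shows "sees p X (visible_index (visible_part p X) x w) x w"
    and "sees p X i x w \<Longrightarrow> visible_index (visible_part p X) x w \<le> i"
  using LeastI_ex[OF ex_sees[OF x]] Least_le[of "\<lambda>i. sees p X i x w"]
  by (simp_all add: visible_index_def interior_visible_part[OF x])

text \<open>The right side is \<open>same\<close> at time 0, spelled out. If both points see leaf
  \<open>i\<close>, the leaves separating them are strictly older, and finitely many in a bounded
  range of times, so a rational cut fits in between. Conversely, a leaf \<open>k\<close> covering
  both points after all separating ones forces every seen leaf to cover both.\<close>

lemma visible_index_eq_iff:
  assumes x: "x \<in> S" and y: "y \<in> S"
  shows "visible_index (visible_part p X) x w = visible_index (visible_part p X) y w \<longleftrightarrow>
    (\<exists>q\<in>\<rat>. 0 < q \<and>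
      (\<forall>i. covers p X i x w \<noteq> covers p X i y w \<longrightarrow> \<not> (- q < snd (p i w) \<and> snd (p i w) \<le> 0)) \<and>
      (\<exists>i. covers p X i x w \<and> covers p X i y w \<and> - q < snd (p i w) \<and> snd (p i w) \<le> 0))"
    (is "?L \<longleftrightarrow> (\<exists>q\<in>\<rat>. ?R q)")
proof
  let ?t = "\<lambda>i. snd (p i w)"
  assume ?L
  then obtain i where s: "sees p X i x w" "sees p X i y w"
    using visible_index_sees(1)[OF x] visible_index_sees(1)[OF y] by metis
  obtain n where n: "- ?t i < real n" using reals_Archimedean2 by blast
  define A where "A = {j. - real n < ?t j \<and> ?t j \<le> 0 \<and> covers p X j x w \<noteq> covers p X j y w}"
  have A: "finite A"
    by (rule finite_subset[OF _ finite_UnI[OF finite_covering[OF x, of n] finite_covering[OF y, of n]]])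
       (auto simp: A_def)
  have lt: "?t j < ?t i" if "j \<in> A" for j
  proof (rule ccontr)
    assume "\<not> ?t j < ?t i"
    moreover have "?t i \<noteq> ?t j"
      using that s by (intro no_tie[OF x y]) (auto simp: A_def sees_def)
    ultimately have "?t i < ?t j" by simp
    moreover have "?t j < 0" using that nonzero_time[of j] by (auto simp: A_def less_le)
    ultimately show False using s that by (auto simp: A_def sees_def)
  qed
  \<comment> \<open>\<open>- real n\<close> keeps the set nonempty and accounts for the separating
    leaves up to time \<open>- n\<close>, which are not in \<open>A\<close>.\<close>
  define a where "a = Max (insert (- real n) (?t ` A))"
  have a: "a < ?t i" "\<And>j. j \<in> A \<Longrightarrow> ?t j \<le> a" "- real n \<le> a"
    unfolding a_def using A lt n by auto
  obtain q where q: "q \<in> \<rat>" "- ?t i < q" "q < - a" using Rats_dense_in_real[of "- ?t i" "- a"] a by auto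
  have "0 \<le> - ?t i" using s by (simp add: sees_def)
  then have "0 < q" using q by linarith
  moreover have "\<not> (- q < ?t j \<and> ?t j \<le> 0)" if "covers p X j x w \<noteq> covers p X j y w" for j
  proof
    assume "- q < ?t j \<and> ?t j \<le> 0"
    then have "j \<in> A" using that q a(3) by (auto simp: A_def)
    then show False using a(2)[of j] q \<open>- q < ?t j \<and> ?t j \<le> 0\<close> by linarith
  qed
  moreover have "covers p X i x w \<and> covers p X i y w \<and> - q < ?t i \<and> ?t i \<le> 0"
    using s q by (auto simp: sees_def)
  ultimately show "\<exists>q\<in>\<rat>. ?R q" using q(1) by blast
next
  let ?t = "\<lambda>i. snd (p i w)"
  assume "\<exists>q\<in>\<rat>. ?R q"
  then obtain q k where q: "\<And>i. covers p X i x w \<noteq> covers p X i y w \<Longrightarrow> \<not> (- q < ?t i \<and> ?t i \<le> 0)"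
    and k: "covers p X k x w" "covers p X k y w" "- q < ?t k" "?t k \<le> 0" by blast
  have k0: "?t k < 0" using k nonzero_time[of k] by (simp add: less_le)
  have sees_both: "covers p X i x w \<and> covers p X i y w \<and> ?t k \<le> ?t i" if "sees p X i x w \<or> sees p X i y w" for i
  proof -
    have "?t k \<le> ?t i" using that k k0 unfolding sees_def by (meson not_le)
    moreover have "?t i \<le> 0" using that by (auto simp: sees_def)
    ultimately have "covers p X i x w = covers p X i y w" using q[of i] k by force
    then show ?thesis using that \<open>?t k \<le> ?t i\<close> by (auto simp: sees_def)
  qed
  have same_time: "?t i = ?t j" if "sees p X i x w" "sees p X j y w" for i j
  proof (rule antisym)
    have c: "covers p X j x w" "covers p X i y w" using that sees_both by auto
    have neg: "?t i < 0" "?t j < 0"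
      using that nonzero_time[of i] nonzero_time[of j] by (auto simp: sees_def less_le)
    show "?t i \<le> ?t j" using that c neg unfolding sees_def by (meson not_le)
    show "?t j \<le> ?t i" using that c neg unfolding sees_def by (meson not_le)
  qed
  \<comment> \<open>Both points see the same set of leaves, possibly several at one time; hence the
    least indices agree.\<close>
  have swap: "sees p X i y w \<longleftrightarrow> sees p X i x w" for i
  proof -
    obtain a where a: "sees p X a x w" using ex_sees[OF x] by blast
    obtain b where b: "sees p X b y w" using ex_sees[OF y] by blast
    show ?thesis
    proof
      assume s: "sees p X i y w"
      then have "?t a = ?t i" using same_time a by blast
      then show "sees p X i x w" using s a sees_both[of i] unfolding sees_def by metis
    next
      assume s: "sees p X i x w"
      then have "?t i = ?t b" using same_time b by blast
      then show "sees p X i y w" using s b sees_both[of i] unfolding sees_def by metis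
    qed
  qed
  show ?L
    using visible_index_sees(1)[OF x] visible_index_sees(1)[OF y]
      visible_index_sees(2)[OF x] visible_index_sees(2)[OF y] swap
    by (meson antisym)
qed

end

section \<open>Types in the dead leaves model\<close>

lemma emeasure_lborel_reflect:
  fixes x :: "'a::euclidean_space"
  assumes [measurable]: "A \<in> sets borel"
  shows "emeasure lborel {y. x - y \<in> A} = emeasure lborel A"
proof -
  have "lborel = density (distr lborel borel (\<lambda>y. x + (- 1) *\<^sub>R y)) (\<lambda>_. ennreal (\<bar>- 1\<bar> ^ DIM('a)))"
    by (rule lborel_affine) simp
  then have "emeasure lborel A = emeasure (distr lborel borel (\<lambda>y. x - y)) A"
    by (simp add: density_1)
  also have "\<dots> = emeasure lborel {y. x - y \<in> A}"
    by (simp add: emeasure_distr vimage_def)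
  finally show ?thesis ..
qed

text \<open>\<open>hit_finite\<close> bounds the mean area of the unit neighbourhood of a leaf,
  which is what local finiteness near a point of \<open>S\<close> rests on.\<close>

locale dead_leaves =
  fixes \<Omega> :: "'w measure" and p :: "nat \<Rightarrow> 'w \<Rightarrow> (real^2) \<times> real"
    and X :: "nat \<Rightarrow> 'w \<Rightarrow> (real^2) set" and L :: "(real^2) set measure" and S :: "(real^2) set"
  assumes marked: "marked_leaves \<Omega> L p X" and finite_points: "finite S"
    and hit_finite: "\<And>x. x \<in> S \<Longrightarrow> (\<integral>\<^sup>+F. emeasure lborel {y. F \<inter> ball (x - y) 1 \<noteq> {}} \<partial>L) < \<infinity>"
    and frontier_null: "AE F in L. emeasure lborel (frontier F) = 0"
    and cover_pos: "\<And>x. x \<in> S \<Longrightarrow> 0 < (\<integral>\<^sup>+F. emeasure lborel {y. x - y \<in> F} \<partial>L)"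

sublocale dead_leaves \<subseteq> marked_poisson \<Omega> p fell_borel L X
proof -
  have "prob_space \<Omega>" using marked by (auto simp: marked_leaves_def poisson_process_def)
  then interpret prob_space \<Omega> .
  show "marked_poisson \<Omega> p fell_borel L X"
    by unfold_locales (use marked in \<open>auto simp: marked_leaves_def\<close>)
qed

context dead_leaves
begin

abbreviation "leaf_space \<equiv> (borel :: (real^2) measure) \<Otimes>\<^sub>M (fell_borel :: (real^2) set measure)"

text \<open>The mean number, per unit of time, of leaves whose position and shape lie in
  \<open>A\<close>.\<close>

definition intensity :: "((real^2) \<times> (real^2) set) set \<Rightarrow> ennreal" where
  "intensity A = (\<integral>\<^sup>+F. emeasure lborel {y. (y, F) \<in> A} \<partial>L)"

definition strip :: "real set \<Rightarrow> ((real^2) \<times> (real^2) set) set \<Rightarrow> (((real^2) \<times> real) \<times> (real^2) set) set" where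
  "strip T A = {z. snd (fst z) \<in> T \<and> (fst (fst z), snd z) \<in> A}"

lemma strip_sets:
  assumes T[measurable]: "T \<in> sets borel" and A[measurable]: "A \<in> sets leaf_space"
  shows "strip T A \<in> sets (borel \<Otimes>\<^sub>M fell_borel)"
proof -
  have "strip T A = {z \<in> space ((borel :: ((real^2) \<times> real) measure) \<Otimes>\<^sub>M fell_borel). snd (fst z) \<in> T \<and> (fst (fst z), snd z) \<in> A}"
    using sets.sets_into_space[OF A] by (auto simp: strip_def space_pair_measure)
  also have "\<dots> \<in> sets (borel \<Otimes>\<^sub>M fell_borel)"
  proof -
    have [measurable]: "(fst :: (real^2) \<times> real \<Rightarrow> _) \<in> borel_measurable borel"
      "(snd :: (real^2) \<times> real \<Rightarrow> _) \<in> borel_measurable borel"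
      by (auto simp: borel_prod[symmetric])
    have "(\<lambda>z. (fst (fst z), snd z)) \<in> measurable ((borel :: ((real^2) \<times> real) measure) \<Otimes>\<^sub>M fell_borel) leaf_space"
      by measurable
    note [measurable] = pred_sets2[OF A this]
    show ?thesis by measurable
  qed
  finally show ?thesis .
qed

lemma emeasure_strip:
  assumes T[measurable]: "T \<in> sets borel" and A[measurable]: "A \<in> sets leaf_space"
  shows "emeasure (lborel \<Otimes>\<^sub>M L) (strip T A) = emeasure lborel T * intensity A"
proof -
  interpret pair_sigma_finite "lborel :: ((real^2) \<times> real) measure" L ..
  have sec: "{y. (y, F) \<in> A} \<in> sets borel" for F
    using sets_Pair2[OF A, of F] by (simp add: vimage_def)
  have "strip T A \<in> sets (lborel \<Otimes>\<^sub>M L)"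
    using strip_sets[OF T A] by (simp add: sets_L cong: sets_pair_measure_cong)
  from emeasure_pair_measure_alt2[OF this]
  have "emeasure (lborel \<Otimes>\<^sub>M L) (strip T A) = (\<integral>\<^sup>+F. emeasure lborel ((\<lambda>z. (z, F)) -` strip T A) \<partial>L)" .
  also have "\<dots> = (\<integral>\<^sup>+F. emeasure lborel T * emeasure lborel {y. (y, F) \<in> A} \<partial>L)"
  proof (rule nn_integral_cong)
    fix F
    have "(\<lambda>z. (z, F)) -` strip T A = {y. (y, F) \<in> A} \<times> T" by (auto simp: strip_def)
    then show "emeasure lborel ((\<lambda>z. (z, F)) -` strip T A) = emeasure lborel T * emeasure lborel {y. (y, F) \<in> A}"
      using sec by (simp add: lborel_prod[symmetric] lborel.emeasure_pair_measure_Times mult.commute)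
  qed
  also have "\<dots> = emeasure lborel T * intensity A"
    unfolding intensity_def
  proof (rule nn_integral_cmult)
    have A': "A \<in> sets ((lborel :: (real^2) measure) \<Otimes>\<^sub>M L)"
      using A by (simp add: sets_L cong: sets_pair_measure_cong)
    interpret q: pair_sigma_finite "lborel :: (real^2) measure" L ..
    show "(\<lambda>F. emeasure lborel {y. (y, F) \<in> A}) \<in> borel_measurable L"
      using q.measurable_emeasure_Pair2[OF A'] by (simp add: vimage_def)
  qed
  finally show ?thesis .
qed

lemma intensity_mono: "A \<subseteq> B \<Longrightarrow> B \<in> sets leaf_space \<Longrightarrow> intensity A \<le> intensity B"
  unfolding intensity_def
  by (intro nn_integral_mono emeasure_mono) (auto dest: sets_Pair2 simp: vimage_def)

lemma pred_covers[measurable]: "Measurable.pred leaf_space (\<lambda>z. x - fst z \<in> snd z)"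
  and pred_near[measurable]: "Measurable.pred leaf_space (\<lambda>z. snd z \<inter> ball (x - fst z) 1 \<noteq> {})"
  and pred_frontier[measurable]: "Measurable.pred leaf_space (\<lambda>z. x - fst z \<in> frontier (snd z))"
  using sets_fell_mem[of snd leaf_space "\<lambda>z. x - fst z"] sets_fell_hit_ball[of snd leaf_space "\<lambda>z. x - fst z" 1]
    sets_fell_frontier[of snd leaf_space "\<lambda>z. x - fst z"]
  by (auto simp: pred_def)

definition typed :: "(real^2) set \<Rightarrow> ((real^2) \<times> (real^2) set) set" where
  "typed B = {z \<in> space leaf_space. {x \<in> S. x - fst z \<in> snd z} = B}"

text \<open>Faithful for nonempty \<open>B\<close>, where the intensity is finite. The leaves
  missing \<open>S\<close> have infinite intensity, so sums range over nonempty traces.\<close>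

definition m :: "(real^2) set \<Rightarrow> real" where
  "m B = enn2real (intensity (typed B))"

lemma typed_sets[measurable]: "typed B \<in> sets leaf_space"
proof (cases "B \<subseteq> S")
  case True
  then have "typed B = {z \<in> space leaf_space. \<forall>x\<in>S. (x - fst z \<in> snd z) \<longleftrightarrow> x \<in> B}"
    by (auto simp: typed_def)
  also have "\<dots> \<in> sets leaf_space" using finite_points by measurable
  finally show ?thesis .
next
  case False
  then have "typed B = {}" by (auto simp: typed_def)
  then show ?thesis by simp
qed

lemma intensity_near:
  assumes "x \<in> S"
  shows "intensity {z \<in> space leaf_space. snd z \<inter> ball (x - fst z) 1 \<noteq> {}} < \<infinity>"
proof -
  have "intensity {z \<in> space leaf_space. snd z \<inter> ball (x - fst z) 1 \<noteq> {}} =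
    (\<integral>\<^sup>+F. emeasure lborel {y. F \<inter> ball (x - y) 1 \<noteq> {}} \<partial>L)"
    unfolding intensity_def
    by (intro nn_integral_cong) (auto simp: space_pair_measure space_L intro!: arg_cong[where f = "emeasure lborel"])
  then show ?thesis using hit_finite[OF assms] by simp
qed

lemma intensity_typed_finite:
  assumes "B \<noteq> {}"
  shows "intensity (typed B) < \<infinity>"
proof (cases "B \<subseteq> S")
  case True
  then obtain x where x: "x \<in> B" "x \<in> S" using assms by auto
  have "typed B \<subseteq> {z \<in> space leaf_space. snd z \<inter> ball (x - fst z) 1 \<noteq> {}}"
  proof
    fix z assume z: "z \<in> typed B"
    then have "x - fst z \<in> snd z \<inter> ball (x - fst z) 1" using x by (auto simp: typed_def)
    then show "z \<in> {z \<in> space leaf_space. snd z \<inter> ball (x - fst z) 1 \<noteq> {}}" using z by (auto simp: typed_def)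
  qed
  then have "intensity (typed B) \<le> intensity {z \<in> space leaf_space. snd z \<inter> ball (x - fst z) 1 \<noteq> {}}"
    by (rule intensity_mono) measurable
  then show ?thesis using intensity_near[OF x(2)] by (rule le_less_trans)
next
  case False
  then have "typed B = {}" by (auto simp: typed_def)
  then show ?thesis by (simp add: intensity_def)
qed

lemma intensity_typed: "B \<noteq> {} \<Longrightarrow> intensity (typed B) = ennreal (m B)"
  unfolding m_def using intensity_typed_finite[of B] by simp

lemma covers_eq: "w \<in> space \<Omega> \<Longrightarrow> {x \<in> S. covers p X i x w} = B \<longleftrightarrow> (fst (p i w), X i w) \<in> typed B"
  using measurable_space[OF mark_measurable] by (auto simp: typed_def covers_def space_pair_measure)

text \<open>Forbidding trace \<open>B\<close> at the times \<open>E B\<close>, for all nonempty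
  \<open>B\<close> at once, forbids a single set \<open>W\<close> of marked points, a disjoint union
  of strips, and the void formula for marked points applies.\<close>

lemma void_event:
  assumes E: "\<And>B. E B \<in> sets borel" "\<And>B. emeasure lborel (E B) < \<infinity>"
  defines "Z \<equiv> {w \<in> space \<Omega>. \<forall>i. {x \<in> S. covers p X i x w} \<in> Pow S - {{}} \<longrightarrow> snd (p i w) \<notin> E {x \<in> S. covers p X i x w}}"
  shows "Z \<in> sets \<Omega>" "prob Z = exp (- (\<Sum>B\<in>Pow S - {{}}. m B * measure lborel (E B)))"
proof -
  define W where "W = (\<Union>B\<in>Pow S - {{}}. strip (E B) (typed B))"
  have Ws: "W \<in> sets (borel \<Otimes>\<^sub>M fell_borel)"
    unfolding W_def using finite_points E by (intro sets.finite_UN strip_sets) auto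
  have "emeasure (lborel \<Otimes>\<^sub>M L) W = (\<Sum>B\<in>Pow S - {{}}. emeasure (lborel \<Otimes>\<^sub>M L) (strip (E B) (typed B)))"
    unfolding W_def
  proof (rule sum_emeasure[symmetric])
    show "disjoint_family_on (\<lambda>B. strip (E B) (typed B)) (Pow S - {{}})"
      by (auto simp: disjoint_family_on_def strip_def typed_def)
    show "(\<lambda>B. strip (E B) (typed B)) ` (Pow S - {{}}) \<subseteq> sets (lborel \<Otimes>\<^sub>M L)"
      using strip_sets[OF E(1) typed_sets] by (auto simp: sets_L cong: sets_pair_measure_cong)
    show "finite (Pow S - {{}})" using finite_points by simp
  qed
  also have "\<dots> = (\<Sum>B\<in>Pow S - {{}}. ennreal (m B * measure lborel (E B)))"
  proof (rule sum.cong[OF refl])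
    fix B assume "B \<in> Pow S - {{}}"
    then have "emeasure (lborel \<Otimes>\<^sub>M L) (strip (E B) (typed B)) = emeasure lborel (E B) * ennreal (m B)"
      using E by (simp add: emeasure_strip intensity_typed)
    also have "emeasure lborel (E B) = ennreal (measure lborel (E B))"
      using E(2)[of B] by (intro emeasure_eq_ennreal_measure) auto
    also have "ennreal (measure lborel (E B)) * ennreal (m B) = ennreal (m B * measure lborel (E B))"
      by (subst ennreal_mult[symmetric]) (auto simp: m_def mult.commute)
    finally show "emeasure (lborel \<Otimes>\<^sub>M L) (strip (E B) (typed B)) = ennreal (m B * measure lborel (E B))" .
  qed
  also have "\<dots> = ennreal (\<Sum>B\<in>Pow S - {{}}. m B * measure lborel (E B))"
    by (rule sum_ennreal) (simp add: m_def)
  finally have eW: "emeasure (lborel \<Otimes>\<^sub>M L) W = ennreal (\<Sum>B\<in>Pow S - {{}}. m B * measure lborel (E B))" .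
  have nn: "0 \<le> (\<Sum>B\<in>Pow S - {{}}. m B * measure lborel (E B))"
    by (intro sum_nonneg) (simp add: m_def)
  have Z: "Z = {w \<in> space \<Omega>. \<forall>i. (p i w, X i w) \<notin> W}"
  proof -
    have "({x \<in> S. covers p X i x w} \<in> Pow S - {{}} \<longrightarrow> snd (p i w) \<notin> E {x \<in> S. covers p X i x w})
      \<longleftrightarrow> (p i w, X i w) \<notin> W" if "w \<in> space \<Omega>" for i w
    proof -
      have "(p i w, X i w) \<in> W \<longleftrightarrow> (\<exists>B\<in>Pow S - {{}}. snd (p i w) \<in> E B \<and> (fst (p i w), X i w) \<in> typed B)"
        by (auto simp: W_def strip_def)
      then show ?thesis unfolding covers_eq[OF that, symmetric] by blast
    qed
    then show ?thesis unfolding Z_def by blast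
  qed
  show "Z \<in> sets \<Omega>" "prob Z = exp (- (\<Sum>B\<in>Pow S - {{}}. m B * measure lborel (E B)))"
    unfolding Z using prob_no_marked_point[OF Ws] eW nn by (simp_all add: measure_def)
qed

end

sublocale dead_leaves \<subseteq> T: type_process \<Omega> S "\<lambda>i w. snd (p i w)" "\<lambda>i w. {x \<in> S. covers p X i x w}" m
proof
  show "finite S" by (rule finite_points)
  show "0 \<le> m B" for B by (simp add: m_def)
qed (use void_event in auto)

context dead_leaves
begin

lemma rate_pos:
  assumes x: "x \<in> S"
  shows "0 < T.rate {x}"
proof -
  have "(\<integral>\<^sup>+F. emeasure lborel {y. x - y \<in> F} \<partial>L) = intensity (\<Union>B\<in>T.hits {x}. typed B)"
    unfolding intensity_def using x
    by (intro nn_integral_cong) (auto simp: space_pair_measure space_L T.hits_def typed_def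
        intro!: arg_cong[where f = "emeasure lborel"])
  also have "\<dots> \<le> (\<Sum>B\<in>T.hits {x}. intensity (typed B))"
  proof -
    have fin: "finite (T.hits {x})" using finite_points by (auto simp: T.hits_def)
    \<comment> \<open>Over a unit interval of time, \<open>intensity\<close> is the product measure
      of a strip, which supplies subadditivity.\<close>
    have "strip {0..1} (\<Union>B\<in>T.hits {x}. typed B) = (\<Union>B\<in>T.hits {x}. strip {0..1} (typed B))"
      by (auto simp: strip_def)
    moreover have "emeasure (lborel \<Otimes>\<^sub>M L) (\<Union>B\<in>T.hits {x}. strip {0..1} (typed B)) \<le>
      (\<Sum>B\<in>T.hits {x}. emeasure (lborel \<Otimes>\<^sub>M L) (strip {0..1} (typed B)))"
      using fin strip_sets[of "{0..1}", OF _ typed_sets]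
      by (intro emeasure_subadditive_finite) (auto simp: sets_L cong: sets_pair_measure_cong)
    ultimately show ?thesis
      using emeasure_strip[of "{0..1}", OF _ typed_sets]
        emeasure_strip[of "{0..1}" "\<Union>B\<in>T.hits {x}. typed B"] sets.finite_UN[OF fin typed_sets]
      by simp
  qed
  also have "\<dots> = (\<Sum>B\<in>T.hits {x}. ennreal (m B))"
    by (intro sum.cong intensity_typed) (auto simp: T.hits_def)
  also have "\<dots> = ennreal (T.rate {x})"
    unfolding T.rate_def by (rule sum_ennreal) (rule T.m_nonneg)
  finally have "ennreal (T.rate {x}) \<noteq> 0" using cover_pos[OF x] by auto
  then show ?thesis by (auto simp: ennreal_eq_0_iff)
qed

text \<open>Leaves near a point have finite intensity, and those with a point of \<open>S\<close> on
  the frontier, or at time 0, have mean number 0. The time to wait for a covering leaf has an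
  exponential tail, and ties are excluded between the disjoint classes \<open>both\<close> and
  \<open>sep\<close>.\<close>

lemma AE_regular_leaves: "AE w in \<Omega>. regular_leaves p X w S"
proof -
  have nearf: "AE w in \<Omega>. finite {i. - real n < snd (p i w) \<and> snd (p i w) \<le> 0 \<and> X i w \<inter> ball (x - fst (p i w)) 1 \<noteq> {}}"
    if "x \<in> S" for x n
  proof -
    let ?E = "strip {- real n<..0} {z \<in> space leaf_space. snd z \<inter> ball (x - fst z) 1 \<noteq> {}}"
    have "AE w in \<Omega>. finite {i. (p i w, X i w) \<in> ?E}"
    proof (rule AE_finite_marked)
      show "?E \<in> sets (borel \<Otimes>\<^sub>M fell_borel)" by (intro strip_sets) measurable
      show "emeasure (lborel \<Otimes>\<^sub>M L) ?E < \<infinity>"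
        using intensity_near[OF that] by (subst emeasure_strip) (auto simp: ennreal_mult_less_top)
    qed
    then show ?thesis
      using AE_space
    proof eventually_elim
      case (elim w)
      have "{i. (p i w, X i w) \<in> ?E} = {i. - real n < snd (p i w) \<and> snd (p i w) \<le> 0 \<and> X i w \<inter> ball (x - fst (p i w)) 1 \<noteq> {}}"
        using measurable_space[OF mark_measurable elim(2)] by (auto simp: strip_def space_pair_measure)
      then show ?case using elim(1) by simp
    qed
  qed
  have fr: "AE w in \<Omega>. \<forall>i. x - fst (p i w) \<notin> frontier (X i w)" if "x \<in> S" for x
  proof -
    let ?A = "{z \<in> space leaf_space. x - fst z \<in> frontier (snd z)}"
    have "intensity ?A = (\<integral>\<^sup>+F. 0 \<partial>L)"
      unfolding intensity_def
    proof (rule nn_integral_cong_AE, use frontier_null AE_space in eventually_elim)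
      fix F assume F: "emeasure lborel (frontier F) = 0" "F \<in> space L"
      then have "{y. (y, F) \<in> ?A} = {y. x - y \<in> frontier F}" by (auto simp: space_pair_measure space_L)
      then show "emeasure lborel {y. (y, F) \<in> ?A} = 0"
        using F emeasure_lborel_reflect[of "frontier F" x] by simp
    qed
    then have "AE w in \<Omega>. \<forall>i. (p i w, X i w) \<notin> strip UNIV ?A"
      by (intro AE_none_marked strip_sets) (auto simp: emeasure_strip)
    then show ?thesis
      using AE_space
      by eventually_elim (use measurable_space[OF mark_measurable] in \<open>auto simp: strip_def space_pair_measure\<close>)
  qed
  have t0: "AE w in \<Omega>. \<forall>i. snd (p i w) \<noteq> 0"
  proof -
    have "AE w in \<Omega>. \<forall>i. (p i w, X i w) \<notin> strip {0} (space leaf_space)"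
      by (intro AE_none_marked strip_sets) (auto simp: emeasure_strip)
    then show ?thesis
      using AE_space
      by eventually_elim (use measurable_space[OF mark_measurable] in \<open>auto simp: strip_def space_pair_measure\<close>)
  qed
  have cov: "AE w in \<Omega>. \<exists>i. snd (p i w) \<le> 0 \<and> covers p X i x w" if x: "x \<in> S" for x
  proof -
    have hx: "T.hits {x} \<subseteq> Pow S - {{}}" by (rule T.type_classes_subset)
    have "AE w in \<Omega>. \<not> (\<forall>i. covers p X i x w \<longrightarrow> \<not> snd (p i w) \<le> 0)"
    proof (rule AE_not_in_if_small[where A = "\<lambda>n. T.quiet (T.hits {x}) (- real n) 0"])
      show "T.quiet (T.hits {x}) (- real n) 0 \<in> events" for n by (rule T.quiet_events[OF hx])
      have "prob (T.quiet (T.hits {x}) (- real n) 0) = exp (- T.rate {x}) ^ n" for n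
        using T.prob_quiet[OF hx, of "- real n" 0]
        by (simp add: T.rate_def exp_of_nat_mult[symmetric] mult.commute)
      moreover have "(\<lambda>n. exp (- T.rate {x}) ^ n) \<longlonglongrightarrow> 0"
        using rate_pos[OF x] by (intro LIMSEQ_power_zero) simp
      ultimately show "(\<lambda>n. prob (T.quiet (T.hits {x}) (- real n) 0)) \<longlonglongrightarrow> 0" by simp
      show "w \<in> T.quiet (T.hits {x}) (- real n) 0"
        if "w \<in> space \<Omega>" "\<forall>i. covers p X i x w \<longrightarrow> \<not> snd (p i w) \<le> 0" for n w
        using that by (auto simp: T.quiet_def T.hits_def)
    qed
    then show ?thesis by eventually_elim auto
  qed
  have tie: "AE w in \<Omega>. \<forall>i j. covers p X i x w \<longrightarrow> covers p X i y w \<longrightarrow> covers p X j x w \<noteq> covers p X j y w \<longrightarrow>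
    snd (p i w) \<le> 0 \<longrightarrow> snd (p i w) \<noteq> snd (p j w)" if xy: "x \<in> S" "y \<in> S" for x y
  proof -
    have "AE w in \<Omega>. \<forall>i j. {x \<in> S. covers p X i x w} \<in> T.both x y \<and> {x \<in> S. covers p X j x w} \<in> T.sep x y \<and>
      snd (p i w) \<le> 0 \<longrightarrow> snd (p i w) \<noteq> snd (p j w)"
      using T.type_classes_disjoint[of x y]
      by (intro T.AE_no_ties T.type_classes_subset) auto
    then show ?thesis
      by eventually_elim (use xy in \<open>auto simp: T.both_def T.sep_def\<close>)
  qed
  have "AE w in \<Omega>. \<forall>x\<in>S. \<forall>n. finite {i. - real n < snd (p i w) \<and> snd (p i w) \<le> 0 \<and> X i w \<inter> ball (x - fst (p i w)) 1 \<noteq> {}}"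
    using finite_points nearf by (intro AE_finite_allI) (auto simp: AE_all_countable)
  moreover have "AE w in \<Omega>. \<forall>x\<in>S. \<forall>i. x - fst (p i w) \<notin> frontier (X i w)"
    using finite_points fr by (intro AE_finite_allI) auto
  moreover have "AE w in \<Omega>. \<forall>x\<in>S. \<exists>i. snd (p i w) \<le> 0 \<and> covers p X i x w"
    using finite_points cov by (intro AE_finite_allI) auto
  moreover have "AE w in \<Omega>. \<forall>x\<in>S. \<forall>y\<in>S. \<forall>i j. covers p X i x w \<longrightarrow> covers p X i y w \<longrightarrow>
    covers p X j x w \<noteq> covers p X j y w \<longrightarrow> snd (p i w) \<le> 0 \<longrightarrow> snd (p i w) \<noteq> snd (p j w)"
    using finite_points tie by (intro AE_finite_allI) auto
  ultimately show ?thesis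
    using t0 AE_space
  proof eventually_elim
    case (elim w)
    show ?case
      using elim(1-5) fell_closed[OF mark_measurable elim(6)] by unfold_locales blast+
  qed
qed

text \<open>Joins the two descriptions: off a null event, the level sets of
  \<open>visible_index\<close> on \<open>S\<close> are those predicted by the void events behind
  \<open>T.same\<close>.\<close>

lemma AE_kernel:
  "AE w in \<Omega>. (\<forall>x\<in>S. x \<notin> model_boundary (visible_part p X) w) \<and>
    ((\<forall>x\<in>S. \<forall>y\<in>S. (x, y) \<in> K \<longleftrightarrow>
        visible_index (visible_part p X) x w = visible_index (visible_part p X) y w) \<longleftrightarrow> w \<in> T.good K 0 S)"
  using AE_regular_leaves AE_space
proof eventually_elim
  case (elim w)
  interpret regular_leaves p X w S by (rule elim(1))
  have "visible_index (visible_part p X) x w = visible_index (visible_part p X) y w \<longleftrightarrow> w \<in> T.same 0 x y"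
    if "x \<in> S" "y \<in> S" for x y
    unfolding visible_index_eq_iff[OF that] T.same_def T.quiet_def T.sep_def T.both_def
    using that elim(2) by auto
  then show ?case using not_model_boundary elim(2) by (auto simp: T.good_def)
qed

end

section \<open>Colours\<close>

abbreviation field_space :: "((real^2) \<Rightarrow> real) measure" where
  "field_space \<equiv> Pi\<^sub>M UNIV (\<lambda>_. borel)"

definition has_kernel :: "'s set \<Rightarrow> ('s \<times> 's) set \<Rightarrow> ('s \<Rightarrow> nat) \<Rightarrow> bool" where
  "has_kernel S K j \<longleftrightarrow> (\<forall>x\<in>S. \<forall>y\<in>S. (x, y) \<in> K \<longleftrightarrow> j x = j y)"

definition color_by :: "(real^2) set \<Rightarrow> (real^2 \<Rightarrow> nat) \<Rightarrow> (nat \<Rightarrow> real^2 \<Rightarrow> real) \<Rightarrow> real^2 \<Rightarrow> real" where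
  "color_by S j c = (\<lambda>x\<in>S. c (j x) x)"

lemma color_by_measurable:
  assumes L: "sets L = sets field_space" and j: "j \<in> S \<rightarrow> J"
  shows "color_by S j \<in> measurable (Pi\<^sub>M J (\<lambda>_. L)) (Pi\<^sub>M S (\<lambda>_. borel))"
  unfolding color_by_def
proof (rule measurable_restrict)
  fix x assume "x \<in> S"
  then have "(\<lambda>c. c (j x)) \<in> measurable (Pi\<^sub>M J (\<lambda>_. L)) L"
    using j by (intro measurable_component_singleton) auto
  moreover have "(\<lambda>h. h x) \<in> borel_measurable L"
    unfolding measurable_cong_sets[OF L refl] by (rule measurable_component_singleton) simp
  ultimately show "(\<lambda>c. c (j x) x) \<in> borel_measurable (Pi\<^sub>M J (\<lambda>_. L))"
    by (rule measurable_compose)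
qed

text \<open>Relabelling the independent copies does not change their joint law, so only the partition of
  \<open>S\<close> into level sets matters.\<close>

lemma distr_color_by_kernel:
  assumes L: "prob_space L" "sets L = sets field_space"
    and K: "has_kernel S K j" "has_kernel S K j'"
  shows "distr (Pi\<^sub>M UNIV (\<lambda>_. L)) (Pi\<^sub>M S (\<lambda>_. borel)) (color_by S j) =
    distr (Pi\<^sub>M UNIV (\<lambda>_. L)) (Pi\<^sub>M S (\<lambda>_. borel)) (color_by S j')"
proof -
  have eq: "j x = j y \<longleftrightarrow> j' x = j' y" if "x \<in> S" "y \<in> S" for x y
    using K that by (auto simp: has_kernel_def)
  define s where "s n = j' (inv_into S j n)" for n
  have s: "s (j x) = j' x" if "x \<in> S" for x
    unfolding s_def using eq[of "inv_into S j (j x)" x] that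
    by (simp add: f_inv_into_f inv_into_into)
  have "inj_on s (j ` S)" using s eq by (auto simp: inj_on_def)
  have *: "distr (Pi\<^sub>M UNIV (\<lambda>_. L)) (Pi\<^sub>M S (\<lambda>_. borel)) (color_by S (\<lambda>x. r (j x))) =
    distr (Pi\<^sub>M (j ` S) (\<lambda>_. L)) (Pi\<^sub>M S (\<lambda>_. borel)) (color_by S j)" if "inj_on r (j ` S)" for r :: "nat \<Rightarrow> nat"
  proof -
    have "distr (Pi\<^sub>M UNIV (\<lambda>_. L)) (Pi\<^sub>M (j ` S) (\<lambda>_. L)) (\<lambda>c. \<lambda>n\<in>j ` S. c (r n)) = Pi\<^sub>M (j ` S) (\<lambda>_. L)"
      using distr_PiM_reindex[of UNIV "\<lambda>_. L" r "j ` S"] L that by auto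
    then have "distr (Pi\<^sub>M (j ` S) (\<lambda>_. L)) (Pi\<^sub>M S (\<lambda>_. borel)) (color_by S j) =
      distr (distr (Pi\<^sub>M UNIV (\<lambda>_. L)) (Pi\<^sub>M (j ` S) (\<lambda>_. L)) (\<lambda>c. \<lambda>n\<in>j ` S. c (r n))) (Pi\<^sub>M S (\<lambda>_. borel)) (color_by S j)"
      by simp
    also have "\<dots> = distr (Pi\<^sub>M UNIV (\<lambda>_. L)) (Pi\<^sub>M S (\<lambda>_. borel)) (color_by S j \<circ> (\<lambda>c. \<lambda>n\<in>j ` S. c (r n)))"
      by (rule distr_distr[OF color_by_measurable[OF L(2)]]) (auto intro!: measurable_restrict)
    also have "color_by S j \<circ> (\<lambda>c. \<lambda>n\<in>j ` S. c (r n)) = color_by S (\<lambda>x. r (j x))"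
      by (auto simp: color_by_def fun_eq_iff restrict_def)
    finally show ?thesis ..
  qed
  have "color_by S (\<lambda>x. s (j x)) = color_by S j'"
    using s by (auto simp: color_by_def fun_eq_iff restrict_def)
  then show ?thesis using *[of "\<lambda>n. n"] *[OF \<open>inj_on s (j ` S)\<close>] by simp
qed

definition representative :: "'s set \<Rightarrow> ('s \<times> 's) set \<Rightarrow> 's \<Rightarrow> nat" where
  "representative S K = (SOME j. has_kernel S K j)"

lemma has_kernel_representative: "has_kernel S K j \<Longrightarrow> has_kernel S K (representative S K)"
  unfolding representative_def by (rule someI[of "has_kernel S K"])

text \<open>The mean of \<open>f\<close> when every class of \<open>K\<close> receives its own copy
  of the field. If \<open>K\<close> is the kernel of no labelling, \<open>representative\<close> is
  an arbitrary choice, but the event of having such a kernel is empty.\<close>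

definition block_mean :: "((real^2) \<Rightarrow> real) measure \<Rightarrow> (real^2) set \<Rightarrow> ((real^2 \<Rightarrow> real) \<Rightarrow> real) \<Rightarrow>
    ((real^2) \<times> (real^2)) set \<Rightarrow> real" where
  "block_mean L S f K = (\<integral>c. f (color_by S (representative S K) c) \<partial>Pi\<^sub>M UNIV (\<lambda>_. L))"

lemma block_mean_eq:
  assumes L: "prob_space L" "sets L = sets field_space" and K: "has_kernel S K j"
    and f: "f \<in> borel_measurable (Pi\<^sub>M S (\<lambda>_. borel))"
  shows "(\<integral>c. f (color_by S j c) \<partial>Pi\<^sub>M UNIV (\<lambda>_. L)) = block_mean L S f K"
  using distr_color_by_kernel[OF L K has_kernel_representative[OF K]]
    integral_distr[OF color_by_measurable[OF L(2)] f, of j UNIV]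
    integral_distr[OF color_by_measurable[OF L(2)] f, of "representative S K" UNIV]
  by (simp add: block_mean_def)

section \<open>Averaging over the colours\<close>

locale colored_leaves = prob_space \<Omega> for \<Omega> :: "'w measure" +
  fixes L :: "((real^2) \<Rightarrow> real) measure" and V :: "nat \<Rightarrow> 'w \<Rightarrow> (real^2) set"
    and C :: "nat \<Rightarrow> (real^2) \<Rightarrow> 'w \<Rightarrow> real"
  assumes colors: "color_copies \<Omega> L V C"
begin

lemma V_measurable[measurable]: "(\<lambda>w i. V i w) \<in> measurable \<Omega> (Pi\<^sub>M UNIV (\<lambda>_. fell_borel))"
  and C_measurable[measurable]: "(\<lambda>w i x. C i x w) \<in> measurable \<Omega> (Pi\<^sub>M UNIV (\<lambda>_. field_space))"
  using colors by (auto simp: color_copies_def indep_rv_def)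

lemma V_component[measurable]: "V i \<in> measurable \<Omega> fell_borel"
  using measurable_compose[OF V_measurable measurable_component_singleton[of i UNIV]] by simp

lemma C_component[measurable]: "(\<lambda>w x. C i x w) \<in> measurable \<Omega> field_space"
  using measurable_compose[OF C_measurable measurable_component_singleton[of i UNIV]] by simp

lemma C_value[measurable]: "C i x \<in> borel_measurable \<Omega>"
  using measurable_compose[OF C_component[of i] measurable_component_singleton[of x UNIV]] by simp

lemma law_eq: "L = distr \<Omega> field_space (\<lambda>w x. C i x w)"
  using colors by (simp add: color_copies_def field_law_def)

lemma prob_space_law: "prob_space L"
  unfolding law_eq[of 0] by (rule prob_space_distr) measurable

lemma sets_law: "sets L = sets field_space"
  unfolding law_eq[of 0] by simp

text \<open>\<open>visible_index\<close> as a function of the visible parts alone, so that colours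
  can be integrated out with the parts held fixed.\<close>

definition least_index :: "(nat \<Rightarrow> (real^2) set) \<Rightarrow> real^2 \<Rightarrow> nat" where
  "least_index v x = (LEAST i. x \<in> interior (v i))"

lemma least_index_measurable[measurable]:
  "(\<lambda>v. least_index v x) \<in> measurable (Pi\<^sub>M UNIV (\<lambda>_. fell_borel)) (count_space UNIV)"
proof -
  have [measurable]: "Measurable.pred (Pi\<^sub>M UNIV (\<lambda>_::nat. fell_borel)) (\<lambda>v. x \<in> interior (v i))" for i
    using sets_fell_interior[of "\<lambda>v. v i" "Pi\<^sub>M UNIV (\<lambda>_::nat. fell_borel)" "\<lambda>_. x"] by (simp add: pred_def)
  show ?thesis unfolding least_index_def by measurable
qed

lemma visible_index_least: "visible_index V x w = least_index (\<lambda>i. V i w) x"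
  by (simp add: visible_index_def least_index_def)

lemma visible_index_measurable[measurable]: "visible_index V x \<in> measurable \<Omega> (count_space UNIV)"
  unfolding visible_index_least[abs_def] by measurable

lemma colored_measurable[measurable]: "colored_dead_leaves V C x \<in> borel_measurable \<Omega>"
proof -
  have "{w \<in> space \<Omega>. x \<in> model_boundary V w} = (\<Union>i. {w \<in> space \<Omega>. x \<in> frontier (V i w)})"
    by (auto simp: model_boundary_def)
  also have "\<dots> \<in> sets \<Omega>"
    using sets_fell_frontier[OF V_component, of "\<lambda>_. x"] by auto
  finally have [measurable]: "Measurable.pred \<Omega> (\<lambda>w. x \<in> model_boundary V w)"
    by (simp add: pred_def)
  have [measurable]: "(\<lambda>w. C (visible_index V x w) x w) \<in> borel_measurable \<Omega>"
    by (rule measurable_compose_countable[OF _ visible_index_measurable]) measurable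
  show ?thesis unfolding colored_dead_leaves_def[abs_def] by measurable
qed

lemma random_field_colored: "random_field \<Omega> (colored_dead_leaves V C)"
  unfolding random_field_def using prob_space_axioms by simp

definition kernel_event :: "(real^2) set \<Rightarrow> ((real^2) \<times> (real^2)) set \<Rightarrow> 'w set" where
  "kernel_event S K = {w \<in> space \<Omega>. has_kernel S K (\<lambda>x. visible_index V x w)}"

lemma kernel_event_sets: "finite S \<Longrightarrow> kernel_event S K \<in> sets \<Omega>"
proof -
  have "{w \<in> space \<Omega>. visible_index V x w = visible_index V y w} =
    (\<Union>n. (visible_index V x -` {n} \<inter> space \<Omega>) \<inter> (visible_index V y -` {n} \<inter> space \<Omega>))" for x y by auto
  moreover have "(\<Union>n. (visible_index V x -` {n} \<inter> space \<Omega>) \<inter> (visible_index V y -` {n} \<inter> space \<Omega>)) \<in> sets \<Omega>" for x y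
    by (intro sets.countable_nat_UN image_subsetI sets.Int measurable_sets[OF visible_index_measurable]) auto
  ultimately have [measurable]: "Measurable.pred \<Omega> (\<lambda>w. visible_index V x w = visible_index V y w)" for x y
    by (simp add: pred_def)
  show "finite S \<Longrightarrow> kernel_event S K \<in> sets \<Omega>"
    unfolding kernel_event_def has_kernel_def by measurable
qed

lemma distr_colors: "distr \<Omega> (Pi\<^sub>M UNIV (\<lambda>_. field_space)) (\<lambda>w i x. C i x w) = Pi\<^sub>M UNIV (\<lambda>_. L)"
proof -
  have "indep_vars (\<lambda>_. field_space) (\<lambda>i w x. C i x w) UNIV"
    using colors by (simp add: color_copies_def)
  then have "distr \<Omega> (Pi\<^sub>M UNIV (\<lambda>_. field_space)) (\<lambda>w. \<lambda>i\<in>UNIV. (\<lambda>x. C i x w)) =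
      Pi\<^sub>M UNIV (\<lambda>i. distr \<Omega> field_space (\<lambda>w x. C i x w))"
    by (subst (asm) indep_vars_iff_distr_eq_PiM) auto
  then show ?thesis
    by (simp add: law_eq[symmetric] restrict_UNIV)
qed

lemma distr_leaves_colors:
  "distr \<Omega> (Pi\<^sub>M UNIV (\<lambda>_. fell_borel) \<Otimes>\<^sub>M Pi\<^sub>M UNIV (\<lambda>_. field_space)) (\<lambda>w. (\<lambda>i. V i w, \<lambda>i x. C i x w)) =
    distr \<Omega> (Pi\<^sub>M UNIV (\<lambda>_. fell_borel)) (\<lambda>w i. V i w) \<Otimes>\<^sub>M Pi\<^sub>M UNIV (\<lambda>_. L)"
proof -
  have "indep_rv \<Omega> (Pi\<^sub>M UNIV (\<lambda>_. fell_borel)) (\<lambda>w i. V i w) (Pi\<^sub>M UNIV (\<lambda>_. field_space)) (\<lambda>w i x. C i x w)"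
    using colors by (simp add: color_copies_def)
  from indep_rv_distr[OF prob_space_axioms this] show ?thesis by (simp add: distr_colors)
qed

text \<open>Colours are independent of the visible parts. For fixed parts, the mean over the colours
  depends only on which points of \<open>S\<close> share an index, and exactly one \<open>K\<close>
  within the square of \<open>S\<close> describes this.\<close>

lemma integral_colored:
  fixes f :: "(real^2 \<Rightarrow> real) \<Rightarrow> real"
  assumes S: "finite S" and bd: "AE w in \<Omega>. \<forall>x\<in>S. x \<notin> model_boundary V w"
    and f[measurable]: "f \<in> borel_measurable (Pi\<^sub>M S (\<lambda>_. borel))" and fb: "\<And>v. v \<in> space (Pi\<^sub>M S (\<lambda>_. borel)) \<Longrightarrow> \<bar>f v\<bar> \<le> B"
  shows "(\<integral>w. f (\<lambda>x\<in>S. colored_dead_leaves V C x w) \<partial>\<Omega>) =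
    (\<Sum>K\<in>Pow (S \<times> S). measure \<Omega> (kernel_event S K) * block_mean L S f K)"
proof -
  have fin: "emeasure \<Omega> (kernel_event S K) < \<infinity>" for K
    by (simp add: emeasure_eq_measure)
  have ki: "integrable \<Omega> (indicat_real (kernel_event S K))" for K
    using kernel_event_sets[OF S] fin by (intro integrable_real_indicator)
  let ?PV = "Pi\<^sub>M UNIV (\<lambda>_::nat. fell_borel) :: (nat \<Rightarrow> (real^2) set) measure"
  let ?PC = "Pi\<^sub>M UNIV (\<lambda>_::nat. field_space)" and ?LC = "Pi\<^sub>M UNIV (\<lambda>_::nat. L)"
  let ?J = "\<lambda>w x. visible_index V x w"
  define D where "D = distr \<Omega> ?PV (\<lambda>w i. V i w)"
  interpret D: prob_space D unfolding D_def by (rule prob_space_distr) measurable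
  interpret L: prob_space L by (rule prob_space_law)
  interpret LC: prob_space ?LC by (rule prob_space_PiM) (rule prob_space_law)
  interpret pair_prob_space D ?LC ..
  have sLC: "sets ?LC = sets ?PC" by (rule sets_PiM_cong) (auto simp: sets_law)
  have law: "distr \<Omega> (?PV \<Otimes>\<^sub>M ?PC) (\<lambda>w. (\<lambda>i. V i w, \<lambda>i x. C i x w)) = D \<Otimes>\<^sub>M ?LC"
    unfolding D_def by (rule distr_leaves_colors)
  define F where "F v c = f (color_by S (least_index v) c)" for v c
  have colm: "(\<lambda>z. color_by S (least_index (fst z)) (snd z)) \<in> measurable (?PV \<Otimes>\<^sub>M ?PC) (Pi\<^sub>M S (\<lambda>_. borel))"
    unfolding color_by_def
  proof (rule measurable_restrict)
    fix x
    have [measurable]: "(\<lambda>z. snd z i x) \<in> borel_measurable (?PV \<Otimes>\<^sub>M ?PC)" for i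
    proof -
      have "(\<lambda>z. snd z i) \<in> measurable (?PV \<Otimes>\<^sub>M ?PC) field_space" by measurable
      from measurable_compose[OF this measurable_component_singleton[of x]] show ?thesis by simp
    qed
    have "(\<lambda>z. least_index (fst z) x) \<in> measurable (?PV \<Otimes>\<^sub>M ?PC) (count_space UNIV)" by measurable
    then show "(\<lambda>z. snd z (least_index (fst z) x) x) \<in> borel_measurable (?PV \<Otimes>\<^sub>M ?PC)"
      by (rule measurable_compose_countable[rotated]) measurable
  qed
  then have Fm[measurable]: "(\<lambda>(v, c). F v c) \<in> borel_measurable (?PV \<Otimes>\<^sub>M ?PC)"
    unfolding F_def case_prod_unfold by measurable
  have Fb: "\<bar>F v c\<bar> \<le> B" for v c
    unfolding F_def by (rule fb) (auto simp: color_by_def space_PiM)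
  have sD: "sets (D \<Otimes>\<^sub>M ?LC) = sets (?PV \<Otimes>\<^sub>M ?PC)"
    by (rule sets_pair_measure_cong) (auto simp: D_def sLC)
  have Fint: "integrable (D \<Otimes>\<^sub>M ?LC) (\<lambda>(v, c). F v c)"
  proof (rule integrable_const_bound[of _ B])
    show "(\<lambda>(v, c). F v c) \<in> borel_measurable (D \<Otimes>\<^sub>M ?LC)"
      using Fm unfolding measurable_cong_sets[OF sD refl] .
  qed (auto intro!: AE_I2 Fb)
  have inner: "(\<integral>c. F (\<lambda>i. V i w) c \<partial>?LC) = (\<Sum>K\<in>Pow (S \<times> S). indicator (kernel_event S K) w * block_mean L S f K)"
    if w: "w \<in> space \<Omega>" for w
  proof -
    define K0 where "K0 = {(x, y). x \<in> S \<and> y \<in> S \<and> ?J w x = ?J w y}"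
    have K0: "has_kernel S K0 (?J w)" by (auto simp: has_kernel_def K0_def)
    have uniq: "w \<in> kernel_event S K \<longleftrightarrow> K = K0" if "K \<in> Pow (S \<times> S)" for K
      using that w by (auto simp: kernel_event_def has_kernel_def K0_def)
    have "(\<integral>c. F (\<lambda>i. V i w) c \<partial>?LC) = block_mean L S f K0"
      unfolding F_def using block_mean_eq[OF prob_space_law sets_law K0 f]
      by (simp add: visible_index_least)
    also have "\<dots> = (\<Sum>K\<in>Pow (S \<times> S). if K = K0 then block_mean L S f K else 0)"
      using S by (subst sum.delta) (auto simp: K0_def)
    also have "\<dots> = (\<Sum>K\<in>Pow (S \<times> S). indicator (kernel_event S K) w * block_mean L S f K)"
      by (intro sum.cong) (auto simp: uniq indicator_def)
    finally show ?thesis .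
  qed
  have "(\<integral>w. f (\<lambda>x\<in>S. colored_dead_leaves V C x w) \<partial>\<Omega>) = (\<integral>w. F (\<lambda>i. V i w) (\<lambda>i x. C i x w) \<partial>\<Omega>)"
  proof (rule integral_cong_AE)
    have "(\<lambda>w. \<lambda>x\<in>S. colored_dead_leaves V C x w) \<in> measurable \<Omega> (Pi\<^sub>M S (\<lambda>_. borel))"
      by (rule measurable_restrict) measurable
    then show "(\<lambda>w. f (\<lambda>x\<in>S. colored_dead_leaves V C x w)) \<in> borel_measurable \<Omega>" by measurable
    have "(\<lambda>w. (\<lambda>i. V i w, \<lambda>i x. C i x w)) \<in> measurable \<Omega> (?PV \<Otimes>\<^sub>M ?PC)" by measurable
    from measurable_compose[OF this Fm]
    show "(\<lambda>w. F (\<lambda>i. V i w) (\<lambda>i x. C i x w)) \<in> borel_measurable \<Omega>" by simp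
    show "AE w in \<Omega>. f (\<lambda>x\<in>S. colored_dead_leaves V C x w) = F (\<lambda>i. V i w) (\<lambda>i x. C i x w)"
      using bd
    proof eventually_elim
      case (elim w)
      then have "(\<lambda>x\<in>S. colored_dead_leaves V C x w) = color_by S (least_index (\<lambda>i. V i w)) (\<lambda>i x. C i x w)"
        by (auto simp: color_by_def colored_dead_leaves_def visible_index_least)
      then show ?case by (simp add: F_def)
    qed
  qed
  also have "\<dots> = (\<integral>z. (\<lambda>(v, c). F v c) z \<partial>distr \<Omega> (?PV \<Otimes>\<^sub>M ?PC) (\<lambda>w. (\<lambda>i. V i w, \<lambda>i x. C i x w)))"
    by (subst integral_distr) auto
  also have "\<dots> = (\<integral>v. \<integral>c. F v c \<partial>?LC \<partial>D)"
    unfolding law using integral_fst'[OF Fint] by simp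
  also have "\<dots> = (\<integral>w. \<integral>c. F (\<lambda>i. V i w) c \<partial>?LC \<partial>\<Omega>)"
  proof -
    have "(\<lambda>(v, c). F v c) \<in> borel_measurable (D \<Otimes>\<^sub>M ?LC)" using Fint by (rule borel_measurable_integrable)
    then have "(\<lambda>v. \<integral>c. F v c \<partial>?LC) \<in> borel_measurable D"
      by (rule LC.borel_measurable_lebesgue_integral)
    then show ?thesis unfolding D_def by (subst integral_distr) auto
  qed
  also have "\<dots> = (\<integral>w. (\<Sum>K\<in>Pow (S \<times> S). indicator (kernel_event S K) w * block_mean L S f K) \<partial>\<Omega>)"
    by (intro Bochner_Integration.integral_cong refl inner)
  also have "\<dots> = (\<Sum>K\<in>Pow (S \<times> S). measure \<Omega> (kernel_event S K) * block_mean L S f K)"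
    using kernel_event_sets[OF S] by (subst Bochner_Integration.integral_sum) (auto simp: ki)
  finally show ?thesis .
qed

end

section \<open>The limit process\<close>

text \<open>Numbering \<open>S\<close> turns \<open>f\<close> into a continuous function of real
  sequences, and on sequences the product sigma-algebra is the Borel one.\<close>

lemma borel_measurable_powertop_real:
  fixes f :: "('s \<Rightarrow> real) \<Rightarrow> real"
  assumes S: "finite S" and f: "continuous_map (powertop_real S) euclideanreal f"
  shows "f \<in> borel_measurable (Pi\<^sub>M S (\<lambda>_. borel))"
proof -
  obtain e where e: "bij_betw e S {..<card S}"
    using ex_bij_betw_finite_nat[OF S] atLeast0LessThan by auto
  define r where "r v = (\<lambda>x\<in>S. v (e x))" for v :: "nat \<Rightarrow> real"
  define s where "s v n = v (inv_into S e n)" for v :: "'s \<Rightarrow> real" and n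
  define s' where "s' v n = (if n < card S then s v n else 0)" for v :: "'s \<Rightarrow> real" and n
  have "continuous_map euclidean (powertop_real S) r"
    unfolding continuous_map_componentwise r_def by auto
  then have "continuous_map euclidean euclideanreal (f \<circ> r)"
    using f by (rule continuous_map_compose)
  then have "continuous_on UNIV (f \<circ> r)" by simp
  then have fr: "f \<circ> r \<in> borel_measurable borel" by (rule borel_measurable_continuous_onI)
  have s'm: "s' \<in> measurable (Pi\<^sub>M S (\<lambda>_. borel)) borel"
  proof -
    have "(\<lambda>v. s' v n) \<in> borel_measurable (Pi\<^sub>M S (\<lambda>_. borel))" for n
    proof (cases "n < card S")
      case True
      then have "inv_into S e n \<in> S" using e by (intro inv_into_into) (auto simp: bij_betw_def)
      then show ?thesis using True by (simp add: s'_def s_def)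
    qed (simp add: s'_def)
    then have "s' \<in> measurable (Pi\<^sub>M S (\<lambda>_. borel)) (Pi\<^sub>M UNIV (\<lambda>_. borel))"
      by (intro measurable_PiM_single') (auto simp: space_PiM)
    then show ?thesis using sets_PiM_equal_borel measurable_cong_sets by blast
  qed
  have "f v = (f \<circ> r) (s' v)" if "v \<in> space (Pi\<^sub>M S (\<lambda>_. borel :: real measure))" for v
  proof -
    have "r (s' v) = v"
    proof
      fix x show "r (s' v) x = v x"
      proof (cases "x \<in> S")
        case True
        then have "e x < card S" "inv_into S e (e x) = x" using e by (auto simp: bij_betw_def)
        then show ?thesis using True by (simp add: r_def s'_def s_def)
      next
        case False
        then show ?thesis using that PiE_arb[of v S "\<lambda>_. UNIV" x] by (simp add: r_def space_PiM)
      qed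
    qed
    then show ?thesis by simp
  qed
  then show ?thesis
    using measurable_compose[OF s'm fr] by (subst measurable_cong) auto
qed

text \<open>The candidate for the limit marginal: a partition \<open>K\<close> is drawn with weight
  \<open>l K\<close>, and its classes are then coloured independently.\<close>

definition kernel_mixture :: "((real^2) \<Rightarrow> real) measure \<Rightarrow> (real^2) set \<Rightarrow>
    (((real^2) \<times> (real^2)) set \<Rightarrow> real) \<Rightarrow> ((real^2) \<Rightarrow> real) measure" where
  "kernel_mixture L S l = distr (point_measure (Pow (S \<times> S)) (\<lambda>K. ennreal (l K)) \<Otimes>\<^sub>M Pi\<^sub>M UNIV (\<lambda>_. L))
     (Pi\<^sub>M S (\<lambda>_. borel)) (\<lambda>(K, c). color_by S (representative S K) c)"

context
  fixes L :: "((real^2) \<Rightarrow> real) measure" and S :: "(real^2) set"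
    and l :: "((real^2) \<times> (real^2)) set \<Rightarrow> real"
  assumes L: "prob_space L" "sets L = sets field_space" and S: "finite S"
    and l: "\<And>K. K \<in> Pow (S \<times> S) \<Longrightarrow> 0 \<le> l K" "(\<Sum>K\<in>Pow (S \<times> S). l K) = 1"
begin

lemma prob_space_weights: "prob_space (point_measure (Pow (S \<times> S)) (\<lambda>K. ennreal (l K)))"
proof
  show "emeasure (point_measure (Pow (S \<times> S)) (\<lambda>K. ennreal (l K)))
    (space (point_measure (Pow (S \<times> S)) (\<lambda>K. ennreal (l K)))) = 1"
  proof -
    have "(\<Sum>K\<in>Pow (S \<times> S). ennreal (l K)) = ennreal (\<Sum>K\<in>Pow (S \<times> S). l K)"
      using l(1) by (rule sum_ennreal)
    then show ?thesis using S by (simp add: space_point_measure emeasure_point_measure_finite l(2))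
  qed
qed

lemma kernel_mixture_map:
  "(\<lambda>(K, c). color_by S (representative S K) c) \<in>
    measurable (point_measure (Pow (S \<times> S)) (\<lambda>K. ennreal (l K)) \<Otimes>\<^sub>M Pi\<^sub>M UNIV (\<lambda>_. L)) (Pi\<^sub>M S (\<lambda>_. borel))"
proof -
  have "(\<lambda>(K, c). color_by S (representative S K) c) \<in>
    measurable (count_space (Pow (S \<times> S)) \<Otimes>\<^sub>M Pi\<^sub>M UNIV (\<lambda>_. L)) (Pi\<^sub>M S (\<lambda>_. borel))"
    using S color_by_measurable[OF L(2), of _ S UNIV]
    by (intro measurable_pair_measure_countable1 countable_finite) auto
  then show ?thesis
    using measurable_cong_sets[OF sets_pair_measure_cong[OF sets_point_measure_count_space refl] refl] by blast
qed

lemma prob_space_kernel_mixture: "prob_space (kernel_mixture L S l)"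
proof -
  interpret pt: prob_space "point_measure (Pow (S \<times> S)) (\<lambda>K. ennreal (l K))" by (rule prob_space_weights)
  interpret LC: prob_space "Pi\<^sub>M UNIV (\<lambda>_::nat. L)" by (rule prob_space_PiM) (rule L)
  interpret pair_prob_space "point_measure (Pow (S \<times> S)) (\<lambda>K. ennreal (l K))" "Pi\<^sub>M UNIV (\<lambda>_::nat. L)" ..
  show ?thesis
    unfolding kernel_mixture_def by (rule prob_space_distr) (rule kernel_mixture_map)
qed

lemma integral_kernel_mixture:
  assumes f: "f \<in> borel_measurable (Pi\<^sub>M S (\<lambda>_. borel))"
    and fb: "\<And>v. v \<in> space (Pi\<^sub>M S (\<lambda>_. borel)) \<Longrightarrow> \<bar>f v\<bar> \<le> (B :: real)"
  shows "(\<integral>v. f v \<partial>kernel_mixture L S l) = (\<Sum>K\<in>Pow (S \<times> S). l K * block_mean L S f K)"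
proof -
  let ?pt = "point_measure (Pow (S \<times> S)) (\<lambda>K. ennreal (l K))" and ?LC = "Pi\<^sub>M UNIV (\<lambda>_::nat. L)"
  interpret pt: prob_space ?pt by (rule prob_space_weights)
  interpret LC: prob_space ?LC by (rule prob_space_PiM) (rule L)
  interpret pair_prob_space ?pt ?LC ..
  have m: "(\<lambda>(K, c). f (color_by S (representative S K) c)) \<in> borel_measurable (?pt \<Otimes>\<^sub>M ?LC)"
    using measurable_compose[OF kernel_mixture_map f] by (simp add: case_prod_unfold)
  have int: "integrable (?pt \<Otimes>\<^sub>M ?LC) (\<lambda>(K, c). f (color_by S (representative S K) c))"
  proof (rule P.integrable_const_bound[of _ B])
    show "AE x in ?pt \<Otimes>\<^sub>M ?LC. norm (case x of (K, c) \<Rightarrow> f (color_by S (representative S K) c)) \<le> B"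
      by (intro AE_I2) (auto intro!: fb simp: color_by_def space_PiM)
  qed (rule m)
  have "(\<integral>v. f v \<partial>kernel_mixture L S l) = (\<integral>z. (\<lambda>(K, c). f (color_by S (representative S K) c)) z \<partial>(?pt \<Otimes>\<^sub>M ?LC))"
    unfolding kernel_mixture_def using kernel_mixture_map f by (subst integral_distr) (auto simp: case_prod_unfold)
  also have "\<dots> = (\<integral>K. block_mean L S f K \<partial>?pt)"
    unfolding block_mean_def using integral_fst'[OF int] by simp
  also have "\<dots> = (\<Sum>K\<in>Pow (S \<times> S). l K * block_mean L S f K)"
    using S l by (subst lebesgue_integral_point_measure_finite) auto
  finally show ?thesis .
qed

end

lemma sets_kernel_mixture: "sets (kernel_mixture L S l) = sets (Pi\<^sub>M S (\<lambda>_. borel))"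
  by (simp add: kernel_mixture_def)

text \<open>Convergence of the kernel weights gives a consistent family of limit marginals, since
  consistency passes to the limit.\<close>

lemma fdd_converges_of_kernel_weights:
  fixes \<Omega> :: "'r \<Rightarrow> 'w measure" and Z :: "'r \<Rightarrow> real^2 \<Rightarrow> 'w \<Rightarrow> real" and L :: "((real^2) \<Rightarrow> real) measure"
    and q :: "'r \<Rightarrow> (real^2) set \<Rightarrow> ((real^2) \<times> (real^2)) set \<Rightarrow> real"
  assumes F: "F \<noteq> bot" and L: "prob_space L" "sets L = sets field_space"
    and rf: "\<forall>\<^sub>F r in F. random_field (\<Omega> r) (Z r)"
    and formula: "\<And>S f B. finite S \<Longrightarrow> f \<in> borel_measurable (Pi\<^sub>M S (\<lambda>_. borel)) \<Longrightarrow>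
      (\<And>v. v \<in> space (Pi\<^sub>M S (\<lambda>_. borel)) \<Longrightarrow> \<bar>f v\<bar> \<le> (B :: real)) \<Longrightarrow>
      \<forall>\<^sub>F r in F. (\<integral>w. f (\<lambda>x\<in>S. Z r x w) \<partial>\<Omega> r) = (\<Sum>K\<in>Pow (S \<times> S). q r S K * block_mean L S f K)"
    and nonneg: "\<And>r S K. 0 \<le> q r S K"
    and lim: "\<And>S K. finite S \<Longrightarrow> \<exists>l. ((\<lambda>r. q r S K) \<longlongrightarrow> l) F"
  shows "\<exists>(\<Omega>0 :: (real^2 \<Rightarrow> real) measure) (I0 :: real^2 \<Rightarrow> (real^2 \<Rightarrow> real) \<Rightarrow> real). fdd_converges \<Omega> Z \<Omega>0 I0 F"
proof -
  define l where "l S K = (SOME l. ((\<lambda>r. q r S K) \<longlongrightarrow> l) F)" for S K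
  have l: "((\<lambda>r. q r S K) \<longlongrightarrow> l S K) F" if "finite S" for S K
    unfolding l_def by (rule someI_ex[OF lim[OF that]])
  have l0: "0 \<le> l S K" if "finite S" for S K
    by (rule tendsto_lowerbound[OF l[OF that]]) (auto simp: nonneg F)
  \<comment> \<open>A finite sum whose coefficients converge. So convergence holds for every bounded
    measurable \<open>f\<close>, continuous or not, and indicators may be used below.\<close>
  have conv: "((\<lambda>r. \<integral>w. f (\<lambda>x\<in>S. Z r x w) \<partial>\<Omega> r) \<longlongrightarrow> (\<Sum>K\<in>Pow (S \<times> S). l S K * block_mean L S f K)) F"
    if S: "finite S" and f: "f \<in> borel_measurable (Pi\<^sub>M S (\<lambda>_. borel))"
      "\<And>v. v \<in> space (Pi\<^sub>M S (\<lambda>_. borel)) \<Longrightarrow> \<bar>f v\<bar> \<le> (B :: real)" for S f B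
  proof -
    have "((\<lambda>r. \<Sum>K\<in>Pow (S \<times> S). q r S K * block_mean L S f K) \<longlongrightarrow> (\<Sum>K\<in>Pow (S \<times> S). l S K * block_mean L S f K)) F"
      by (intro tendsto_sum tendsto_mult tendsto_const l S)
    moreover have "\<forall>\<^sub>F r in F. (\<integral>w. f (\<lambda>x\<in>S. Z r x w) \<partial>\<Omega> r) = (\<Sum>K\<in>Pow (S \<times> S). q r S K * block_mean L S f K)"
      by (rule formula[OF S f])
    ultimately show ?thesis by (simp add: tendsto_cong)
  qed
  have bm1: "block_mean L S (\<lambda>_. 1) K = 1" for S K
  proof -
    interpret LC: prob_space "Pi\<^sub>M UNIV (\<lambda>_::nat. L)" by (rule prob_space_PiM) (rule L)
    show ?thesis by (simp add: block_mean_def LC.prob_space)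
  qed
  \<comment> \<open>The constant test function 1 shows that no mass is lost in the limit.\<close>
  have l1: "(\<Sum>K\<in>Pow (S \<times> S). l S K) = 1" if "finite S" for S
  proof -
    have "((\<lambda>r. \<integral>w. 1 \<partial>\<Omega> r) \<longlongrightarrow> (\<Sum>K\<in>Pow (S \<times> S). l S K)) F"
      using conv[OF that, of "\<lambda>_. 1" 1] by (simp add: bm1)
    moreover have "\<forall>\<^sub>F r in F. (\<integral>w. 1 \<partial>\<Omega> r) = (1 :: real)"
      using rf by eventually_elim (simp add: random_field_def prob_space.prob_space)
    ultimately have "((\<lambda>_. 1) \<longlongrightarrow> (\<Sum>K\<in>Pow (S \<times> S). l S K)) F" by (rule Lim_transform_eventually)
    then show ?thesis using F by (simp add: tendsto_const_iff)
  qed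
  define P where "P S = kernel_mixture L S (l S)" for S
  note mix = prob_space_kernel_mixture[OF L _ l0 l1] integral_kernel_mixture[OF L _ l0 l1]
  have sP: "sets (P S) = sets (Pi\<^sub>M S (\<lambda>_. borel))" for S unfolding P_def by (rule sets_kernel_mixture)
  have prP: "prob_space (P S)" if "finite S" for S unfolding P_def using that by (intro mix) auto
  have convP: "((\<lambda>r. \<integral>w. f (\<lambda>x\<in>S. Z r x w) \<partial>\<Omega> r) \<longlongrightarrow> (\<integral>v. f v \<partial>P S)) F"
    if S: "finite S" and f: "f \<in> borel_measurable (Pi\<^sub>M S (\<lambda>_. borel))"
      "\<And>v. v \<in> space (Pi\<^sub>M S (\<lambda>_. borel)) \<Longrightarrow> \<bar>f v\<bar> \<le> (B :: real)" for S f B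
  proof -
    have "(\<integral>v. f v \<partial>P S) = (\<Sum>K\<in>Pow (S \<times> S). l S K * block_mean L S f K)"
      unfolding P_def by (rule mix(2)[OF S S S f])
    moreover have "((\<lambda>r. \<integral>w. f (\<lambda>x\<in>S. Z r x w) \<partial>\<Omega> r) \<longlongrightarrow> (\<Sum>K\<in>Pow (S \<times> S). l S K * block_mean L S f K)) F"
      by (rule conv[OF S f])
    ultimately show ?thesis by simp
  qed
  \<comment> \<open>On a measurable set, both measures are the limit of the probability that the
    values on \<open>J\<close> belong to it.\<close>
  have proj: "P J = distr (P H) (Pi\<^sub>M J (\<lambda>_. borel)) (\<lambda>f. restrict f J)" if JH: "J \<subseteq> H" "finite H" for J H
  proof -
    have J: "finite J" using JH by (rule finite_subset)
    interpret PJ: prob_space "P J" by (rule prP[OF J])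
    interpret PH: prob_space "P H" by (rule prP[OF JH(2)])
    have rm: "(\<lambda>f. restrict f J) \<in> measurable (Pi\<^sub>M H (\<lambda>_. borel :: real measure)) (Pi\<^sub>M J (\<lambda>_. borel))"
      using JH by (intro measurable_restrict_subset) auto
    then have rmP: "(\<lambda>f. restrict f J) \<in> measurable (P H) (Pi\<^sub>M J (\<lambda>_. borel :: real measure))"
      using measurable_cong_sets[OF sP refl] by blast
    interpret D: prob_space "distr (P H) (Pi\<^sub>M J (\<lambda>_. borel)) (\<lambda>f. restrict f J)"
      by (rule PH.prob_space_distr[OF rmP])
    show ?thesis
    proof (rule measure_eqI)
      show "sets (P J) = sets (distr (P H) (Pi\<^sub>M J (\<lambda>_. borel)) (\<lambda>f. restrict f J))" by (simp add: sP)
      fix A assume "A \<in> sets (P J)"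
      then have A: "A \<in> sets (Pi\<^sub>M J (\<lambda>_. borel :: real measure))" by (simp add: sP)
      have Ai: "indicat_real A \<in> borel_measurable (Pi\<^sub>M J (\<lambda>_. borel))" using A by simp
      have "((\<lambda>r. \<integral>w. indicat_real A (\<lambda>x\<in>J. Z r x w) \<partial>\<Omega> r) \<longlongrightarrow> (\<integral>v. indicat_real A v \<partial>P J)) F"
        by (rule convP[OF J Ai, of 1]) (auto simp: indicator_def)
      moreover have "((\<lambda>r. \<integral>w. indicat_real A (restrict (\<lambda>x\<in>H. Z r x w) J) \<partial>\<Omega> r) \<longlongrightarrow>
          (\<integral>v. indicat_real A (restrict v J) \<partial>P H)) F"
        by (rule convP[OF JH(2) measurable_compose[OF rm Ai], of 1]) (auto simp: indicator_def)
      moreover have "restrict (\<lambda>x\<in>H. Z r x w) J = (\<lambda>x\<in>J. Z r x w)" for r w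
        using JH by (auto simp: restrict_def fun_eq_iff)
      ultimately have "(\<integral>v. indicat_real A v \<partial>P J) = (\<integral>v. indicat_real A (restrict v J) \<partial>P H)"
        using tendsto_unique[OF F] by simp
      also have "\<dots> = (\<integral>v. indicat_real A v \<partial>distr (P H) (Pi\<^sub>M J (\<lambda>_. borel)) (\<lambda>f. restrict f J))"
        by (rule integral_distr[symmetric, OF rmP Ai])
      finally have "measure (P J) A = measure (distr (P H) (Pi\<^sub>M J (\<lambda>_. borel)) (\<lambda>f. restrict f J)) A"
        using A sets.sets_into_space[OF A] sets_eq_imp_space_eq[OF sP[of J]] by (simp add: Int_absorb2 sP)
      then show "emeasure (P J) A = emeasure (distr (P H) (Pi\<^sub>M J (\<lambda>_. borel)) (\<lambda>f. restrict f J)) A"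
        by (simp add: PJ.emeasure_eq_measure D.emeasure_eq_measure)
    qed
  qed
  \<comment> \<open>Kolmogorov extension of the consistent marginals. The coordinates on the
    resulting space form the limit process.\<close>
  interpret polish_projective UNIV P
    by (intro polish_projective.intro projective_family.intro proj prP)
  define \<Omega>0 where "\<Omega>0 = lim"
  have s0: "sets \<Omega>0 = sets field_space" by (simp add: \<Omega>0_def)
  have pr0: "prob_space \<Omega>0" unfolding \<Omega>0_def by (rule P.prob_space_axioms)
  have rs: "(\<lambda>w. restrict w S) \<in> measurable \<Omega>0 (Pi\<^sub>M S (\<lambda>_. borel :: real measure))" for S
    unfolding measurable_cong_sets[OF s0 refl] by (rule measurable_restrict_subset) simp
  have marg: "distr \<Omega>0 (Pi\<^sub>M S (\<lambda>_. borel)) (\<lambda>w. restrict w S) = P S" if S: "finite S" for S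
  proof (rule measure_eqI)
    show "sets (distr \<Omega>0 (Pi\<^sub>M S (\<lambda>_. borel)) (\<lambda>w. restrict w S)) = sets (P S)" by (simp add: sP)
    fix A assume "A \<in> sets (distr \<Omega>0 (Pi\<^sub>M S (\<lambda>_. borel)) (\<lambda>w. restrict w S))"
    then have A: "A \<in> sets (Pi\<^sub>M S (\<lambda>_. borel :: real measure))" by simp
    have "emeasure (distr \<Omega>0 (Pi\<^sub>M S (\<lambda>_. borel)) (\<lambda>w. restrict w S)) A = emeasure \<Omega>0 (emb UNIV S A)"
      using A rs sets_eq_imp_space_eq[OF s0] by (simp add: emeasure_distr prod_emb_def space_PiM)
    also have "\<dots> = emeasure (P S) A"
      unfolding \<Omega>0_def using emeasure_lim_emb[OF _ S A] by simp
    finally show "emeasure (distr \<Omega>0 (Pi\<^sub>M S (\<lambda>_. borel)) (\<lambda>w. restrict w S)) A = emeasure (P S) A" .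
  qed
  have "fdd_converges \<Omega> Z \<Omega>0 (\<lambda>x w. w x) F"
    unfolding fdd_converges_def
  proof (intro conjI allI impI rf)
    have "(\<lambda>w. w x) \<in> borel_measurable \<Omega>0" for x :: "real^2"
      unfolding measurable_cong_sets[OF s0 refl] by (rule measurable_component_singleton) simp
    then show "random_field \<Omega>0 (\<lambda>x w. w x)" by (simp add: random_field_def pr0)
    fix S :: "(real^2) set" and f :: "(real^2 \<Rightarrow> real) \<Rightarrow> real"
    assume S: "finite S" and f: "continuous_map (powertop_real S) euclideanreal f"
      and b: "bounded (f ` topspace (powertop_real S))"
    have fm: "f \<in> borel_measurable (Pi\<^sub>M S (\<lambda>_. borel))" by (rule borel_measurable_powertop_real[OF S f])
    obtain B where B: "\<And>v. v \<in> topspace (powertop_real S) \<Longrightarrow> \<bar>f v\<bar> \<le> B"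
      using b by (auto simp: bounded_iff)
    have "((\<lambda>r. \<integral>w. f (\<lambda>x\<in>S. Z r x w) \<partial>\<Omega> r) \<longlongrightarrow> (\<integral>v. f v \<partial>P S)) F"
      by (rule convP[OF S fm, of B]) (rule B, simp add: space_PiM)
    also have "(\<integral>v. f v \<partial>P S) = (\<integral>w. f (restrict w S) \<partial>\<Omega>0)"
      unfolding marg[OF S, symmetric] by (rule integral_distr[OF rs fm])
    finally show "((\<lambda>r. \<integral>w. f (\<lambda>x\<in>S. Z r x w) \<partial>\<Omega> r) \<longlongrightarrow> (\<integral>w. f (\<lambda>x\<in>S. w x) \<partial>\<Omega>0)) F" .
  qed
  then show ?thesis by blast
qed

section \<open>Scaled grains\<close>

lemma emeasure_lborel_scaleR:
  fixes A :: "'a::euclidean_space set"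
  assumes A: "closed A" and c: "c \<noteq> 0"
  shows "emeasure lborel ((*\<^sub>R) c ` A) = ennreal (\<bar>c\<bar> ^ DIM('a)) * emeasure lborel A"
proof -
  have cA: "(*\<^sub>R) c ` A \<in> sets borel" using closed_scaling[OF A, of c] by simp
  have "lborel = density (distr lborel borel (\<lambda>y::'a. 0 + c *\<^sub>R y)) (\<lambda>_. ennreal (\<bar>c\<bar> ^ DIM('a)))"
    using c by (rule lborel_affine)
  then have "emeasure lborel ((*\<^sub>R) c ` A) =
    emeasure (density (distr lborel borel (\<lambda>y. c *\<^sub>R y)) (\<lambda>_. ennreal (\<bar>c\<bar> ^ DIM('a)))) ((*\<^sub>R) c ` A)"
    by simp
  also have "\<dots> = ennreal (\<bar>c\<bar> ^ DIM('a)) * emeasure lborel ((\<lambda>y. c *\<^sub>R y) -` ((*\<^sub>R) c ` A))"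
    using cA by (simp add: emeasure_density_const emeasure_distr)
  also have "(\<lambda>y. c *\<^sub>R y) -` ((*\<^sub>R) c ` A) = A" using c by auto
  finally show ?thesis .
qed

lemma frontier_scaleR:
  fixes A :: "'a::euclidean_space set"
  assumes "c \<noteq> 0"
  shows "frontier ((*\<^sub>R) c ` A) = (*\<^sub>R) c ` frontier A"
proof -
  have i: "inj ((*\<^sub>R) c :: 'a \<Rightarrow> 'a)" using assms by (simp add: inj_def)
  have "interior ((*\<^sub>R) c ` A) = (*\<^sub>R) c ` interior A"
    by (rule interior_injective_linear_image) (auto simp: i linear_scaleR)
  then show ?thesis
    unfolding frontier_def by (simp add: closure_scaleR[symmetric] image_set_diff[OF i])
qed

lemma fell_emeasure_measurable:
  assumes "Measurable.pred (fell_borel \<Otimes>\<^sub>M (lborel :: 'a::euclidean_space measure)) (\<lambda>z. Q (fst z) (snd z))"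
  shows "(\<lambda>F. emeasure lborel {y. Q F y}) \<in> borel_measurable (fell_borel :: 'b::euclidean_space set measure)"
proof -
  have "{z \<in> space (fell_borel \<Otimes>\<^sub>M lborel). Q (fst z) (snd z)} \<in> sets ((fell_borel :: 'b set measure) \<Otimes>\<^sub>M (lborel :: 'a measure))"
    using assms by (simp add: pred_def)
  from lborel.measurable_emeasure_Pair[OF this]
  show ?thesis
    by (rule measurable_cong[THEN iffD1, rotated]) (auto simp: space_pair_measure vimage_def)
qed

lemma fell_pred:
  fixes x :: "'a::euclidean_space"
  shows "Measurable.pred (fell_borel \<Otimes>\<^sub>M lborel) (\<lambda>z. x - snd z \<in> fst z)"
    and "Measurable.pred (fell_borel \<Otimes>\<^sub>M lborel) (\<lambda>z. fst z \<inter> ball (x - snd z) e \<noteq> {})"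
    and "Measurable.pred (fell_borel \<Otimes>\<^sub>M lborel) (\<lambda>z. snd z \<in> frontier (fst z :: 'a set))"
  using sets_fell_mem[of fst "fell_borel \<Otimes>\<^sub>M lborel" "\<lambda>z. x - snd z"]
    sets_fell_hit_ball[of fst "fell_borel \<Otimes>\<^sub>M lborel" "\<lambda>z. x - snd z" e]
    sets_fell_frontier[of fst "fell_borel \<Otimes>\<^sub>M lborel" "snd"]
  by (auto simp: pred_def)

definition trace_of :: "(real^2) set \<Rightarrow> (real^2) set \<Rightarrow> real^2 \<Rightarrow> (real^2) set" where
  "trace_of S F y = {x \<in> S. x - y \<in> F}"

lemma trace_of_measurable:
  assumes "finite S"
  shows "(\<lambda>F. emeasure lborel {y. trace_of S F y = B}) \<in> borel_measurable (fell_borel :: (real^2) set measure)"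
proof (cases "B \<subseteq> S")
  case True
  then have "trace_of S F y = B \<longleftrightarrow> (\<forall>x\<in>S. (x - y \<in> F) = (x \<in> B))" for F y by (auto simp: trace_of_def)
  then show ?thesis
    using assms fell_pred(1)[where ?'a = "real^2", measurable]
    by (simp only:) (intro fell_emeasure_measurable, measurable)
next
  case False
  then have "{y. trace_of S F y = B} = {}" for F by (auto simp: trace_of_def)
  then show ?thesis by simp
qed

locale typical_grain = prob_space P for P :: "'p measure" +
  fixes Y :: "'p \<Rightarrow> (real^2) set" and a1 a2 :: real
  assumes Y_measurable[measurable]: "Y \<in> measurable P fell_borel"
    and a_pos: "0 < a1" "0 < a2"
    and bounds: "AE w in P. cball 0 a1 \<subseteq> Y w \<and> Y w \<subseteq> cball 0 a2"
    and frontier_Y: "AE w in P. emeasure lborel (frontier (Y w)) = 0"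

locale scaled_grain = typical_grain P Y a1 a2
  for P :: "'p measure" and Y :: "'p \<Rightarrow> (real^2) set" and a1 a2 :: real +
  fixes \<alpha> r0 c :: real and r1 :: ereal and R :: "'p \<Rightarrow> real"
  assumes r0: "0 < r0" and tail: "r1 < \<infinity> \<or> 3 < \<alpha>" and c: "0 < c"
    and R_distributed: "distributed P lborel R
        (\<lambda>r. ennreal (c * r powr (-\<alpha>) * indicator {r. r0 \<le> r \<and> ereal r \<le> r1} r))"
    and R_Y_indep: "indep_rv P borel R fell_borel Y"
begin

definition leaf_law :: "(real^2) set measure" where
  "leaf_law = distr P fell_borel (\<lambda>w. (*\<^sub>R) (R w) ` Y w)"

lemma R_measurable[measurable]: "R \<in> borel_measurable P"
  using R_distributed by (auto simp: distributed_def)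

lemma AE_R: "AE w in P. r0 \<le> R w \<and> ereal (R w) \<le> r1"
proof -
  have "Measurable.pred lborel (\<lambda>r. r0 \<le> r \<and> ereal r \<le> r1)" by measurable
  then show ?thesis
    by (subst distributed_AE2[OF R_distributed]) (auto intro!: AE_I2 simp: indicator_def split: if_splits)
qed

lemma leaf_measurable[measurable]: "(\<lambda>w. (*\<^sub>R) (R w) ` Y w) \<in> measurable P fell_borel"
  by (rule measurable_fell_scaleR) measurable

lemma nn_integral_leaf:
  "g \<in> borel_measurable fell_borel \<Longrightarrow> (\<integral>\<^sup>+F. g F \<partial>leaf_law) = (\<integral>\<^sup>+w. g ((*\<^sub>R) (R w) ` Y w) \<partial>P)"
  unfolding leaf_law_def by (simp add: nn_integral_distr)

text \<open>By independence the grain is averaged separately for each radius. In the resulting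
  integral over radii the cutoff \<open>r0\<close> appears only as lower limit and through the
  constant \<open>c\<close>.\<close>

lemma nn_integral_leaf_density:
  assumes g: "g \<in> borel_measurable fell_borel"
  shows "(\<lambda>r. \<integral>\<^sup>+w. g ((*\<^sub>R) r ` Y w) \<partial>P) \<in> borel_measurable borel"
    and "(\<integral>\<^sup>+F. g F \<partial>leaf_law) = (\<integral>\<^sup>+r. ennreal (c * r powr (-\<alpha>) * indicator {r. r0 \<le> r \<and> ereal r \<le> r1} r) *
      (\<integral>\<^sup>+w. g ((*\<^sub>R) r ` Y w) \<partial>P) \<partial>lborel)"
proof -
  let ?D = "distr P fell_borel Y"
  interpret D: prob_space ?D by (rule prob_space_distr) measurable
  have sc: "(\<lambda>z. (*\<^sub>R) (fst z) ` (snd z)) \<in> measurable ((borel :: real measure) \<Otimes>\<^sub>M (fell_borel :: (real^2) set measure)) fell_borel"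
    by (rule measurable_fell_scaleR) measurable
  have gm: "(\<lambda>z. g ((*\<^sub>R) (fst z) ` (snd z))) \<in> borel_measurable ((borel :: real measure) \<Otimes>\<^sub>M (fell_borel :: (real^2) set measure))"
    by (rule measurable_compose[OF sc g])
  then have gm': "(\<lambda>z. g ((*\<^sub>R) (fst z) ` (snd z))) \<in> borel_measurable ((borel :: real measure) \<Otimes>\<^sub>M ?D)"
    by (simp cong: measurable_cong_sets sets_pair_measure_cong)
  have inner: "(\<integral>\<^sup>+F. g ((*\<^sub>R) r ` F) \<partial>?D) = (\<integral>\<^sup>+w. g ((*\<^sub>R) r ` Y w) \<partial>P)" for r
  proof (rule nn_integral_distr)
    have "(\<lambda>F. (*\<^sub>R) r ` F) \<in> measurable (fell_borel :: (real^2) set measure) fell_borel"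
      by (rule measurable_fell_scaleR) measurable
    from measurable_compose[OF this g]
    show "(\<lambda>F. g ((*\<^sub>R) r ` F)) \<in> borel_measurable (distr P fell_borel Y)" by simp
  qed measurable
  show m: "(\<lambda>r. \<integral>\<^sup>+w. g ((*\<^sub>R) r ` Y w) \<partial>P) \<in> borel_measurable borel"
    using D.borel_measurable_nn_integral_fst[OF gm'] by (simp add: inner)
  have "(\<integral>\<^sup>+F. g F \<partial>leaf_law) = (\<integral>\<^sup>+w. g ((*\<^sub>R) (R w) ` Y w) \<partial>P)" by (rule nn_integral_leaf[OF g])
  also have "\<dots> = (\<integral>\<^sup>+z. g ((*\<^sub>R) (fst z) ` (snd z)) \<partial>distr P (borel \<Otimes>\<^sub>M fell_borel) (\<lambda>w. (R w, Y w)))"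
    using gm by (subst nn_integral_distr) auto
  also have "\<dots> = (\<integral>\<^sup>+r. (\<integral>\<^sup>+F. g ((*\<^sub>R) r ` F) \<partial>?D) \<partial>distr P borel R)"
    unfolding indep_rv_distr[OF prob_space_axioms R_Y_indep]
    using D.nn_integral_fst[of "\<lambda>z. g ((*\<^sub>R) (fst z) ` (snd z))" "distr P borel R"] gm'
    by (simp cong: measurable_cong_sets sets_pair_measure_cong)
  also have "\<dots> = (\<integral>\<^sup>+w. (\<integral>\<^sup>+w'. g ((*\<^sub>R) (R w) ` Y w') \<partial>P) \<partial>P)"
    unfolding inner using m by (subst nn_integral_distr) auto
  also have "\<dots> = (\<integral>\<^sup>+r. ennreal (c * r powr (-\<alpha>) * indicator {r. r0 \<le> r \<and> ereal r \<le> r1} r) *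
      (\<integral>\<^sup>+w. g ((*\<^sub>R) r ` Y w) \<partial>P) \<partial>lborel)"
    using m by (intro distributed_nn_integral[OF R_distributed, symmetric]) simp
  finally show "(\<integral>\<^sup>+F. g F \<partial>leaf_law) = (\<integral>\<^sup>+r. ennreal (c * r powr (-\<alpha>) * indicator {r. r0 \<le> r \<and> ereal r \<le> r1} r) *
      (\<integral>\<^sup>+w. g ((*\<^sub>R) r ` Y w) \<partial>P) \<partial>lborel)" .
qed

lemma leaf_frontier_null: "AE F in leaf_law. emeasure lborel (frontier F) = 0"
proof -
  have "(\<lambda>F. emeasure lborel {y. y \<in> frontier F}) \<in> borel_measurable (fell_borel :: (real^2) set measure)"
    by (rule fell_emeasure_measurable) (rule fell_pred)
  then have [measurable]: "(\<lambda>F. emeasure lborel (frontier F)) \<in> borel_measurable (fell_borel :: (real^2) set measure)"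
    by simp
  have "AE w in P. emeasure lborel (frontier ((*\<^sub>R) (R w) ` Y w)) = 0"
    using AE_R frontier_Y
  proof eventually_elim
    case (elim w)
    then have "R w \<noteq> 0" using r0 by auto
    then show ?case using elim(2) by (simp add: frontier_scaleR emeasure_lborel_scaleR)
  qed
  then show ?thesis unfolding leaf_law_def by (subst AE_distr_iff) auto
qed

text \<open>Almost surely the leaf contains a disk of radius \<open>a1 * R w\<close>, which has
  positive area.\<close>

lemma leaf_cover_pos: "0 < (\<integral>\<^sup>+F. emeasure lborel {y. x - y \<in> F} \<partial>leaf_law)"
proof (rule ccontr)
  have gm: "(\<lambda>F. emeasure lborel {y. x - y \<in> F}) \<in> borel_measurable (fell_borel :: (real^2) set measure)"
    by (rule fell_emeasure_measurable) (rule fell_pred)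
  assume "\<not> 0 < (\<integral>\<^sup>+F. emeasure lborel {y. x - y \<in> F} \<partial>leaf_law)"
  then have "(\<integral>\<^sup>+w. emeasure lborel {y. x - y \<in> (*\<^sub>R) (R w) ` Y w} \<partial>P) = 0"
    by (simp add: nn_integral_leaf[OF gm])
  then have "AE w in P. emeasure lborel {y. x - y \<in> (*\<^sub>R) (R w) ` Y w} = 0"
    using measurable_compose[OF leaf_measurable gm] by (subst (asm) nn_integral_0_iff_AE) auto
  then have "AE w in P. False"
    using AE_R bounds AE_space
  proof eventually_elim
    case (elim w)
    have Rp: "0 < R w" using elim(2) r0 by auto
    have cl: "closed ((*\<^sub>R) (R w) ` Y w)" using fell_closed[OF leaf_measurable elim(4)] .
    have "0 < emeasure lborel ((*\<^sub>R) (R w) ` cball (0 :: real^2) a1)"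
      using Rp a_pos emeasure_lborel_scaleR[of "cball (0 :: real^2) a1" "R w"]
      by (simp add: emeasure_cball ennreal_zero_less_mult_iff zero_less_power)
    also have "\<dots> \<le> emeasure lborel ((*\<^sub>R) (R w) ` Y w)"
      using elim(3) cl by (intro emeasure_mono image_mono) auto
    also have "\<dots> = emeasure lborel {y. x - y \<in> (*\<^sub>R) (R w) ` Y w}"
      using cl by (intro emeasure_lborel_reflect[symmetric]) simp
    finally show False using elim(1) by simp
  qed
  then show False by simp
qed

text \<open>The area is at most a constant times the square of the radius, and the second moment of
  the radius is finite because the radii are bounded or \<alpha> > 3.\<close>

lemma leaf_hit_finite: "(\<integral>\<^sup>+F. emeasure lborel {y. F \<inter> ball (x - y) 1 \<noteq> {}} \<partial>leaf_law) < \<infinity>"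
proof -
  have gm: "(\<lambda>F. emeasure lborel {y. F \<inter> ball (x - y) 1 \<noteq> {}}) \<in> borel_measurable (fell_borel :: (real^2) set measure)"
    by (rule fell_emeasure_measurable) (rule fell_pred)
  \<comment> \<open>The term \<open>1 / r0\<close> absorbs the unit ball: since
    \<open>1 \<le> R w / r0\<close>, a leaf coming within distance 1 of \<open>x\<close> has its
    position within \<open>R w * k\<close> of \<open>x\<close>.\<close>
  define k where "k = a2 + 1 / r0"
  have k: "0 < k" using a_pos r0 by (simp add: k_def add_pos_pos)
  define v where "v = unit_ball_vol 2 * k ^ 2"
  have v: "0 \<le> v" by (simp add: v_def)
  have "(\<integral>\<^sup>+F. emeasure lborel {y. F \<inter> ball (x - y) 1 \<noteq> {}} \<partial>leaf_law) =
    (\<integral>\<^sup>+w. emeasure lborel {y. (*\<^sub>R) (R w) ` Y w \<inter> ball (x - y) 1 \<noteq> {}} \<partial>P)"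
    by (rule nn_integral_leaf[OF gm])
  also have "\<dots> \<le> (\<integral>\<^sup>+w. ennreal (v * (R w)\<^sup>2) \<partial>P)"
  proof (rule nn_integral_mono_AE, use AE_R bounds in eventually_elim)
    case (elim w)
    have Rp: "0 < R w" "r0 \<le> R w" using elim(1) r0 by auto
    have "{y. (*\<^sub>R) (R w) ` Y w \<inter> ball (x - y) 1 \<noteq> {}} \<subseteq> cball x (R w * k)"
    proof
      fix y assume "y \<in> {y. (*\<^sub>R) (R w) ` Y w \<inter> ball (x - y) 1 \<noteq> {}}"
      then obtain z where z: "z \<in> Y w" "R w *\<^sub>R z \<in> ball (x - y) 1" by blast
      have "norm z \<le> a2" using z elim(2) by auto
      then have "norm (R w *\<^sub>R z) \<le> R w * a2" using Rp by simp
      moreover have "norm (x - y - R w *\<^sub>R z) < 1" using z(2) by (simp add: dist_norm)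
      moreover have "norm (x - y) \<le> norm (x - y - R w *\<^sub>R z) + norm (R w *\<^sub>R z)"
        using norm_triangle_sub[of "x - y" "R w *\<^sub>R z"] by simp
      moreover have "1 \<le> R w * (1 / r0)" using Rp r0 by (simp add: field_simps)
      ultimately have "norm (x - y) \<le> R w * k" by (simp add: k_def distrib_left)
      then show "y \<in> cball x (R w * k)" by (simp add: dist_norm)
    qed
    then have "emeasure lborel {y. (*\<^sub>R) (R w) ` Y w \<inter> ball (x - y) 1 \<noteq> {}} \<le> emeasure lborel (cball x (R w * k))"
      by (rule emeasure_mono) simp
    also have "\<dots> = ennreal (v * (R w)\<^sup>2)"
      using Rp k by (simp add: emeasure_cball v_def power_mult_distrib mult_ac)
    finally show ?case .
  qed
  also have "\<dots> < \<infinity>"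
  proof (cases "r1 < \<infinity>")
    case True
    have "(\<integral>\<^sup>+w. ennreal (v * (R w)\<^sup>2) \<partial>P) \<le> (\<integral>\<^sup>+w. ennreal (v * (real_of_ereal r1)\<^sup>2) \<partial>P)"
    proof (rule nn_integral_mono_AE, use AE_R in eventually_elim)
      case (elim w)
      then have "R w \<le> real_of_ereal r1" using True by (cases r1) auto
      then show ?case using elim r0 v by (intro ennreal_leI mult_left_mono power_mono) auto
    qed
    also have "\<dots> < \<infinity>" by (simp add: emeasure_space_1)
    finally show ?thesis .
  next
    case False
    then have \<alpha>: "3 < \<alpha>" using tail by auto
    have "(\<integral>\<^sup>+w. ennreal (v * (R w)\<^sup>2) \<partial>P) =
      (\<integral>\<^sup>+r. ennreal (c * r powr (-\<alpha>) * indicator {r. r0 \<le> r \<and> ereal r \<le> r1} r) * ennreal (v * r\<^sup>2) \<partial>lborel)"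
      by (rule distributed_nn_integral[OF R_distributed, symmetric]) simp
    also have "\<dots> \<le> (\<integral>\<^sup>+r. ennreal (c * v) * (ennreal (r powr (2 - \<alpha>)) * indicator {r0..} r) \<partial>lborel)"
    proof (rule nn_integral_mono)
      fix r :: real
      show "ennreal (c * r powr (-\<alpha>) * indicator {r. r0 \<le> r \<and> ereal r \<le> r1} r) * ennreal (v * r\<^sup>2)
        \<le> ennreal (c * v) * (ennreal (r powr (2 - \<alpha>)) * indicator {r0..} r)"
      proof (cases "r0 \<le> r")
        case True
        then have r: "0 < r" using r0 by simp
        have "r powr (2 - \<alpha>) = r powr (-\<alpha>) * r\<^sup>2"
          using r powr_add[of r "-\<alpha>" 2] by (simp add: powr_numeral)
        then show ?thesis using True c v r
          by (auto simp: indicator_def ennreal_mult[symmetric] mult_ac)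
      qed simp
    qed
    also have "\<dots> = ennreal (c * v) * (\<integral>\<^sup>+r. ennreal (r powr (2 - \<alpha>)) * indicator {r0..} r \<partial>lborel)"
      by (rule nn_integral_cmult) measurable
    also have "(\<integral>\<^sup>+r. ennreal (r powr (2 - \<alpha>)) * indicator {r0..} r \<partial>lborel) = ennreal (0 - r0 powr (3 - \<alpha>) / (3 - \<alpha>))"
    proof (rule nn_integral_FTC_atLeast)
      show "((\<lambda>r. r powr (3 - \<alpha>) / (3 - \<alpha>)) has_real_derivative r powr (2 - \<alpha>)) (at r)" if "r0 \<le> r" for r
        using that r0 \<alpha> by (auto intro!: derivative_eq_intros)
      show "((\<lambda>r. r powr (3 - \<alpha>) / (3 - \<alpha>)) \<longlongrightarrow> 0) at_top"
      proof -
        have "((\<lambda>r::real. r powr (3 - \<alpha>)) \<longlongrightarrow> 0) at_top"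
          using \<alpha> by (intro tendsto_neg_powr filterlim_ident) auto
        from tendsto_divide[OF this tendsto_const[of "3 - \<alpha>"]] show ?thesis using \<alpha> by simp
      qed
    qed auto
    also have "ennreal (c * v) * ennreal (0 - r0 powr (3 - \<alpha>) / (3 - \<alpha>)) < \<infinity>"
      by (simp add: ennreal_mult_less_top)
    finally show ?thesis .
  qed
  finally show ?thesis .
qed

end

section \<open>Limits of the block probabilities\<close>

text \<open>Induction on \<open>U\<close>: every \<open>D\<close> is nonempty, so
  \<open>U - D\<close> is smaller and its limit is already known.\<close>

lemma recursion_limit:
  fixes g :: "'r \<Rightarrow> 's set \<Rightarrow> real"
  assumes S: "finite S" and U: "U \<subseteq> S"
    and \<D>: "\<And>U. \<D> U \<subseteq> Pow U - {{}}"
    and g0: "\<forall>\<^sub>F r in F. g r {} = 1"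
    and rec: "\<And>U. U \<subseteq> S \<Longrightarrow> U \<noteq> {} \<Longrightarrow> \<forall>\<^sub>F r in F. g r U = (\<Sum>D\<in>\<D> U. W r U D * g r (U - D))"
    and W: "\<And>U D. U \<subseteq> S \<Longrightarrow> U \<noteq> {} \<Longrightarrow> D \<in> \<D> U \<Longrightarrow> \<exists>l. ((\<lambda>r. W r U D) \<longlongrightarrow> l) F"
  shows "\<exists>l. ((\<lambda>r. g r U) \<longlongrightarrow> l) F"
proof -
  have "finite U" using U S by (rule finite_subset)
  then show ?thesis using U
  proof (induction U rule: finite_psubset_induct)
    case (psubset U)
    show ?case
    proof (cases "U = {}")
      case True
      have "((\<lambda>r. g r {}) \<longlongrightarrow> 1) F" using g0 by (rule tendsto_eventually)
      then show ?thesis using True by auto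
    next
      case False
      have "\<exists>l. ((\<lambda>r. W r U D * g r (U - D)) \<longlongrightarrow> l) F" if D: "D \<in> \<D> U" for D
      proof -
        obtain l where l: "((\<lambda>r. W r U D) \<longlongrightarrow> l) F" using W psubset.prems False D by blast
        have "U - D \<subset> U" using \<D>[of U] D by blast
        then obtain l' where "((\<lambda>r. g r (U - D)) \<longlongrightarrow> l') F" using psubset.IH psubset.prems by blast
        with l show ?thesis by (intro exI) (rule tendsto_mult)
      qed
      then obtain l where "\<And>D. D \<in> \<D> U \<Longrightarrow> ((\<lambda>r. W r U D * g r (U - D)) \<longlongrightarrow> l D) F" by metis
      then have "((\<lambda>r. \<Sum>D\<in>\<D> U. W r U D * g r (U - D)) \<longlongrightarrow> (\<Sum>D\<in>\<D> U. l D)) F" by (rule tendsto_sum)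
      then have "((\<lambda>r. g r U) \<longlongrightarrow> (\<Sum>D\<in>\<D> U. l D)) F"
        by (rule Lim_transform_eventually) (use rec[OF psubset.prems False] in eventually_elim, simp)
      then show ?thesis by blast
    qed
  qed
qed

text \<open>A monotone function converges or diverges to infinity. The bound
  \<open>u r \<le> l\<close> is recorded because it later keeps a denominator away from 0.\<close>

lemma antimono_at_right_limit:
  fixes u :: "real \<Rightarrow> real"
  assumes b: "0 < b" and mono: "\<And>r s. 0 < r \<Longrightarrow> r \<le> s \<Longrightarrow> s < b \<Longrightarrow> u s \<le> u r"
  shows "(\<exists>l. (u \<longlongrightarrow> l) (at_right 0) \<and> (\<forall>r. 0 < r \<longrightarrow> r < b \<longrightarrow> u r \<le> l)) \<or> filterlim u at_top (at_right 0)"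
proof (cases "bdd_above (u ` {0<..<b})")
  case True
  define l where "l = Sup (u ` {0<..<b})"
  have le: "u r \<le> l" if "0 < r" "r < b" for r
    unfolding l_def using that True by (intro cSup_upper) auto
  have "(u \<longlongrightarrow> l) (at_right 0)"
  proof (rule order_tendstoI)
    fix y assume "y < l"
    then obtain s where s: "0 < s" "s < b" "y < u s"
      using less_cSup_iff[of "u ` {0<..<b}" y] True b unfolding l_def by auto
    have "\<forall>\<^sub>F r in at_right 0. r < s \<and> 0 < r"
      using s by (auto simp: eventually_at_right intro: exI[of _ s])
    then show "\<forall>\<^sub>F r in at_right 0. y < u r"
      by eventually_elim (use mono[of _ s] s in \<open>auto intro: less_le_trans\<close>)
  next
    fix y assume "l < y"
    have "\<forall>\<^sub>F r in at_right 0. r < b \<and> 0 < r"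
      using b by (auto simp: eventually_at_right intro: exI[of _ b])
    then show "\<forall>\<^sub>F r in at_right 0. u r < y"
      by eventually_elim (use le \<open>l < y\<close> in \<open>auto intro: le_less_trans\<close>)
  qed
  then show ?thesis using le by blast
next
  case False
  have "filterlim u at_top (at_right 0)"
    unfolding filterlim_at_top
  proof
    fix Z :: real
    obtain s where "s \<in> {0<..<b}" "Z < u s"
      using False unfolding bdd_above_def by (metis image_iff not_le)
    then have s: "0 < s" "s < b" "Z < u s" by auto
    have "\<forall>\<^sub>F r in at_right 0. r < s \<and> 0 < r"
      using s by (auto simp: eventually_at_right intro: exI[of _ s])
    then show "\<forall>\<^sub>F r in at_right 0. Z \<le> u r"
    proof eventually_elim
      case (elim r)
      then show ?case using mono[of r s] s by simp
    qed
  qed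
  then show ?thesis by blast
qed

text \<open>Covers both regimes at once: for \<open>\<alpha> < 3\<close> the contribution \<open>u\<close> of the small leaves converges, for
  \<open>\<alpha> \<ge> 3\<close> it diverges.\<close>

lemma affine_ratio_limit:
  fixes u :: "real \<Rightarrow> real" and A B A' B' :: real
  assumes b: "0 < b" and mono: "\<And>r s. 0 < r \<Longrightarrow> r \<le> s \<Longrightarrow> s < b \<Longrightarrow> u s \<le> u r"
    and B': "0 < B'" and pos: "\<And>r. 0 < r \<Longrightarrow> r < b \<Longrightarrow> 0 < A' + B' * u r"
  shows "\<exists>l. ((\<lambda>r. (A + B * u r) / (A' + B' * u r)) \<longlongrightarrow> l) (at_right 0)"
proof -
  have "(\<exists>l. (u \<longlongrightarrow> l) (at_right 0) \<and> (\<forall>r. 0 < r \<longrightarrow> r < b \<longrightarrow> u r \<le> l)) \<or> filterlim u at_top (at_right 0)"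
    by (rule antimono_at_right_limit[OF b]) (rule mono)
  then show ?thesis
  proof (elim disjE exE conjE)
    fix l assume l: "(u \<longlongrightarrow> l) (at_right 0)" "\<forall>r. 0 < r \<longrightarrow> r < b \<longrightarrow> u r \<le> l"
    \<comment> \<open>The denominator is positive at \<open>b / 2\<close>, and replacing
      \<open>u (b / 2)\<close> by \<open>l\<close> can only increase it.\<close>
    have "u (b / 2) \<le> l" using l b by auto
    then have "B' * u (b / 2) \<le> B' * l" using B' by simp
    moreover have "0 < A' + B' * u (b / 2)" using b by (intro pos) auto
    ultimately have "A' + B' * l \<noteq> 0" by linarith
    then have "((\<lambda>r. (A + B * u r) / (A' + B' * u r)) \<longlongrightarrow> (A + B * l) / (A' + B' * l)) (at_right 0)"
      by (intro tendsto_intros l(1))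
    then show ?thesis by blast
  next
    assume u: "filterlim u at_top (at_right 0)"
    have "((\<lambda>r. inverse (u r)) \<longlongrightarrow> 0) (at_right 0)"
      by (rule tendsto_inverse_0_at_top[OF u])
    then have "((\<lambda>r. (A * inverse (u r) + B) / (A' * inverse (u r) + B')) \<longlongrightarrow> (A * 0 + B) / (A' * 0 + B')) (at_right 0)"
      using B' by (intro tendsto_intros) auto
    moreover have "\<forall>\<^sub>F r in at_right 0. (A * inverse (u r) + B) / (A' * inverse (u r) + B') = (A + B * u r) / (A' + B' * u r)"
    proof -
      have "\<forall>\<^sub>F r in at_right 0. 0 < u r" using u by (simp add: filterlim_at_top_dense)
      then show ?thesis
      proof eventually_elim
        case (elim r)
        then have "(A * inverse (u r) + B) * u r = A + B * u r" "(A' * inverse (u r) + B') * u r = A' + B' * u r"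
          by (simp_all add: distrib_right)
        then show ?case using elim by (metis mult_divide_mult_cancel_right order_less_irrefl)
      qed
    qed
    ultimately show ?thesis by (blast intro: Lim_transform_eventually)
  qed
qed

text \<open>The contribution of the radii in \<open>J\<close> to the intensity of the leaves with
  trace \<open>B\<close>, before normalization. The cutoff can enter only through
  \<open>J\<close>.\<close>

definition grain_weight :: "'p measure \<Rightarrow> ('p \<Rightarrow> (real^2) set) \<Rightarrow> real \<Rightarrow> (real^2) set \<Rightarrow> (real^2) set \<Rightarrow>
    real set \<Rightarrow> ennreal" where
  "grain_weight P Y \<alpha> S B J = (\<integral>\<^sup>+r. ennreal (r powr (-\<alpha>)) * indicator J r *
     (\<integral>\<^sup>+w. emeasure lborel {y. trace_of S ((*\<^sub>R) r ` Y w) y = B} \<partial>P) \<partial>lborel)"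

text \<open>The same contribution for a single point that is covered alone: by translation
  invariance it is a mean area, whichever the point.\<close>

definition small_weight :: "'p measure \<Rightarrow> ('p \<Rightarrow> (real^2) set) \<Rightarrow> real \<Rightarrow> real set \<Rightarrow> ennreal" where
  "small_weight P Y \<alpha> J = (\<integral>\<^sup>+r. ennreal (r powr (-\<alpha>)) * indicator J r *
     (\<integral>\<^sup>+w. emeasure lborel ((*\<^sub>R) r ` Y w) \<partial>P) \<partial>lborel)"

lemma small_weight_mono: "J \<subseteq> J' \<Longrightarrow> small_weight P Y \<alpha> J \<le> small_weight P Y \<alpha> J'"
  unfolding small_weight_def
  by (intro nn_integral_mono mult_right_mono mult_left_mono) (auto simp: indicator_def)

context typical_grain
begin

lemma trace_weight_measurable:
  assumes "finite S"
  shows "(\<lambda>r. \<integral>\<^sup>+w. emeasure lborel {y. trace_of S ((*\<^sub>R) r ` Y w) y = B} \<partial>P) \<in> borel_measurable borel"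
proof -
  let ?g = "\<lambda>F. emeasure lborel {y. trace_of S F y = B}"
  have "(\<lambda>z. (*\<^sub>R) (fst z) ` Y (snd z)) \<in> measurable (borel \<Otimes>\<^sub>M P) fell_borel"
    by (rule measurable_fell_scaleR) measurable
  from measurable_compose[OF this trace_of_measurable[OF assms, of B]]
  have "(\<lambda>(r, w). ?g ((*\<^sub>R) r ` Y w)) \<in> borel_measurable (borel \<Otimes>\<^sub>M P)" by (simp add: case_prod_unfold)
  then show ?thesis by (rule borel_measurable_nn_integral)
qed

lemma grain_weight_Un:
  assumes "finite S" and [measurable]: "J \<in> sets borel" "J' \<in> sets borel" and "J \<inter> J' = {}"
  shows "grain_weight P Y \<alpha> S B (J \<union> J') = grain_weight P Y \<alpha> S B J + grain_weight P Y \<alpha> S B J'"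
proof -
  note [measurable] = trace_weight_measurable[OF assms(1), of B]
  have "indicator (J \<union> J') r = (indicator J r + indicator J' r :: ennreal)" for r
    using assms(4) by (auto simp: indicator_def)
  then show ?thesis
    unfolding grain_weight_def
    by (subst nn_integral_add[symmetric]) (auto simp: distrib_left distrib_right)
qed

text \<open>A leaf of small radius covers at most one point of \<open>S\<close>.\<close>

lemma grain_weight_small:
  assumes S: "finite S" and sep: "\<And>x x'. x \<in> S \<Longrightarrow> x' \<in> S \<Longrightarrow> x \<noteq> x' \<Longrightarrow> 2 * b * a2 < dist x x'"
    and J: "J \<subseteq> {0<..<b}" and B: "B \<subseteq> S" "B \<noteq> {}"
  shows "grain_weight P Y \<alpha> S B J = (if card B = 1 then small_weight P Y \<alpha> J else 0)"
proof -
  have one: "x = x'" if w: "Y w \<subseteq> cball 0 a2" and r: "0 < r" "r < b"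
    and x: "x \<in> S" "x' \<in> S" "x - y \<in> (*\<^sub>R) r ` Y w" "x' - y \<in> (*\<^sub>R) r ` Y w" for w r x x' y
  proof (rule ccontr)
    assume "x \<noteq> x'"
    have le: "norm (z - y) \<le> r * a2" if z: "z - y \<in> (*\<^sub>R) r ` Y w" for z
    proof -
      obtain v where v: "v \<in> Y w" "z - y = r *\<^sub>R v" using z by auto
      then have "norm v \<le> a2" using w by auto
      then show ?thesis using v r by simp
    qed
    have "dist x x' \<le> norm (x - y) + norm (x' - y)"
      using norm_triangle_ineq4[of "x - y" "x' - y"] by (simp add: dist_norm)
    also have "\<dots> \<le> 2 * r * a2" using le[OF x(3)] le[OF x(4)] by simp
    also have "\<dots> \<le> 2 * b * a2" using r a_pos by simp
    finally show False using sep[OF x(1,2) \<open>x \<noteq> x'\<close>] by simp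
  qed
  have inner: "(\<integral>\<^sup>+w. emeasure lborel {y. trace_of S ((*\<^sub>R) r ` Y w) y = B} \<partial>P) =
     (if card B = 1 then (\<integral>\<^sup>+w. emeasure lborel ((*\<^sub>R) r ` Y w) \<partial>P) else 0)" if r: "0 < r" "r < b" for r
  proof (cases "card B = 1")
    case True
    then obtain x where x: "B = {x}" "x \<in> S" using B by (auto simp: card_1_singleton_iff)
    have "(\<integral>\<^sup>+w. emeasure lborel {y. trace_of S ((*\<^sub>R) r ` Y w) y = B} \<partial>P) = (\<integral>\<^sup>+w. emeasure lborel ((*\<^sub>R) r ` Y w) \<partial>P)"
    proof (rule nn_integral_cong_AE, use bounds AE_space in eventually_elim)
      case (elim w)
      have "trace_of S ((*\<^sub>R) r ` Y w) y = B \<longleftrightarrow> x - y \<in> (*\<^sub>R) r ` Y w" for y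
        using one[of w r x _ y] elim r x by (auto simp: trace_of_def)
      moreover have "closed ((*\<^sub>R) r ` Y w)"
        using closed_scaling fell_closed[OF Y_measurable elim(2)] by blast
      ultimately show ?case
        using emeasure_lborel_reflect[of "(*\<^sub>R) r ` Y w" x] by simp
    qed
    then show ?thesis using True by simp
  next
    case False
    obtain x where x: "x \<in> B" using B by auto
    have "B \<noteq> {x}" using False by auto
    then obtain x' where x': "x' \<in> B" "x' \<noteq> x" using x by auto
    have "(\<integral>\<^sup>+w. emeasure lborel {y. trace_of S ((*\<^sub>R) r ` Y w) y = B} \<partial>P) = (\<integral>\<^sup>+w. 0 \<partial>P)"
    proof (rule nn_integral_cong_AE, use bounds in eventually_elim)
      case (elim w)
      have "trace_of S ((*\<^sub>R) r ` Y w) y \<noteq> B" for y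
      proof
        assume "trace_of S ((*\<^sub>R) r ` Y w) y = B"
        then have "x - y \<in> (*\<^sub>R) r ` Y w" "x' - y \<in> (*\<^sub>R) r ` Y w" "x \<in> S" "x' \<in> S"
          using x x' by (auto simp: trace_of_def)
        then show False using one[of w r x x' y] elim r x' by blast
      qed
      then show ?case by simp
    qed
    then show ?thesis using False by simp
  qed
  have "grain_weight P Y \<alpha> S B J = (\<integral>\<^sup>+r. ennreal (r powr (-\<alpha>)) * indicator J r *
     (if card B = 1 then (\<integral>\<^sup>+w. emeasure lborel ((*\<^sub>R) r ` Y w) \<partial>P) else 0) \<partial>lborel)"
    unfolding grain_weight_def
  proof (rule nn_integral_cong)
    fix r
    show "ennreal (r powr (-\<alpha>)) * indicator J r * (\<integral>\<^sup>+w. emeasure lborel {y. trace_of S ((*\<^sub>R) r ` Y w) y = B} \<partial>P) =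
      ennreal (r powr (-\<alpha>)) * indicator J r * (if card B = 1 then (\<integral>\<^sup>+w. emeasure lborel ((*\<^sub>R) r ` Y w) \<partial>P) else 0)"
    proof (cases "r \<in> J")
      case True
      then have "0 < r" "r < b" using J by auto
      then show ?thesis by (simp only: inner)
    qed simp
  qed
  then show ?thesis by (simp add: small_weight_def)
qed

end

lemma (in scaled_grain) nn_integral_leaf_trace:
  assumes "finite S"
  shows "(\<integral>\<^sup>+F. emeasure lborel {y. trace_of S F y = B} \<partial>leaf_law) =
    ennreal c * grain_weight P Y \<alpha> S B {r. r0 \<le> r \<and> ereal r \<le> r1}"
proof -
  let ?J = "{r. r0 \<le> r \<and> ereal r \<le> r1}"
  note [measurable] = trace_weight_measurable[OF assms, of B]
  have "(\<integral>\<^sup>+F. emeasure lborel {y. trace_of S F y = B} \<partial>leaf_law) =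
    (\<integral>\<^sup>+r. ennreal (c * r powr (-\<alpha>) * indicator ?J r) *
      (\<integral>\<^sup>+w. emeasure lborel {y. trace_of S ((*\<^sub>R) r ` Y w) y = B} \<partial>P) \<partial>lborel)"
    by (rule nn_integral_leaf_density(2)[OF trace_of_measurable[OF assms]])
  also have "\<dots> = (\<integral>\<^sup>+r. ennreal c * (ennreal (r powr (-\<alpha>)) * indicator ?J r *
      (\<integral>\<^sup>+w. emeasure lborel {y. trace_of S ((*\<^sub>R) r ` Y w) y = B} \<partial>P)) \<partial>lborel)"
    using c by (intro nn_integral_cong) (auto simp: indicator_def ennreal_mult mult_ac)
  also have "\<dots> = ennreal c * grain_weight P Y \<alpha> S B ?J"
    unfolding grain_weight_def by (rule nn_integral_cmult) measurable
  finally show ?thesis .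
qed

lemma (in dead_leaves) m_trace: "m B = enn2real (\<integral>\<^sup>+F. emeasure lborel {y. trace_of S F y = B} \<partial>L)"
  unfolding m_def intensity_def
  by (intro arg_cong[where f = enn2real] nn_integral_cong arg_cong[where f = "emeasure lborel"])
     (auto simp: typed_def trace_of_def space_pair_measure space_L)

lemma (in dead_leaves) trace_finite:
  assumes "B \<noteq> {}"
  shows "(\<integral>\<^sup>+F. emeasure lborel {y. trace_of S F y = B} \<partial>L) < \<infinity>"
proof -
  have "(\<integral>\<^sup>+F. emeasure lborel {y. trace_of S F y = B} \<partial>L) = intensity (typed B)"
    unfolding intensity_def
    by (intro nn_integral_cong arg_cong[where f = "emeasure lborel"])
       (auto simp: typed_def trace_of_def space_pair_measure space_L)
  then show ?thesis using intensity_typed_finite[OF assms] by simp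
qed

text \<open>Determined by \<open>K\<close> and \<open>U\<close> alone, so the recursion has the same
  shape for all \<open>r0\<close>.\<close>

definition blocks :: "('s \<times> 's) set \<Rightarrow> 's set \<Rightarrow> 's set set" where
  "blocks K U = {D. D \<subseteq> U \<and> D \<noteq> {} \<and> type_process.block K U D}"

context dead_leaves
begin

lemma prob_good_empty: "prob (T.good K 0 {}) = 1"
  by (simp add: T.good_def prob_space)

lemma prob_good_blocks:
  assumes "U \<subseteq> S" "U \<noteq> {}"
  shows "prob (T.good K 0 U) = (\<Sum>D\<in>blocks K U. T.trace_rate U D / T.rate U * prob (T.good K 0 (U - D)))"
  unfolding blocks_def by (rule T.prob_good_recursion[OF rate_pos assms])

lemma rate_pos_nonempty:
  assumes "U \<subseteq> S" "U \<noteq> {}"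
  shows "0 < T.rate U"
proof -
  obtain x where "x \<in> U" using assms by auto
  then show ?thesis using rate_pos[of x] T.rate_mono[of "{x}" U] assms by fastforce
qed

lemma prob_kernel:
  assumes "{w \<in> space \<Omega>. has_kernel S K (\<lambda>x. visible_index (visible_part p X) x w)} \<in> sets \<Omega>"
  shows "prob {w \<in> space \<Omega>. has_kernel S K (\<lambda>x. visible_index (visible_part p X) x w)} = prob (T.good K 0 S)"
proof (rule finite_measure_eq_AE)
  show "T.good K 0 S \<in> sets \<Omega>" using T.good_window[of S K 0] T.window_algebra_events by blast
  show "AE w in \<Omega>. (w \<in> {w \<in> space \<Omega>. has_kernel S K (\<lambda>x. visible_index (visible_part p X) x w)}) =
      (w \<in> T.good K 0 S)"
    using AE_kernel[of K] by eventually_elim (auto simp: has_kernel_def T.good_def)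
qed (rule assms)

end

theorem proposition11:
  fixes \<alpha> a1 a2 :: real and r1 :: ereal
    and P :: "'p measure" and Y :: "'p \<Rightarrow> (real^2) set" and R :: "real \<Rightarrow> 'p \<Rightarrow> real"
    and Q :: "'q measure" and C0 :: "real^2 \<Rightarrow> 'q \<Rightarrow> real"
    and \<Omega> :: "real \<Rightarrow> 'w measure"
    and p :: "real \<Rightarrow> nat \<Rightarrow> 'w \<Rightarrow> (real^2) \<times> real"
    and X :: "real \<Rightarrow> nat \<Rightarrow> 'w \<Rightarrow> (real^2) set"
    and C :: "real \<Rightarrow> nat \<Rightarrow> real^2 \<Rightarrow> 'w \<Rightarrow> real"
  assumes "(1 < \<alpha> \<and> \<alpha> \<le> 3 \<and> 0 < r1 \<and> r1 < \<infinity>) \<or> (3 < \<alpha> \<and> 0 < r1)"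
    and "random_compact_set P Y"
    and "0 < a1" and "a1 < a2"
    and "AE w in P. cball 0 a1 \<subseteq> Y w \<and> Y w \<subseteq> cball 0 a2"
    and "AE w in P. emeasure lborel (frontier (Y w)) = 0"
    and "random_field Q C0"
    and "\<And>r0. 0 < r0 \<Longrightarrow> ereal r0 < r1 \<Longrightarrow> power_law_radius P \<alpha> r0 r1 (R r0)"
    and "\<And>r0. 0 < r0 \<Longrightarrow> ereal r0 < r1 \<Longrightarrow> indep_rv P borel (R r0) fell_borel Y"
    and "\<And>r0. 0 < r0 \<Longrightarrow> ereal r0 < r1 \<Longrightarrow>
           marked_leaves (\<Omega> r0) (distr P fell_borel (\<lambda>w. (*\<^sub>R) (R r0 w) ` Y w)) (p r0) (X r0)"
    and "\<And>r0. 0 < r0 \<Longrightarrow> ereal r0 < r1 \<Longrightarrow>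
           color_copies (\<Omega> r0) (field_law Q C0) (visible_part (p r0) (X r0)) (C r0)"
  shows "\<exists>(\<Omega>0 :: (real^2 \<Rightarrow> real) measure) (I0 :: real^2 \<Rightarrow> (real^2 \<Rightarrow> real) \<Rightarrow> real).
           fdd_converges \<Omega> (\<lambda>r0. colored_dead_leaves (visible_part (p r0) (X r0)) (C r0))
             \<Omega>0 I0 (at_right 0)"
proof -
  have r1: "0 < r1" and tail: "r1 < \<infinity> \<or> 3 < \<alpha>" using assms(1) by auto
  obtain b0 where b0: "0 < b0" "ereal b0 < r1" using ereal_dense2[OF r1] by auto
  have ev_below: "\<forall>\<^sub>F r in at_right 0. 0 < r \<and> r < b" if "0 < b" for b :: real
    using that by (auto simp: eventually_at_right intro: exI[of _ b])
  interpret Y: typical_grain P Y a1 a2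
    using assms(2-6) by (intro typical_grain.intro typical_grain_axioms.intro) (auto simp: random_compact_set_def)
  let ?L = "\<lambda>r0. distr P fell_borel (\<lambda>w. (*\<^sub>R) (R r0 w) ` Y w)"
  let ?V = "\<lambda>r0. visible_part (p r0) (X r0)"
  have "\<exists>c. scaled_grain P Y a1 a2 \<alpha> r0 c r1 (R r0)" if r: "0 < r0" "ereal r0 < r1" for r0
  proof -
    obtain c where "c > 0" "distributed P lborel (R r0)
        (\<lambda>r. ennreal (c * r powr (-\<alpha>) * indicator {r. r0 \<le> r \<and> ereal r \<le> r1} r))"
      using assms(8)[OF r] by (auto simp: power_law_radius_def)
    then have "scaled_grain P Y a1 a2 \<alpha> r0 c r1 (R r0)"
      using r tail assms(9)[OF r]
      by (intro scaled_grain.intro scaled_grain_axioms.intro Y.typical_grain_axioms) auto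
    then show ?thesis ..
  qed
  then obtain c where sg: "\<And>r0. 0 < r0 \<Longrightarrow> ereal r0 < r1 \<Longrightarrow> scaled_grain P Y a1 a2 \<alpha> r0 (c r0) r1 (R r0)"
    by metis
  have LL: "scaled_grain.leaf_law P Y (R r0) = ?L r0" if "0 < r0" "ereal r0 < r1" for r0
    by (rule scaled_grain.leaf_law_def[OF sg[OF that]])
  have dl: "dead_leaves (\<Omega> r0) (p r0) (X r0) (?L r0) S" if r0: "0 < r0" "ereal r0 < r1" and S: "finite S" for r0 S
    using scaled_grain.leaf_hit_finite[OF sg[OF r0]] scaled_grain.leaf_frontier_null[OF sg[OF r0]]
      scaled_grain.leaf_cover_pos[OF sg[OF r0]] assms(10)[OF r0] S
    unfolding LL[OF r0] by (intro dead_leaves.intro) auto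
  have cl: "colored_leaves (\<Omega> r0) (field_law Q C0) (?V r0) (C r0)" if r0: "0 < r0" "ereal r0 < r1" for r0
    using assms(10,11)[OF r0]
    by (intro colored_leaves.intro colored_leaves_axioms.intro) (auto simp: marked_leaves_def poisson_process_def)
  have law: "prob_space (field_law Q C0)" "sets (field_law Q C0) = sets field_space"
    using colored_leaves.prob_space_law[OF cl[OF b0]] colored_leaves.sets_law[OF cl[OF b0]] by auto
  define q where "q r S K = measure (\<Omega> r) {w \<in> space (\<Omega> r). has_kernel S K (\<lambda>x. visible_index (?V r) x w)}" for r S K
  have ev: "\<forall>\<^sub>F r in at_right 0. 0 < r \<and> ereal r < r1"
    using ev_below[OF b0(1)] by eventually_elim (use b0(2) in \<open>auto intro: less_trans[where y = "ereal b0"]\<close>)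
  show ?thesis
  proof (rule fdd_converges_of_kernel_weights[where q = q, OF _ law])
    show "at_right (0 :: real) \<noteq> bot" by simp
    show "\<forall>\<^sub>F r in at_right 0. random_field (\<Omega> r) (colored_dead_leaves (?V r) (C r))"
      using ev by eventually_elim (auto intro: colored_leaves.random_field_colored[OF cl])
    show "0 \<le> q r S K" for r S K by (simp add: q_def)
  next
    fix S :: "(real^2) set" and f :: "(real^2 \<Rightarrow> real) \<Rightarrow> real" and B :: real
    assume S: "finite S" and f: "f \<in> borel_measurable (Pi\<^sub>M S (\<lambda>_. borel))"
      "\<And>v. v \<in> space (Pi\<^sub>M S (\<lambda>_. borel)) \<Longrightarrow> \<bar>f v\<bar> \<le> B"
    show "\<forall>\<^sub>F r in at_right 0. (\<integral>w. f (\<lambda>x\<in>S. colored_dead_leaves (?V r) (C r) x w) \<partial>\<Omega> r) =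
        (\<Sum>K\<in>Pow (S \<times> S). q r S K * block_mean (field_law Q C0) S f K)"
      using ev
    proof eventually_elim
      case (elim r)
      interpret D: dead_leaves "\<Omega> r" "p r" "X r" "?L r" S using dl S elim by blast
      interpret CL: colored_leaves "\<Omega> r" "field_law Q C0" "?V r" "C r" using cl elim by blast
      have "AE w in \<Omega> r. \<forall>x\<in>S. x \<notin> model_boundary (?V r) w"
        using D.AE_kernel[of "{}"] by eventually_elim auto
      from CL.integral_colored[OF S this f] show ?case
        by (simp add: q_def CL.kernel_event_def)
    qed
  next
    fix S :: "(real^2) set" and K :: "((real^2) \<times> (real^2)) set"
    assume S: "finite S"
    \<comment> \<open>Quantities belonging to the model with cutoff \<open>r\<close> are written as
      functions of \<open>r\<close>, so that limits in \<open>r\<close> can be stated.\<close>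
    define t where "t r i w = snd (p r i w)" for r i w
    define ty where "ty r i w = {x \<in> S. covers (p r) (X r) i x w}" for r i w
    define g where "g r U = measure (\<Omega> r) (type_process.good (\<Omega> r) S (t r) (ty r) K 0 U)" for r U
    define rate where "rate r = type_process.rate S (dead_leaves.m (?L r) S)" for r
    define trate where "trate r = type_process.trace_rate S (dead_leaves.m (?L r) S)" for r
    have td: "t r = (\<lambda>i w. snd (p r i w))" "ty r = (\<lambda>i w. {x \<in> S. covers (p r) (X r) i x w})" for r
      by (simp_all add: fun_eq_iff t_def ty_def)
    have gq: "\<forall>\<^sub>F r in at_right 0. g r S = q r S K"
      using ev
    proof eventually_elim
      case (elim r)
      interpret D: dead_leaves "\<Omega> r" "p r" "X r" "?L r" S using dl S elim by blast
      interpret CL: colored_leaves "\<Omega> r" "field_law Q C0" "?V r" "C r" using cl elim by blast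
      show ?case
        using D.prob_kernel[of K] CL.kernel_event_sets[OF S, of K]
        by (simp add: g_def q_def td CL.kernel_event_def)
    qed
    obtain b where b: "0 < b" "ereal b < r1"
      "\<And>x x'. x \<in> S \<Longrightarrow> x' \<in> S \<Longrightarrow> x \<noteq> x' \<Longrightarrow> 2 * b * a2 < dist x x'"
    proof -
      \<comment> \<open>\<open>insert 1\<close> keeps the minimum meaningful when \<open>S\<close>
        has fewer than two points.\<close>
      define d where "d = Min (insert 1 ((\<lambda>(x, x'). dist x x') ` {z \<in> S \<times> S. fst z \<noteq> snd z}))"
      have fin: "finite ((\<lambda>(x, x'). dist x x') ` {z \<in> S \<times> S. fst z \<noteq> snd z})" using S by auto
      have d0: "0 < d" unfolding d_def using fin by (subst Min_gr_iff) auto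
      have d: "d \<le> dist x x'" if "x \<in> S" "x' \<in> S" "x \<noteq> x'" for x x'
        unfolding d_def using fin that by (intro Min_le) (auto intro!: image_eqI[of _ _ "(x, x')"])
      \<comment> \<open>The factor 4 gives \<open>2 * b * a2 \<le> d / 2\<close>, which is strictly
        below \<open>d\<close>.\<close>
      define b where "b = min b0 (d / (4 * a2))"
      have a2: "0 < a2" using assms(3,4) by simp
      have "0 < b" using b0 d0 a2 by (simp add: b_def)
      moreover have "ereal b < r1" using b0(2) by (rule le_less_trans[rotated]) (simp add: b_def)
      moreover have "2 * b * a2 < d"
      proof -
        have "b \<le> d / (4 * a2)" by (simp add: b_def)
        then have "b * (4 * a2) \<le> d" using a2 by (simp add: pos_le_divide_eq)
        then show ?thesis using \<open>0 < b\<close> a2 d0 by (simp add: algebra_simps)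
      qed
      ultimately show thesis using that d by (meson less_le_trans)
    qed
    let ?J = "\<lambda>r0. {r. r0 \<le> r \<and> ereal r \<le> r1}"
    \<comment> \<open>\<open>n B\<close> collects the radii from \<open>b\<close> on and does not
      involve the cutoff \<open>r\<close>; \<open>u r\<close> collects those from \<open>r\<close>
      up to \<open>b\<close>, which by the choice of \<open>b\<close> matter only for singletons,
      selected by \<open>e\<close>.\<close>
    define n where "n B = enn2real (grain_weight P Y \<alpha> S B (?J b))" for B
    define e where "e B = (if card B = 1 then 1 else 0 :: real)" for B :: "(real^2) set"
    define u where "u r = enn2real (small_weight P Y \<alpha> {r..<b})" for r
    have below: "ereal r < r1" if "r < b" for r
      using that by (intro less_trans[OF _ b(2)]) simp
    have split: "grain_weight P Y \<alpha> S B (?J r) = (if card B = 1 then small_weight P Y \<alpha> {r..<b} else 0) + grain_weight P Y \<alpha> S B (?J b)"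
      if r: "0 < r" "r < b" and B: "B \<subseteq> S" "B \<noteq> {}" for r B
    proof -
      have "?J r = {r..<b} \<union> ?J b" using r by (auto simp: not_less intro: less_imp_le[OF below])
      moreover have "{r..<b} \<inter> ?J b = {}" by auto
      ultimately have "grain_weight P Y \<alpha> S B (?J r) = grain_weight P Y \<alpha> S B {r..<b} + grain_weight P Y \<alpha> S B (?J b)"
        using Y.grain_weight_Un[OF S, of "{r..<b}" "?J b"] by simp
      also have "grain_weight P Y \<alpha> S B {r..<b} = (if card B = 1 then small_weight P Y \<alpha> {r..<b} else 0)"
        using r by (intro Y.grain_weight_small[OF S b(3)] B) auto
      finally show ?thesis .
    qed
    \<comment> \<open>Inherited from the model with cutoff \<open>r\<close>, whose intensities for
      nonempty traces are finite, by dividing by \<open>c r\<close>.\<close>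
    have fin: "grain_weight P Y \<alpha> S B (?J r) < \<infinity>" if r: "0 < r" "r < b" and B: "B \<noteq> {}" for r B
    proof -
      have r': "ereal r < r1" using below r by blast
      have "c r > 0" using scaled_grain.c[OF sg[OF r(1) r']] .
      moreover have "ennreal (c r) * grain_weight P Y \<alpha> S B (?J r) < \<infinity>"
        using dead_leaves.trace_finite[OF dl[OF r(1) r' S] B]
          scaled_grain.nn_integral_leaf_trace[OF sg[OF r(1) r'] S, of B] by (simp add: LL[OF r(1) r'])
      ultimately show ?thesis by (auto simp: ennreal_mult_less_top)
    qed
    have ufin: "small_weight P Y \<alpha> {r..<b} < \<infinity>" if r: "0 < r" "r < b" and Sne: "S \<noteq> {}" for r
    proof -
      obtain x where "x \<in> S" using Sne by auto
      then show ?thesis using split[OF r, of "{x}"] fin[OF r, of "{x}"] by auto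
    qed
    have mB: "dead_leaves.m (?L r) S B = c r * (n B + e B * u r)" if r: "0 < r" "r < b" and B: "B \<subseteq> S" "B \<noteq> {}" for r B
    proof -
      have r': "ereal r < r1" using below r by blast
      have "S \<noteq> {}" using B by auto
      have c0: "0 < c r" using scaled_grain.c[OF sg[OF r(1) r']] .
      have "dead_leaves.m (?L r) S B = enn2real (ennreal (c r) * grain_weight P Y \<alpha> S B (?J r))"
        unfolding dead_leaves.m_trace[OF dl[OF r(1) r' S]]
        using scaled_grain.nn_integral_leaf_trace[OF sg[OF r(1) r'] S, of B] by (simp add: LL[OF r(1) r'])
      also have "\<dots> = c r * enn2real (grain_weight P Y \<alpha> S B (?J r))"
        using c0 by (simp add: enn2real_mult)
      also have "enn2real (grain_weight P Y \<alpha> S B (?J r)) = n B + e B * u r"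
        using split[OF r B] fin[OF r B(2)] ufin[OF r \<open>S \<noteq> {}\<close>]
        by (auto simp: n_def e_def u_def enn2real_plus)
      finally show ?thesis .
    qed
    have umono: "u s \<le> u r" if "0 < r" "r \<le> s" "s < b" "S \<noteq> {}" for r s
      unfolding u_def using that ufin[of r] by (intro enn2real_mono small_weight_mono) auto
    have "\<exists>l. ((\<lambda>r. g r S) \<longlongrightarrow> l) (at_right 0)"
    proof (rule recursion_limit[where \<D> = "blocks K" and W = "\<lambda>r U D. trate r U D / rate r U", OF S subset_refl])
      show "blocks K U \<subseteq> Pow U - {{}}" for U by (auto simp: blocks_def)
      show "\<forall>\<^sub>F r in at_right 0. g r {} = 1"
        using ev
      proof eventually_elim
        case (elim r)
        then show ?case
          using dead_leaves.prob_good_empty[OF dl[OF _ _ S], of r K] by (simp add: g_def td)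
      qed
    next
      fix U assume U: "U \<subseteq> S" "U \<noteq> {}"
      show "\<forall>\<^sub>F r in at_right 0. g r U = (\<Sum>D\<in>blocks K U. trate r U D / rate r U * g r (U - D))"
        using ev
      proof eventually_elim
        case (elim r)
        then show ?case
          using dead_leaves.prob_good_blocks[OF dl[OF _ _ S] U, of r K] by (simp add: g_def td rate_def trate_def)
      qed
    next
      fix U D assume U: "U \<subseteq> S" "U \<noteq> {}" and D: "D \<in> blocks K U"
      have Sne: "S \<noteq> {}" using U by auto
      define H where "H = {B \<in> Pow S. B \<inter> U \<noteq> {}}"
      define Tr where "Tr = {B \<in> Pow S. B \<inter> U = D}"
      have H: "finite H" "finite Tr" "\<And>B. B \<in> H \<Longrightarrow> B \<subseteq> S \<and> B \<noteq> {}" "\<And>B. B \<in> Tr \<Longrightarrow> B \<subseteq> S \<and> B \<noteq> {}"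
        using S D by (auto simp: H_def Tr_def blocks_def)
      have rt: "rate r U = c r * ((\<Sum>B\<in>H. n B) + (\<Sum>B\<in>H. e B) * u r)"
        "trate r U D = c r * ((\<Sum>B\<in>Tr. n B) + (\<Sum>B\<in>Tr. e B) * u r)" "0 < rate r U" "0 < c r"
        if r: "0 < r" "r < b" for r
      proof -
        have r': "ereal r < r1" using below r by blast
        interpret D: dead_leaves "\<Omega> r" "p r" "X r" "?L r" S using dl[OF r(1) r' S] .
        have eq: "(\<Sum>B\<in>A. D.m B) = c r * ((\<Sum>B\<in>A. n B) + (\<Sum>B\<in>A. e B) * u r)"
          if "\<And>B. B \<in> A \<Longrightarrow> B \<subseteq> S \<and> B \<noteq> {}" for A
        proof -
          have "(\<Sum>B\<in>A. D.m B) = (\<Sum>B\<in>A. c r * (n B + e B * u r))"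
            using that by (intro sum.cong refl mB r) auto
          then show ?thesis by (simp add: sum_distrib_left sum_distrib_right sum.distrib distrib_left)
        qed
        show "rate r U = c r * ((\<Sum>B\<in>H. n B) + (\<Sum>B\<in>H. e B) * u r)"
          unfolding rate_def D.T.rate_def D.T.hits_def H_def[symmetric] by (rule eq) (rule H)
        show "trate r U D = c r * ((\<Sum>B\<in>Tr. n B) + (\<Sum>B\<in>Tr. e B) * u r)"
          unfolding trate_def D.T.trace_rate_def D.T.traces_def Tr_def[symmetric] by (rule eq) (rule H)
        show "0 < rate r U" unfolding rate_def by (rule D.rate_pos_nonempty[OF U])
        show "0 < c r" using scaled_grain.c[OF sg[OF r(1) r']] .
      qed
      obtain x where x: "x \<in> U" using U by auto
      \<comment> \<open>A singleton trace hits \<open>U\<close>, so \<open>u\<close> enters the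
        denominator with a positive coefficient; this gives a finite limit even if \<open>u\<close>
        diverges.\<close>
      have "{x} \<in> H" using x U by (auto simp: H_def)
      then have "e {x} \<le> (\<Sum>B\<in>H. e B)" using H by (intro member_le_sum) (auto simp: e_def)
      then have eH: "0 < (\<Sum>B\<in>H. e B)" by (simp add: e_def)
      have "\<exists>l. ((\<lambda>r. ((\<Sum>B\<in>Tr. n B) + (\<Sum>B\<in>Tr. e B) * u r) / ((\<Sum>B\<in>H. n B) + (\<Sum>B\<in>H. e B) * u r)) \<longlongrightarrow> l) (at_right 0)"
      proof (rule affine_ratio_limit[OF b(1) _ eH])
        show "u s \<le> u r" if "0 < r" "r \<le> s" "s < b" for r s using umono that Sne by blast
        show "0 < (\<Sum>B\<in>H. n B) + (\<Sum>B\<in>H. e B) * u r" if "0 < r" "r < b" for r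
          using rt(1,3,4)[OF that] by (simp add: zero_less_mult_iff)
      qed
      \<comment> \<open>The normalizing constant \<open>c r\<close> cancels in the ratio.\<close>
      moreover have "\<forall>\<^sub>F r in at_right 0. ((\<Sum>B\<in>Tr. n B) + (\<Sum>B\<in>Tr. e B) * u r) / ((\<Sum>B\<in>H. n B) + (\<Sum>B\<in>H. e B) * u r) =
          trate r U D / rate r U"
        using ev_below[OF b(1)]
      proof eventually_elim
        case (elim r)
        then show ?case using rt[of r] by simp
      qed
      ultimately show "\<exists>l. ((\<lambda>r. trate r U D / rate r U) \<longlongrightarrow> l) (at_right 0)"
        by (blast intro: Lim_transform_eventually)
    qed
    then show "\<exists>l. ((\<lambda>r. q r S K) \<longlongrightarrow> l) (at_right 0)"
      using gq by (blast intro: Lim_transform_eventually)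
  qed
qed

end
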